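(* Let $(M,[g],\mathbb{PQ})$ be a $(4n+3)$-dimensional pqc manifold with fixed $g\in[g]$, local data $(\eta_s,I_s)$, Reeb vector fields $\xi_1,\xi_2,\xi_3$, and canonical pqc connection $\nabla$ with torsion $T$, $T(A,B,C)=g(T(A,B),C)$, and connection 1-forms $\alpha_1,\alpha_2,\alpha_3$. Then, for all $s,t$, every cyclic permutation $(i,j,k)$ of $(1,2,3)$ and every horizontal $X$: $$T(\xi_t,\xi_s,X)=-\epsilon_i(\mathbb L_{\xi_t}\omega_i)(\xi_s,I_iX),\qquad T(\xi_i,\xi_j,\xi_i)=T(\xi_i,\xi_k,\xi_i)=0,$$ $$T(\xi_j,\xi_k,\xi_i)=T(\xi_k,\xi_i,\xi_j)=T(\xi_i,\xi_j,\xi_k)=-\lambda,$$ where the function $\lambda$ is given by $$\lambda=\frac1{2n}g((\mathbb L_{\xi_i}I_k)e_a,I_je_a)-\epsilon_id\eta_i(\xi_j,\xi_k)+\epsilon_jd\eta_j(\xi_k,\xi_i)+\epsilon_kd\eta_k(\xi_i,\xi_j).$$ The values of the connection 1-forms on the Reeb fields are $$\alpha_j(\xi_i)=-\epsilon_jd\eta_i(\xi_i,\xi_k),\qquad \alpha_k(\xi_i)=-d\eta_i(\xi_i,\xi_j),$$ $$\alpha_i(\xi_i)=\frac12\Big[\epsilon_kd\eta_i(\xi_j,\xi_k)+d\eta_j(\xi_k,\xi_i)-\epsilon_id\eta_k(\xi_i,\xi_j)-\epsilon_j\lambda\Big]=\frac{\epsilon_j}{4n}g((\mathbb L_{\xi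_i}I_k)I_je_a,e_a).$$
   Context: Put $\epsilon_1=\epsilon_2=1$, $\epsilon_3=-1$; $(i,j,k)$ denotes any cyclic permutation of $(1,2,3)$, $s,t\in\{1,2,3\}$; $X,Y,\dots$ denote horizontal vectors. Exterior derivative: $d\eta(A,B)=A\eta(B)-B\eta(A)-\eta([A,B])$. A pqc manifold $(M,[g],\mathbb{PQ})$ is a smooth $(4n+3)$-dimensional manifold $M$ with a codimension-three distribution $H$, a conformal class $[g]$ of metrics of signature $(2n,2n)$ on $H$, and a rank-three bundle $\mathbb{PQ}\subset\mathrm{End}(H)$ locally spanned by $I_1,I_2,I_3$ with $I_s^2=\epsilon_s\,\mathrm{id}_H$, $I_iI_j=-I_jI_i=-\epsilon_kI_k$, $g(I_s\cdot,I_s\cdot)=-\epsilon_s g$, and such that locally $H=\bigcap_s\ker\eta_s$ for 1-forms $\eta_s$ with $d\eta_s(X,Y)=-2\epsilon_s g(I_sX,Y)$ on $H$. With $g$ fixed, $(\eta_s,I_s)$ denotes such compatible local data; $\omega_s(X,Y)=g(I_sX,Y)$ on $H$, extended by zero when an argument is in $V$. Reeb vector fields: local $\xi_1,\xi_2,\xi_3$ with $\eta_s(\xi_t)=\delta_{st}$, $(\xi_s\lrcorner d\eta_s)_{|H}=0$, $(\xi_j\lrcorner d\eta_i)_{|H}=\epsilon_k(\xi_i\lrcorner d\eta_j)_{|H}$; they exist and are unique for $n>1$, and for $n=1$ their existence is part of the definition of a pqc structure. $V=\mathrm{span}\{\xi_1,\xi_2,\xi_3\}$, $TM=H\oplus V$,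 and $|H,|V$ are the projections. $g$ is extended to $M$ by $g=g_{|H}-\sum_s\epsilon_s\eta_s\otimes\eta_s$, $H\perp V$. The canonical pqc connection is the unique linear connection $\nabla$ preserving $H\oplus V$, $g$ and $\mathbb{PQ}$, with $T(X,Y)=-[X,Y]_{|V}$ for $X,Y\in H$, with $X\mapsto T(\xi,X)_{|H}$ in $(sp(n,\mathbb R)\oplus sp(1,\mathbb R))^\perp\subset\mathrm{End}(H)$ for $\xi\in V$, and with the map $V\to\mathbb{PQ}$, $\xi_s\mapsto I_s$, parallel. Here $sp(1,\mathbb R)=\mathrm{span}\{I_s\}$, $sp(n,\mathbb R)$ is the space of $g$-skew endomorphisms of $H$ commuting with all $I_s$, and $\langle A,B\rangle=\sum_ag(e_a,e_a)g(Ae_a,Be_a)$. $T(A,B)=\nabla_AB-\nabla_BA-[A,B]$. The connection 1-forms $\alpha_s$ are defined by $\nabla I_i=\alpha_jI_k+\epsilon_k\alpha_kI_j$, equivalently $\nabla\xi_i=\alpha_j\xi_k+\epsilon_k\alpha_k\xi_j$. Repeated $e_a$ means the $g$-trace over a $g$-orthonormal basis of $H$: $P(e_a,e_a)=\sum_a g(e_a,e_a)P(e_a,e_a)$. For horizontal $X$: $(\mathbb L_{\xi}I_s)X=[\xi,I_sX]_{|H}-I_s([\xi,X]_{|H})$. $\mathbb L$ is the Lie derivative. *)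

theory Defs
  imports "HOL-Analysis.Analysis" "HOL-Library.Function_Algebras"
begin

text \<open>Tangent vectors are functionals on real functions and endomorphisms are functions between
  tangent vectors; both live in function spaces with the pointwise linear structure.\<close>

instantiation "fun" :: (type, real_vector) real_vector
begin

definition "scaleR c f = (\<lambda>x. c *\<^sub>R f x)"

instance
  by standard (auto simp: scaleR_fun_def plus_fun_def scaleR_add_right scaleR_add_left)

end

definition lin_on :: "'v::real_vector set \<Rightarrow> ('v \<Rightarrow> 'w::real_vector) \<Rightarrow> bool" where
  "lin_on S f \<longleftrightarrow>
     (\<forall>u\<in>S. \<forall>v\<in>S. \<forall>a b. f (a *\<^sub>R u + b *\<^sub>R v) = a *\<^sub>R f u + b *\<^sub>R f v)"


section \<open>Smooth manifolds\<close>

text \<open>Meant for open sets: demanding differentiability and then recursing on the directional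
  derivatives is equivalent to the usual \<open>C\<^sup>k\<close>, since the directions range over a
  finite-dimensional space.\<close>

primrec Ck_on :: "nat \<Rightarrow> 'e::euclidean_space set \<Rightarrow> ('e \<Rightarrow> 'f::euclidean_space) \<Rightarrow> bool" where
  "Ck_on 0 S f = continuous_on S f"
| "Ck_on (Suc k) S f =
     ((\<forall>x\<in>S. f differentiable (at x)) \<and>
      (\<forall>v. Ck_on k S (\<lambda>x. frechet_derivative f (at x) v)))"

definition Cinf_on :: "'e::euclidean_space set \<Rightarrow> ('e \<Rightarrow> 'f::euclidean_space) \<Rightarrow> bool" where
  "Cinf_on S f \<longleftrightarrow> (\<forall>k. Ck_on k S f)"

type_synonym ('a, 'e) atlas = "('a set \<times> ('a \<Rightarrow> 'e)) set"

text \<open>The manifold is the whole type \<open>'a\<close>; Hausdorff and second countable are type classes.\<close>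

definition smooth_atlas ::
    "('a::{t2_space,second_countable_topology}, 'e::euclidean_space) atlas \<Rightarrow> bool" where
  "smooth_atlas \<A> \<longleftrightarrow>
     (\<forall>(U, \<phi>)\<in>\<A>. open U \<and> open (\<phi> ` U) \<and> homeomorphism U (\<phi> ` U) \<phi> (inv_into U \<phi>)) \<and>
     (\<Union>(U, \<phi>)\<in>\<A>. U) = UNIV \<and>
     (\<forall>(U, \<phi>)\<in>\<A>. \<forall>(W, \<psi>)\<in>\<A>. Cinf_on (\<phi> ` (U \<inter> W)) (\<psi> \<circ> inv_into U \<phi>))"

definition smooth_fun ::
    "('a::topological_space, 'e::euclidean_space) atlas \<Rightarrow> 'a set \<Rightarrow> ('a \<Rightarrow> real) \<Rightarrow> bool" where
  "smooth_fun \<A> W f \<longleftrightarrow> (\<forall>(U, \<phi>)\<in>\<A>. Cinf_on (\<phi> ` (U \<inter> W)) (f \<circ> inv_into U \<phi>))"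

definition smooth_at ::
    "('a::topological_space, 'e::euclidean_space) atlas \<Rightarrow> 'a \<Rightarrow> ('a \<Rightarrow> real) \<Rightarrow> bool" where
  "smooth_at \<A> p f \<longleftrightarrow> (\<exists>W. open W \<and> p \<in> W \<and> smooth_fun \<A> W f)"

type_synonym 'a tvec = "('a \<Rightarrow> real) \<Rightarrow> real"
type_synonym 'a vfield = "'a \<Rightarrow> 'a tvec"
type_synonym 'a form1 = "'a \<Rightarrow> 'a tvec \<Rightarrow> real"
type_synonym 'a form2 = "'a \<Rightarrow> 'a tvec \<Rightarrow> 'a tvec \<Rightarrow> real"
type_synonym 'a endo = "'a \<Rightarrow> 'a tvec \<Rightarrow> 'a tvec"
type_synonym 'a conn = "'a \<Rightarrow> 'a tvec \<Rightarrow> 'a vfield \<Rightarrow> 'a tvec"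

text \<open>Derivations at \<open>p\<close> of the functions smooth near \<open>p\<close>. They only see germs: the indicator of
  an open neighbourhood of \<open>p\<close> is smooth near \<open>p\<close>, so the Leibniz rule lets one cut off. The last
  clause fixes the values on the irrelevant functions, so that a tangent vector is determined by
  its action on smooth germs.\<close>

definition tangent_space ::
    "('a::topological_space, 'e::euclidean_space) atlas \<Rightarrow> 'a \<Rightarrow> 'a tvec set" where
  "tangent_space \<A> p = {v.
     (\<forall>f h. smooth_at \<A> p f \<and> smooth_at \<A> p h \<longrightarrow> v (\<lambda>x. f x + h x) = v f + v h) \<and>
     (\<forall>c f. smooth_at \<A> p f \<longrightarrow> v (\<lambda>x. c * f x) = c * v f) \<and>
     (\<forall>f h. smooth_at \<A> p f \<and> smooth_at \<A> p h \<longrightarrow>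
        v (\<lambda>x. f x * h x) = f p * v h + h p * v f) \<and>
     (\<forall>f. \<not> smooth_at \<A> p f \<longrightarrow> v f = 0)}"

definition vector_field ::
    "('a::topological_space, 'e::euclidean_space) atlas \<Rightarrow> 'a set \<Rightarrow> 'a vfield \<Rightarrow> bool" where
  "vector_field \<A> U X \<longleftrightarrow>
     (\<forall>p\<in>U. X p \<in> tangent_space \<A> p \<and>
        (\<forall>f. smooth_at \<A> p f \<longrightarrow> smooth_at \<A> p (\<lambda>q. X q f)))"

text \<open>Vector fields defined near \<open>p\<close>, and those among them with values in a family \<open>E\<close> of
  subspaces.\<close>

definition section_at ::
    "('a::topological_space, 'e::euclidean_space) atlas \<Rightarrow> ('a \<Rightarrow> 'a tvec set) \<Rightarrow>
     'a \<Rightarrow> 'a vfield \<Rightarrow> bool" where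
  "section_at \<A> E p X \<longleftrightarrow>
     (\<exists>W. open W \<and> p \<in> W \<and> vector_field \<A> W X \<and> (\<forall>q\<in>W. X q \<in> E q))"

abbreviation vfield_at ::
    "('a::topological_space, 'e::euclidean_space) atlas \<Rightarrow> 'a \<Rightarrow> 'a vfield \<Rightarrow> bool" where
  "vfield_at \<A> p X \<equiv> section_at \<A> (tangent_space \<A>) p X"

definition bracket ::
    "('a::topological_space, 'e::euclidean_space) atlas \<Rightarrow> 'a vfield \<Rightarrow> 'a vfield \<Rightarrow> 'a vfield"
  where
  "bracket \<A> X Y p = (\<lambda>f. if smooth_at \<A> p f
     then X p (\<lambda>q. Y q f) - Y p (\<lambda>q. X q f) else 0)"

definition one_form ::
    "('a::topological_space, 'e::euclidean_space) atlas \<Rightarrow> 'a set \<Rightarrow> 'a form1 \<Rightarrow> bool" where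
  "one_form \<A> U \<theta> \<longleftrightarrow>
     (\<forall>p\<in>U. lin_on (tangent_space \<A> p) (\<theta> p) \<and>
        (\<forall>X. vfield_at \<A> p X \<longrightarrow> smooth_at \<A> p (\<lambda>q. \<theta> q (X q))))"

definition ext_deriv ::
    "('a::topological_space, 'e::euclidean_space) atlas \<Rightarrow> 'a form1 \<Rightarrow>
     'a vfield \<Rightarrow> 'a vfield \<Rightarrow> 'a \<Rightarrow> real" where
  "ext_deriv \<A> \<theta> X Y p =
     X p (\<lambda>q. \<theta> q (Y q)) - Y p (\<lambda>q. \<theta> q (X q)) - \<theta> p (bracket \<A> X Y p)"

definition lie_deriv_form2 ::
    "('a::topological_space, 'e::euclidean_space) atlas \<Rightarrow> 'a vfield \<Rightarrow> 'a form2 \<Rightarrow>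
     'a vfield \<Rightarrow> 'a vfield \<Rightarrow> 'a \<Rightarrow> real" where
  "lie_deriv_form2 \<A> Z \<omega> X Y p =
     Z p (\<lambda>q. \<omega> q (X q) (Y q)) - \<omega> p (bracket \<A> Z X p) (Y p) - \<omega> p (X p) (bracket \<A> Z Y p)"

text \<open>\<open>D p v B\<close> is the derivative of the field \<open>B\<close>, defined near \<open>p\<close>, in direction \<open>v\<close> at \<open>p\<close>.
  As for tangent vectors, the Leibniz rule forces dependence on the germ of \<open>B\<close> only.\<close>

definition linear_connection ::
    "('a::topological_space, 'e::euclidean_space) atlas \<Rightarrow> 'a conn \<Rightarrow> bool" where
  "linear_connection \<A> D \<longleftrightarrow>
     (\<forall>p B. vfield_at \<A> p B \<longrightarrow>
        (\<forall>v\<in>tangent_space \<A> p. D p v B \<in> tangent_space \<A> p) \<and>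
        lin_on (tangent_space \<A> p) (\<lambda>v. D p v B)) \<and>
     (\<forall>p B C. \<forall>v\<in>tangent_space \<A> p. vfield_at \<A> p B \<and> vfield_at \<A> p C \<longrightarrow>
        D p v (\<lambda>q. B q + C q) = D p v B + D p v C) \<and>
     (\<forall>p f B. \<forall>v\<in>tangent_space \<A> p. smooth_at \<A> p f \<and> vfield_at \<A> p B \<longrightarrow>
        D p v (\<lambda>q. f q *\<^sub>R B q) = v f *\<^sub>R B p + f p *\<^sub>R D p v B) \<and>
     (\<forall>W X B. open W \<and> vector_field \<A> W X \<and> vector_field \<A> W B \<longrightarrow>
        vector_field \<A> W (\<lambda>p. D p (X p) B))"

definition torsion ::
    "('a::topological_space, 'e::euclidean_space) atlas \<Rightarrow> 'a conn \<Rightarrow>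
     'a vfield \<Rightarrow> 'a vfield \<Rightarrow> 'a vfield" where
  "torsion \<A> D X Y p = D p (X p) Y - D p (Y p) X - bracket \<A> X Y p"


section \<open>Horizontal metrics and endomorphisms\<close>

text \<open>\<open>H\<close> is a family of subspaces of the tangent spaces. A member of \<open>End(H\<^sub>p)\<close> is extended by zero
  to non-horizontal arguments, so that equality of endomorphisms is equality of functions.\<close>

definition hor_end :: "'a tvec set \<Rightarrow> ('a tvec \<Rightarrow> 'a tvec) set" where
  "hor_end Hp = {B. lin_on Hp B \<and> (\<forall>v\<in>Hp. B v \<in> Hp) \<and> (\<forall>v. v \<notin> Hp \<longrightarrow> B v = 0)}"

definition end_field ::
    "('a::topological_space, 'e::euclidean_space) atlas \<Rightarrow> ('a \<Rightarrow> 'a tvec set) \<Rightarrow>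
     'a set \<Rightarrow> 'a endo \<Rightarrow> bool" where
  "end_field \<A> H W \<Psi> \<longleftrightarrow>
     (\<forall>p\<in>W. \<Psi> p \<in> hor_end (H p) \<and>
        (\<forall>X. section_at \<A> H p X \<longrightarrow> vfield_at \<A> p (\<lambda>q. \<Psi> q (X q))))"

text \<open>Signature \<open>(2n,2n)\<close> is expressed by an orthonormal basis with \<open>2n\<close> vectors of each sign.
  Nothing is required of \<open>g\<close> off \<open>H\<close>.\<close>

definition hor_metric ::
    "('a::topological_space, 'e::euclidean_space) atlas \<Rightarrow> nat \<Rightarrow> ('a \<Rightarrow> 'a tvec set) \<Rightarrow>
     'a form2 \<Rightarrow> bool" where
  "hor_metric \<A> n H g \<longleftrightarrow>
     (\<forall>p. (\<forall>u\<in>H p. lin_on (H p) (g p u)) \<and>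
          (\<forall>u\<in>H p. \<forall>v\<in>H p. g p u v = g p v u) \<and>
          (\<exists>e :: nat \<Rightarrow> 'a tvec. span (e ` {..<4*n}) = H p \<and>
             (\<forall>a<4*n. \<forall>b<4*n. g p (e a) (e b) =
                (if a \<noteq> b then 0 else if a < 2*n then 1 else - 1))) \<and>
          (\<forall>X Y. section_at \<A> H p X \<and> section_at \<A> H p Y \<longrightarrow>
             smooth_at \<A> p (\<lambda>q. g q (X q) (Y q))))"

definition conformal_class ::
    "('a::topological_space, 'e::euclidean_space) atlas \<Rightarrow> nat \<Rightarrow> ('a \<Rightarrow> 'a tvec set) \<Rightarrow>
     'a form2 set \<Rightarrow> bool" where
  "conformal_class \<A> n H G \<longleftrightarrow>
     (\<exists>g0. hor_metric \<A> n H g0 \<and>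
        G = {g. \<exists>f. smooth_fun \<A> UNIV f \<and> (\<forall>p. f p > 0) \<and>
               (\<forall>p. \<forall>u\<in>H p. \<forall>v\<in>H p. g p u v = f p * g0 p u v)})"

text \<open>Horizontal fields near \<open>p\<close> whose values at \<open>p\<close> form a \<open>g\<close>-orthonormal basis of \<open>H\<^sub>p\<close>. Only the
  values at \<open>p\<close> are constrained: the fields are arbitrary extensions of a basis of \<open>H\<^sub>p\<close>, in which
  tensors given by formulas on vector fields can be evaluated.\<close>

definition orthonormal_basis_at ::
    "('a::topological_space, 'e::euclidean_space) atlas \<Rightarrow> nat \<Rightarrow> ('a \<Rightarrow> 'a tvec set) \<Rightarrow>
     'a form2 \<Rightarrow> 'a \<Rightarrow> (nat \<Rightarrow> 'a vfield) \<Rightarrow> bool" where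
  "orthonormal_basis_at \<A> n H g p e \<longleftrightarrow>
     (\<forall>a<4*n. section_at \<A> H p (e a)) \<and>
     span ((\<lambda>a. e a p) ` {..<4*n}) = H p \<and>
     (\<forall>a<4*n. \<forall>b<4*n. a \<noteq> b \<longrightarrow> g p (e a p) (e b p) = 0) \<and>
     (\<forall>a<4*n. g p (e a p) (e a p) = 1 \<or> g p (e a p) (e a p) = - 1)"

definition gtrace ::
    "nat \<Rightarrow> 'a form2 \<Rightarrow> 'a \<Rightarrow> (nat \<Rightarrow> 'a vfield) \<Rightarrow> ('a vfield \<Rightarrow> 'a vfield \<Rightarrow> real) \<Rightarrow> real" where
  "gtrace n g p e P = (\<Sum>a<4*n. g p (e a p) (e a p) * P (e a) (e a))"


section \<open>Paraquaternionic contact structures\<close>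

definition eps :: "nat \<Rightarrow> real" where
  "eps s = (if s = 3 then - 1 else 1)"

definition cyclic :: "nat \<Rightarrow> nat \<Rightarrow> nat \<Rightarrow> bool" where
  "cyclic i j k \<longleftrightarrow> (i, j, k) \<in> {(1, 2, 3), (2, 3, 1), (3, 1, 2)}"

definition local_data ::
    "('a::topological_space, 'e::euclidean_space) atlas \<Rightarrow> ('a \<Rightarrow> 'a tvec set) \<Rightarrow> 'a form2 \<Rightarrow>
     ('a \<Rightarrow> ('a tvec \<Rightarrow> 'a tvec) set) \<Rightarrow> 'a set \<Rightarrow>
     (nat \<Rightarrow> 'a form1) \<Rightarrow> (nat \<Rightarrow> 'a endo) \<Rightarrow> bool" where
  "local_data \<A> H g PQ U \<eta> I \<longleftrightarrow>
     open U \<and>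
     (\<forall>s\<in>{1,2,3}. one_form \<A> U (\<eta> s) \<and> end_field \<A> H U (I s)) \<and>
     (\<forall>p\<in>U.
        PQ p = span {I 1 p, I 2 p, I 3 p} \<and>
        (\<forall>s\<in>{1,2,3}. \<forall>u\<in>H p. I s p (I s p u) = eps s *\<^sub>R u) \<and>
        (\<forall>i j k. cyclic i j k \<longrightarrow> (\<forall>u\<in>H p.
           I i p (I j p u) = - eps k *\<^sub>R I k p u \<and> I j p (I i p u) = eps k *\<^sub>R I k p u)) \<and>
        (\<forall>s\<in>{1,2,3}. \<forall>u\<in>H p. \<forall>v\<in>H p. g p (I s p u) (I s p v) = - eps s * g p u v) \<and>
        H p = {v \<in> tangent_space \<A> p. \<forall>s\<in>{1,2,3}. \<eta> s p v = 0} \<and>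
        (\<forall>s\<in>{1,2,3}. \<forall>X Y. section_at \<A> H p X \<and> section_at \<A> H p Y \<longrightarrow>
           ext_deriv \<A> (\<eta> s) X Y p = - 2 * eps s * g p (I s p (X p)) (Y p)))"

definition reeb_fields ::
    "('a::topological_space, 'e::euclidean_space) atlas \<Rightarrow> ('a \<Rightarrow> 'a tvec set) \<Rightarrow> 'a set \<Rightarrow>
     (nat \<Rightarrow> 'a form1) \<Rightarrow> (nat \<Rightarrow> 'a vfield) \<Rightarrow> bool" where
  "reeb_fields \<A> H U \<eta> \<xi> \<longleftrightarrow>
     (\<forall>s\<in>{1,2,3}. vector_field \<A> U (\<xi> s)) \<and>
     (\<forall>p\<in>U.
        (\<forall>s\<in>{1,2,3}. \<forall>t\<in>{1,2,3}. \<eta> s p (\<xi> t p) = (if s = t then 1 else 0)) \<and>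
        (\<forall>X. section_at \<A> H p X \<longrightarrow>
           (\<forall>s\<in>{1,2,3}. ext_deriv \<A> (\<eta> s) (\<xi> s) X p = 0) \<and>
           (\<forall>i j k. cyclic i j k \<longrightarrow>
              ext_deriv \<A> (\<eta> i) (\<xi> j) X p = eps k * ext_deriv \<A> (\<eta> j) (\<xi> i) X p)))"

text \<open>Smoothness of the distribution \<open>H\<close> and of the bundle \<open>PQ\<close> is part of the existence of the
  smooth local data. Rescaling \<open>\<eta>\<close> shows that it is immaterial for which metrics of the conformal
  class the local data are required. For \<open>n = 1\<close> the existence of Reeb fields is part of the
  definition.\<close>

definition pqc_manifold ::
    "('a::{t2_space,second_countable_topology}, 'e::euclidean_space) atlas \<Rightarrow> nat \<Rightarrow>
     ('a \<Rightarrow> 'a tvec set) \<Rightarrow> 'a form2 set \<Rightarrow> ('a \<Rightarrow> ('a tvec \<Rightarrow> 'a tvec) set) \<Rightarrow> bool" where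
  "pqc_manifold \<A> n H G PQ \<longleftrightarrow>
     smooth_atlas \<A> \<and> n \<ge> 1 \<and> DIM('e) = 4 * n + 3 \<and>
     (\<forall>p. subspace (H p) \<and> H p \<subseteq> tangent_space \<A> p \<and> dim (H p) = 4 * n) \<and>
     conformal_class \<A> n H G \<and>
     (\<forall>p. PQ p \<subseteq> hor_end (H p) \<and> subspace (PQ p) \<and> dim (PQ p) = 3) \<and>
     (\<forall>g\<in>G. \<forall>p. \<exists>U \<eta> I. p \<in> U \<and> local_data \<A> H g PQ U \<eta> I \<and>
        (n = 1 \<longrightarrow> (\<exists>\<xi>. reeb_fields \<A> H U \<eta> \<xi>)))"

definition vert :: "(nat \<Rightarrow> 'a vfield) \<Rightarrow> 'a \<Rightarrow> 'a tvec set" where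
  "vert \<xi> p = span {\<xi> 1 p, \<xi> 2 p, \<xi> 3 p}"

definition vpart :: "(nat \<Rightarrow> 'a form1) \<Rightarrow> (nat \<Rightarrow> 'a vfield) \<Rightarrow> 'a \<Rightarrow> 'a tvec \<Rightarrow> 'a tvec" where
  "vpart \<eta> \<xi> p v = (\<Sum>s\<in>{1,2,3}. \<eta> s p v *\<^sub>R \<xi> s p)"

definition hpart :: "(nat \<Rightarrow> 'a form1) \<Rightarrow> (nat \<Rightarrow> 'a vfield) \<Rightarrow> 'a \<Rightarrow> 'a tvec \<Rightarrow> 'a tvec" where
  "hpart \<eta> \<xi> p v = v - vpart \<eta> \<xi> p v"

definition gext :: "'a form2 \<Rightarrow> (nat \<Rightarrow> 'a form1) \<Rightarrow> (nat \<Rightarrow> 'a vfield) \<Rightarrow> 'a form2" where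
  "gext g \<eta> \<xi> p u v =
     g p (hpart \<eta> \<xi> p u) (hpart \<eta> \<xi> p v) - (\<Sum>s\<in>{1,2,3}. eps s * \<eta> s p u * \<eta> s p v)"

definition omega ::
    "'a form2 \<Rightarrow> (nat \<Rightarrow> 'a form1) \<Rightarrow> (nat \<Rightarrow> 'a endo) \<Rightarrow> (nat \<Rightarrow> 'a vfield) \<Rightarrow> nat \<Rightarrow> 'a form2" where
  "omega g \<eta> I \<xi> s p u v = g p (I s p (hpart \<eta> \<xi> p u)) (hpart \<eta> \<xi> p v)"

definition lie_deriv_end ::
    "('a::topological_space, 'e::euclidean_space) atlas \<Rightarrow>
     (nat \<Rightarrow> 'a form1) \<Rightarrow> (nat \<Rightarrow> 'a vfield) \<Rightarrow> 'a vfield \<Rightarrow> 'a endo \<Rightarrow> 'a vfield \<Rightarrow> 'a vfield"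
  where
  "lie_deriv_end \<A> \<eta> \<xi> Z \<Psi> X p =
     hpart \<eta> \<xi> p (bracket \<A> Z (\<lambda>q. \<Psi> q (X q)) p) - \<Psi> p (hpart \<eta> \<xi> p (bracket \<A> Z X p))"


section \<open>The canonical connection\<close>

definition sp_n ::
    "('a \<Rightarrow> 'a tvec set) \<Rightarrow> 'a form2 \<Rightarrow> (nat \<Rightarrow> 'a endo) \<Rightarrow> 'a \<Rightarrow> ('a tvec \<Rightarrow> 'a tvec) set" where
  "sp_n H g I p = {B \<in> hor_end (H p).
     (\<forall>u\<in>H p. \<forall>v\<in>H p. g p (B u) v = - g p u (B v)) \<and>
     (\<forall>s\<in>{1,2,3}. \<forall>u\<in>H p. B (I s p u) = I s p (B u))}"

definition sp_1 :: "(nat \<Rightarrow> 'a endo) \<Rightarrow> 'a \<Rightarrow> ('a tvec \<Rightarrow> 'a tvec) set" where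
  "sp_1 I p = span {I 1 p, I 2 p, I 3 p}"

text \<open>\<open>(\<nabla>\<^sub>v \<Psi>) X\<close> for an endomorphism field \<open>\<Psi>\<close> of \<open>H\<close>, and the bundle map \<open>V \<rightarrow> PQ\<close>
  with \<open>\<xi>\<^sub>s \<mapsto> I\<^sub>s\<close>.\<close>

definition nabla_end :: "'a conn \<Rightarrow> 'a \<Rightarrow> 'a tvec \<Rightarrow> 'a endo \<Rightarrow> 'a vfield \<Rightarrow> 'a tvec" where
  "nabla_end D p v \<Psi> X = D p v (\<lambda>q. \<Psi> q (X q)) - \<Psi> p (D p v X)"

definition V_to_PQ ::
    "(nat \<Rightarrow> 'a form1) \<Rightarrow> (nat \<Rightarrow> 'a endo) \<Rightarrow> 'a \<Rightarrow> 'a tvec \<Rightarrow> ('a tvec \<Rightarrow> 'a tvec)" where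
  "V_to_PQ \<eta> I p v = (\<Sum>s\<in>{1,2,3}. \<eta> s p v *\<^sub>R I s p)"

text \<open>The bundle \<open>V\<close>, the extended metric and the map \<open>V \<rightarrow> PQ\<close> do not depend on the choice of
  local data compatible with \<open>g\<close>, so the defining conditions are imposed in all of them.\<close>

definition canonical_pqc_connection ::
    "('a::topological_space, 'e::euclidean_space) atlas \<Rightarrow> nat \<Rightarrow> ('a \<Rightarrow> 'a tvec set) \<Rightarrow>
     'a form2 \<Rightarrow> ('a \<Rightarrow> ('a tvec \<Rightarrow> 'a tvec) set) \<Rightarrow> 'a conn \<Rightarrow> bool" where
  "canonical_pqc_connection \<A> n H g PQ D \<longleftrightarrow>
     linear_connection \<A> D \<and>
     (\<forall>U \<eta> I \<xi>. local_data \<A> H g PQ U \<eta> I \<and> reeb_fields \<A> H U \<eta> \<xi> \<longrightarrow> (\<forall>p\<in>U.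
        (\<forall>v\<in>tangent_space \<A> p.
           (\<forall>X. section_at \<A> H p X \<longrightarrow> D p v X \<in> H p) \<and>
           (\<forall>Z. section_at \<A> (vert \<xi>) p Z \<longrightarrow> D p v Z \<in> vert \<xi> p) \<and>
           (\<forall>B C. vfield_at \<A> p B \<and> vfield_at \<A> p C \<longrightarrow>
              v (\<lambda>q. gext g \<eta> \<xi> q (B q) (C q)) =
                gext g \<eta> \<xi> p (D p v B) (C p) + gext g \<eta> \<xi> p (B p) (D p v C)) \<and>
           (\<forall>W \<Psi>. open W \<and> p \<in> W \<and> end_field \<A> H W \<Psi> \<and> (\<forall>q\<in>W. \<Psi> q \<in> PQ q) \<longrightarrow>
              (\<exists>Q\<in>PQ p. \<forall>X. section_at \<A> H p X \<longrightarrow> nabla_end D p v \<Psi> X = Q (X p))) \<and>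
           (\<forall>Z X. section_at \<A> (vert \<xi>) p Z \<and> section_at \<A> H p X \<longrightarrow>
              nabla_end D p v (\<lambda>q. V_to_PQ \<eta> I q (Z q)) X = V_to_PQ \<eta> I p (D p v Z) (X p))) \<and>
        (\<forall>X Y. section_at \<A> H p X \<and> section_at \<A> H p Y \<longrightarrow>
           torsion \<A> D X Y p = - vpart \<eta> \<xi> p (bracket \<A> X Y p)) \<and>
        (\<forall>Z e. section_at \<A> (vert \<xi>) p Z \<and> orthonormal_basis_at \<A> n H g p e \<longrightarrow>
           (\<forall>Q\<in>sp_n H g I p. \<forall>R\<in>sp_1 I p.
              gtrace n g p e (\<lambda>X Y. g p (hpart \<eta> \<xi> p (torsion \<A> D Z X p)) ((Q + R) (Y p))) = 0))))"

definition connection_forms ::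
    "('a::topological_space, 'e::euclidean_space) atlas \<Rightarrow> ('a \<Rightarrow> 'a tvec set) \<Rightarrow> 'a set \<Rightarrow>
     (nat \<Rightarrow> 'a endo) \<Rightarrow> 'a conn \<Rightarrow> (nat \<Rightarrow> 'a form1) \<Rightarrow> bool" where
  "connection_forms \<A> H U I D \<alpha> \<longleftrightarrow>
     (\<forall>s\<in>{1,2,3}. one_form \<A> U (\<alpha> s)) \<and>
     (\<forall>p\<in>U. \<forall>v\<in>tangent_space \<A> p. \<forall>X. section_at \<A> H p X \<longrightarrow>
        (\<forall>i j k. cyclic i j k \<longrightarrow>
           nabla_end D p v (I i) X =
             \<alpha> j p v *\<^sub>R I k p (X p) + (eps k * \<alpha> k p v) *\<^sub>R I j p (X p)))"

end

theory Submission
  imports Defs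
begin

text \<open>Apply \<open>\<eta>\<^sub>t\<close> to the Jacobi identity for \<open>\<xi>\<^sub>s\<close> and two horizontal fields \<open>X, Y\<close>. This expresses
  \<open>(L\<^bsub>\<xi>\<^sub>s\<^esub> \<omega>\<^sub>t)(X, Y)\<close> by the forms \<open>\<omega>\<^sub>r\<close> with coefficients \<open>d\<eta>\<^sub>t(\<xi>\<^sub>s, \<xi>\<^sub>r)\<close>, up to terms in the horizontal
  1-forms \<open>d\<eta>\<^sub>t(\<xi>\<^sub>s, X)\<close>; by the Reeb conditions the latter vanish for \<open>s = t\<close>, and cancel in the
  combination of the pairs \<open>(s,t) = (j,i)\<close> and \<open>(i,j)\<close>. On the other hand the Lie derivative is
  \<open>\<nabla>\<^bsub>\<xi>\<^sub>s\<^esub> \<omega>\<^sub>t\<close> plus torsion terms, and these disappear when \<open>Y = I\<^sub>m X\<close> with \<open>m \<noteq> t\<close> is traced over \<open>X\<close>,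
  because the torsion endomorphisms are orthogonal to the \<open>I\<^sub>r\<close>. Comparing the two traces gives
  \<open>\<alpha>\<^sub>j(\<xi>\<^sub>i)\<close> and \<open>\<alpha>\<^sub>k(\<xi>\<^sub>i)\<close> for \<open>s = t\<close>, and for the combination a relation between \<open>\<alpha>\<^sub>i(\<xi>\<^sub>i)\<close> and
  \<open>\<alpha>\<^sub>j(\<xi>\<^sub>j)\<close> which is the cyclic symmetry of \<open>T(\<xi>\<^sub>i, \<xi>\<^sub>j, \<xi>\<^sub>k)\<close>. The trace of \<open>L\<^bsub>\<xi>\<^sub>i\<^esub> I\<^sub>k\<close> against \<open>I\<^sub>j\<close>
  yields \<open>\<alpha>\<^sub>i(\<xi>\<^sub>i)\<close> in the same way.\<close>

section \<open>Calculus of smooth functions\<close>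

lemma Ck_on_subset: "Ck_on k S f \<Longrightarrow> T \<subseteq> S \<Longrightarrow> Ck_on k T f"
  by (induction k arbitrary: f) (auto intro: continuous_on_subset)

text \<open>Where a function is differentiable, its derivative depends on the germ only. As S is
  open, equality on S passes to the derivatives, hence the induction over both functions at
  once.\<close>

lemma Ck_on_cong:
  assumes "open S" "\<And>x. x \<in> S \<Longrightarrow> f x = h x" "Ck_on k S f"
  shows "Ck_on k S h"
  using assms(2,3)
proof (induction k arbitrary: f h)
  case 0
  then show ?case using continuous_on_cong[of S S f h] by simp
next
  case (Suc k)
  have d: "(h has_derivative frechet_derivative f (at x)) (at x)" if "x \<in> S" for x
    using Suc.prems that assms(1)
    by (intro has_derivative_transform_within_open[of f _ x UNIV S h])
       (auto simp: frechet_derivative_works[symmetric])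
  then have "frechet_derivative h (at x) = frechet_derivative f (at x)" if "x \<in> S" for x
    using that d frechet_derivative_at[of h "frechet_derivative f (at x)" x] by simp
  with d Suc show ?case
    by (auto simp: differentiable_def intro!: Suc.IH[of "\<lambda>x. frechet_derivative f (at x) _"])
qed

lemma Ck_on_const: "Ck_on k S (\<lambda>x. c)"
  by (induction k arbitrary: c) auto

lemma Ck_on_SucD: "Ck_on (Suc k) S f \<Longrightarrow> Ck_on k S f"
proof (induction k arbitrary: f)
  case 0
  then show ?case
    by (auto intro!: continuous_at_imp_continuous_on differentiable_imp_continuous_within)
next
  case (Suc k)
  then show ?case by auto
qed

text \<open>\<open>frechet_derivative\<close> obeys the sum rule only where both functions are
  differentiable, so the rule is used on S and regularity is carried over by
  \<open>Ck_on_cong\<close>. Products, inner products and compositions follow the same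
  pattern.\<close>

lemma Ck_on_add:
  assumes "open S" "Ck_on k S f" "Ck_on k S h"
  shows "Ck_on k S (\<lambda>x. f x + h x)"
  using assms(2,3)
proof (induction k arbitrary: f h)
  case 0
  then show ?case by (auto intro: continuous_on_add)
next
  case (Suc k)
  have "Ck_on k S (\<lambda>x. frechet_derivative (\<lambda>x. f x + h x) (at x) v)" for v
  proof (rule Ck_on_cong[OF assms(1)])
    show "Ck_on k S (\<lambda>x. frechet_derivative f (at x) v + frechet_derivative h (at x) v)"
      using Suc by auto
    show "frechet_derivative f (at x) v + frechet_derivative h (at x) v
      = frechet_derivative (\<lambda>x. f x + h x) (at x) v" if "x \<in> S" for x
    proof -
      have "(f has_derivative frechet_derivative f (at x)) (at x)"
        "(h has_derivative frechet_derivative h (at x)) (at x)"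
        using Suc.prems that by (auto simp: frechet_derivative_works[symmetric])
      from frechet_derivative_at[OF has_derivative_add[OF this]] show ?thesis
        by (simp add: fun_eq_iff)
    qed
  qed
  with Suc show ?case by auto
qed

lemma Ck_on_mult:
  fixes f h :: "'e::euclidean_space \<Rightarrow> real"
  assumes "open S" "Ck_on k S f" "Ck_on k S h"
  shows "Ck_on k S (\<lambda>x. f x * h x)"
  using assms(2,3)
proof (induction k arbitrary: f h)
  case 0
  then show ?case by (auto intro: continuous_on_mult)
next
  case (Suc k)
  have "Ck_on k S (\<lambda>x. frechet_derivative (\<lambda>x. f x * h x) (at x) v)" for v
  proof (rule Ck_on_cong[OF assms(1)])
    \<comment> \<open>The product rule contains undifferentiated factors; these are lowered from
      order \<open>Suc k\<close> to \<open>k\<close> before the induction hypothesis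
      applies.\<close>
    show "Ck_on k S (\<lambda>x. f x * frechet_derivative h (at x) v + frechet_derivative f (at x) v * h x)"
      using Suc Ck_on_SucD[OF Suc.prems(1)] Ck_on_SucD[OF Suc.prems(2)]
      by (intro Ck_on_add Suc.IH assms(1)) auto
    show "f x * frechet_derivative h (at x) v + frechet_derivative f (at x) v * h x
      = frechet_derivative (\<lambda>x. f x * h x) (at x) v" if "x \<in> S" for x
    proof -
      have "(f has_derivative frechet_derivative f (at x)) (at x)"
        "(h has_derivative frechet_derivative h (at x)) (at x)"
        using Suc.prems that by (auto simp: frechet_derivative_works[symmetric])
      from frechet_derivative_at[OF has_derivative_mult[OF this]] show ?thesis
        by (simp add: fun_eq_iff)
    qed
  qed
  with Suc show ?case by auto
qed

lemma Ck_on_sum: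
  assumes "open S" "finite B" "\<And>b. b \<in> B \<Longrightarrow> Ck_on k S (f b)"
  shows "Ck_on k S (\<lambda>x. \<Sum>b\<in>B. f b x)"
  using assms(2,3)
  by (induction B rule: finite_induct) (auto intro: Ck_on_const Ck_on_add assms(1))

lemma Ck_on_inner:
  assumes "open S" "Ck_on k S f"
  shows "Ck_on k S (\<lambda>x. f x \<bullet> b)"
  using assms(2)
proof (induction k arbitrary: f)
  case 0
  then show ?case by (auto intro: continuous_on_inner)
next
  case (Suc k)
  have d: "((\<lambda>x. f x \<bullet> b) has_derivative (\<lambda>v. frechet_derivative f (at x) v \<bullet> b)) (at x)"
    if "x \<in> S" for x
    using Suc.prems that
    by (intro has_derivative_inner_left) (auto simp: frechet_derivative_works[symmetric])
  have "Ck_on k S (\<lambda>x. frechet_derivative (\<lambda>x. f x \<bullet> b) (at x) v)" for v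
  proof (rule Ck_on_cong[OF assms(1)])
    show "Ck_on k S (\<lambda>x. frechet_derivative f (at x) v \<bullet> b)"
      using Suc by auto
    show "frechet_derivative f (at x) v \<bullet> b = frechet_derivative (\<lambda>x. f x \<bullet> b) (at x) v"
      if "x \<in> S" for x
      using frechet_derivative_at[OF d[OF that]] by metis
  qed
  with d show ?case by (auto simp: differentiable_def)
qed

lemma Ck_on_compose:
  fixes F :: "'e::euclidean_space \<Rightarrow> real" and G :: "'e \<Rightarrow> 'e"
  assumes "open S" "open T" "G ` S \<subseteq> T" "Ck_on k T F" "Ck_on k S G"
  shows "Ck_on k S (\<lambda>x. F (G x))"
  using assms(4,5)
proof (induction k arbitrary: F)
  case 0
  then show ?case using assms(3) by (auto intro: continuous_on_compose2)
next
  case (Suc k)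
  have d: "((\<lambda>x. F (G x)) has_derivative
      (\<lambda>v. frechet_derivative F (at (G x)) (frechet_derivative G (at x) v))) (at x)"
    if "x \<in> S" for x
    using Suc.prems that assms(3)
    by (intro has_derivative_compose[of G _ x UNIV F, simplified])
       (auto simp: frechet_derivative_works[symmetric])
  have "Ck_on k S (\<lambda>x. frechet_derivative (\<lambda>x. F (G x)) (at x) v)" for v
  proof (rule Ck_on_cong[OF assms(1)])
    \<comment> \<open>Expanding the inner derivative in \<open>Basis\<close> turns the chain rule
      into a sum of products. The factors with \<open>F\<close> are directional derivatives of
      \<open>F\<close> composed with the same \<open>G\<close>, so the induction hypothesis, general
      in \<open>F\<close>, covers them.\<close>
    show "Ck_on k S (\<lambda>x. \<Sum>b\<in>Basis. (frechet_derivative G (at x) v \<bullet> b)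
       * frechet_derivative F (at (G x)) b)"
      using Suc Ck_on_SucD[OF Suc.prems(2)]
      by (intro Ck_on_sum Ck_on_mult Ck_on_inner assms(1)) auto
    show "(\<Sum>b\<in>Basis. (frechet_derivative G (at x) v \<bullet> b) * frechet_derivative F (at (G x)) b)
      = frechet_derivative (\<lambda>x. F (G x)) (at x) v" if "x \<in> S" for x
    proof -
      have lin: "linear (frechet_derivative F (at (G x)))"
        using Suc.prems that assms(3) by (intro linear_frechet_derivative) auto
      have "frechet_derivative (\<lambda>x. F (G x)) (at x) v
        = frechet_derivative F (at (G x)) (frechet_derivative G (at x) v)"
        using frechet_derivative_at[OF d[OF that]] by metis
      also have "\<dots> = frechet_derivative F (at (G x))
          (\<Sum>b\<in>Basis. (frechet_derivative G (at x) v \<bullet> b) *\<^sub>R b)"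
        by (simp add: euclidean_representation)
      also have "\<dots> = (\<Sum>b\<in>Basis. (frechet_derivative G (at x) v \<bullet> b)
          * frechet_derivative F (at (G x)) b)"
        by (simp add: linear_sum[OF lin] linear_cmul[OF lin])
      finally show ?thesis by simp
    qed
  qed
  with d show ?case by (auto simp: differentiable_def)
qed

section \<open>Smooth functions, tangent vectors and vector fields\<close>

lemma sum_fun_apply: "(\<Sum>b\<in>B. F b) x = (\<Sum>b\<in>B. F b x)"
  by (induction B rule: infinite_finite_induct) auto

lemma scaleR_fun_apply: "(c *\<^sub>R f) x = c *\<^sub>R f x"
  by (simp add: scaleR_fun_def)

text \<open>With the neighbourhood filter in place of an explicit open set, conditions can be
  intersected freely and the base point can move, by \<open>eventually_eventually\<close>.\<close>

lemma section_at_iff: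
  "section_at \<A> E p X \<longleftrightarrow> (\<forall>\<^sub>F q in nhds p. X q \<in> tangent_space \<A> q \<and>
     (\<forall>f. smooth_at \<A> q f \<longrightarrow> smooth_at \<A> q (\<lambda>r. X r f)) \<and> X q \<in> E q)"
  unfolding section_at_def vector_field_def eventually_nhds by blast

lemma section_at_eventually: "section_at \<A> E p X \<Longrightarrow> \<forall>\<^sub>F q in nhds p. section_at \<A> E q X"
  unfolding section_at_iff eventually_eventually .

lemma section_at_mono: "section_at \<A> E p X \<Longrightarrow> vfield_at \<A> p X"
  unfolding section_at_iff by (auto elim: eventually_mono)

lemma section_at_vfieldI:
  "vfield_at \<A> p X \<Longrightarrow> \<forall>\<^sub>F q in nhds p. X q \<in> E q \<Longrightarrow> section_at \<A> E p X"
  unfolding section_at_iff by (auto elim: eventually_elim2)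

lemma section_at_mem: "section_at \<A> E p X \<Longrightarrow> X p \<in> E p"
  unfolding section_at_def by blast

lemma vector_field_imp_vfield_at: "vector_field \<A> W X \<Longrightarrow> open W \<Longrightarrow> p \<in> W \<Longrightarrow> vfield_at \<A> p X"
  unfolding section_at_def vector_field_def by blast

lemma smooth_at_eventually: "smooth_at \<A> p f \<Longrightarrow> \<forall>\<^sub>F q in nhds p. smooth_at \<A> q f"
  unfolding smooth_at_def eventually_nhds by blast

section \<open>Charts and the algebra of functions smooth near a point\<close>

locale smooth_manifold =
  fixes \<A> :: "('a::{t2_space,second_countable_topology}, 'e::euclidean_space) atlas"
  assumes atlas: "smooth_atlas \<A>"
begin

lemma chart:
  assumes "(U, \<phi>) \<in> \<A>"
  shows "open U" "open (\<phi> ` U)" "homeomorphism U (\<phi> ` U) \<phi> (inv_into U \<phi>)"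
  using atlas assms unfolding smooth_atlas_def by auto

lemma chart_at: obtains U \<phi> where "(U, \<phi>) \<in> \<A>" "p \<in> U"
  using atlas unfolding smooth_atlas_def by blast

lemma chart_inj: "(U, \<phi>) \<in> \<A> \<Longrightarrow> inj_on \<phi> U"
  using chart(3) unfolding homeomorphism_def by (metis inj_onI)

lemma chart_inv: "(U, \<phi>) \<in> \<A> \<Longrightarrow> x \<in> U \<Longrightarrow> inv_into U \<phi> (\<phi> x) = x"
  using chart_inj by simp

lemma chart_image_open:
  assumes "(U, \<phi>) \<in> \<A>" "open W"
  shows "open (\<phi> ` (U \<inter> W))"
proof -
  have "\<phi> ` (U \<inter> W) = \<phi> ` U \<inter> inv_into U \<phi> -` W"
    using chart_inv[OF assms(1)] by auto
  moreover have "continuous_on (\<phi> ` U) (inv_into U \<phi>)"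
    using chart(3)[OF assms(1)] by (simp add: homeomorphism_def)
  ultimately show ?thesis
    using continuous_open_preimage[OF _ chart(2)[OF assms(1)] assms(2)] by metis
qed

lemma chart_transition:
  assumes "(U, \<phi>) \<in> \<A>" "(W, \<psi>) \<in> \<A>"
  shows "Ck_on k (\<phi> ` (U \<inter> W)) (\<psi> \<circ> inv_into U \<phi>)"
  using atlas assms unfolding smooth_atlas_def Cinf_on_def by fast

lemma smooth_atI:
  assumes "open W" "p \<in> W"
    "\<And>U \<phi> k. (U, \<phi>) \<in> \<A> \<Longrightarrow> Ck_on k (\<phi> ` (U \<inter> W)) (\<lambda>x. f (inv_into U \<phi> x))"
  shows "smooth_at \<A> p f"
proof -
  have "smooth_fun \<A> W f"
    using assms(3) by (auto simp: smooth_fun_def Cinf_on_def comp_def)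
  with assms(1,2) show ?thesis unfolding smooth_at_def by blast
qed

text \<open>Regularity is provided on every subset of the neighbourhood, so that the neighbourhoods
  of two functions can be intersected.\<close>

lemma smooth_atE:
  assumes "smooth_at \<A> p f"
  obtains W where "open W" "p \<in> W"
    "\<And>V U \<phi> k. (U, \<phi>) \<in> \<A> \<Longrightarrow> V \<subseteq> W \<Longrightarrow> Ck_on k (\<phi> ` (U \<inter> V)) (\<lambda>x. f (inv_into U \<phi> x))"
proof -
  obtain W where "open W" "p \<in> W" and W: "smooth_fun \<A> W f"
    using assms unfolding smooth_at_def by blast
  have *: "Ck_on k (\<phi> ` (U \<inter> W)) (\<lambda>x. f (inv_into U \<phi> x))" if "(U, \<phi>) \<in> \<A>" for U \<phi> k
    using W that by (auto simp: smooth_fun_def Cinf_on_def comp_def)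
  note \<open>open W\<close> \<open>p \<in> W\<close>
  moreover have "Ck_on k (\<phi> ` (U \<inter> V)) (\<lambda>x. f (inv_into U \<phi> x))"
    if "(U, \<phi>) \<in> \<A>" "V \<subseteq> W" for V U \<phi> k
    by (rule Ck_on_subset[OF *[OF that(1)]]) (use that(2) in auto)
  ultimately show ?thesis using that by blast
qed

lemma smooth_at_cong:
  assumes "\<forall>\<^sub>F q in nhds p. f q = h q" "smooth_at \<A> p f"
  shows "smooth_at \<A> p h"
proof -
  obtain V where V: "open V" "p \<in> V" "\<And>q. q \<in> V \<Longrightarrow> f q = h q"
    using assms(1) unfolding eventually_nhds by blast
  obtain W where W: "open W" "p \<in> W" "\<And>V U \<phi> k. (U, \<phi>) \<in> \<A> \<Longrightarrow> V \<subseteq> W \<Longrightarrow>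
      Ck_on k (\<phi> ` (U \<inter> V)) (\<lambda>x. f (inv_into U \<phi> x))"
    using smooth_atE[OF assms(2)] by blast
  show ?thesis
  proof (rule smooth_atI[of "V \<inter> W"])
    fix U \<phi> k assume c: "(U, \<phi>) \<in> \<A>"
    show "Ck_on k (\<phi> ` (U \<inter> (V \<inter> W))) (\<lambda>x. h (inv_into U \<phi> x))"
      by (rule Ck_on_cong[OF chart_image_open[OF c] _ W(3)[OF c]])
        (use V W(1) chart_inv[OF c] in auto)
  qed (use V W in auto)
qed

lemma smooth_at_const: "smooth_at \<A> p (\<lambda>q. c)"
  by (rule smooth_atI[of UNIV]) (auto intro: Ck_on_const)

lemma smooth_at_add:
  assumes "smooth_at \<A> p f" "smooth_at \<A> p h"
  shows "smooth_at \<A> p (\<lambda>q. f q + h q)"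
proof -
  obtain V where V: "open V" "p \<in> V" "\<And>W U \<phi> k. (U, \<phi>) \<in> \<A> \<Longrightarrow> W \<subseteq> V \<Longrightarrow>
      Ck_on k (\<phi> ` (U \<inter> W)) (\<lambda>x. f (inv_into U \<phi> x))"
    using smooth_atE[OF assms(1)] by blast
  obtain W where W: "open W" "p \<in> W" "\<And>V U \<phi> k. (U, \<phi>) \<in> \<A> \<Longrightarrow> V \<subseteq> W \<Longrightarrow>
      Ck_on k (\<phi> ` (U \<inter> V)) (\<lambda>x. h (inv_into U \<phi> x))"
    using smooth_atE[OF assms(2)] by blast
  show ?thesis
    using V W by (intro smooth_atI[of "V \<inter> W"] Ck_on_add chart_image_open) auto
qed

lemma smooth_at_mult:
  assumes "smooth_at \<A> p f" "smooth_at \<A> p h"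
  shows "smooth_at \<A> p (\<lambda>q. f q * h q)"
proof -
  obtain V where V: "open V" "p \<in> V" "\<And>W U \<phi> k. (U, \<phi>) \<in> \<A> \<Longrightarrow> W \<subseteq> V \<Longrightarrow>
      Ck_on k (\<phi> ` (U \<inter> W)) (\<lambda>x. f (inv_into U \<phi> x))"
    using smooth_atE[OF assms(1)] by blast
  obtain W where W: "open W" "p \<in> W" "\<And>V U \<phi> k. (U, \<phi>) \<in> \<A> \<Longrightarrow> V \<subseteq> W \<Longrightarrow>
      Ck_on k (\<phi> ` (U \<inter> V)) (\<lambda>x. h (inv_into U \<phi> x))"
    using smooth_atE[OF assms(2)] by blast
  show ?thesis
    using V W by (intro smooth_atI[of "V \<inter> W"] Ck_on_mult chart_image_open) auto
qed

lemma smooth_at_cmult: "smooth_at \<A> p f \<Longrightarrow> smooth_at \<A> p (\<lambda>q. c * f q)"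
  using smooth_at_mult[OF smooth_at_const] .

lemma smooth_at_minus: "smooth_at \<A> p f \<Longrightarrow> smooth_at \<A> p (\<lambda>q. - f q)"
  using smooth_at_cmult[where c = "-1"] by simp

lemma smooth_at_diff:
  "smooth_at \<A> p f \<Longrightarrow> smooth_at \<A> p h \<Longrightarrow> smooth_at \<A> p (\<lambda>q. f q - h q)"
  using smooth_at_add[OF _ smooth_at_minus] by fastforce

lemma smooth_at_cong_iff:
  "\<forall>\<^sub>F q in nhds p. f q = h q \<Longrightarrow> smooth_at \<A> p f \<longleftrightarrow> smooth_at \<A> p h"
  using smooth_at_cong[where f = f and h = h] smooth_at_cong[where f = h and h = f] by (auto simp: eq_commute)

section \<open>Tangent vectors as derivations of germs\<close>

context
  fixes p v assumes v: "v \<in> tangent_space \<A> p"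
begin

lemma tangent_add:
  "smooth_at \<A> p f \<Longrightarrow> smooth_at \<A> p h \<Longrightarrow> v (\<lambda>x. f x + h x) = v f + v h"
  using v unfolding tangent_space_def by auto

lemma tangent_cmult: "smooth_at \<A> p f \<Longrightarrow> v (\<lambda>x. c * f x) = c * v f"
  using v unfolding tangent_space_def by auto

lemma tangent_mult:
  "smooth_at \<A> p f \<Longrightarrow> smooth_at \<A> p h \<Longrightarrow> v (\<lambda>x. f x * h x) = f p * v h + h p * v f"
  using v unfolding tangent_space_def by auto

lemma tangent_nonsmooth: "\<not> smooth_at \<A> p f \<Longrightarrow> v f = 0"
  using v unfolding tangent_space_def by auto

lemma tangent_minus: "smooth_at \<A> p f \<Longrightarrow> v (\<lambda>x. - f x) = - v f"
  using tangent_cmult[of f "-1"] by simp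

lemma tangent_diff:
  "smooth_at \<A> p f \<Longrightarrow> smooth_at \<A> p h \<Longrightarrow> v (\<lambda>x. f x - h x) = v f - v h"
  using tangent_add[of f "\<lambda>x. - h x"] tangent_minus[of h] smooth_at_minus by simp

lemma tangent_const: "v (\<lambda>x. c) = 0"
proof -
  \<comment> \<open>By the Leibniz rule for 1 times 1, the derivative of 1 is twice itself.\<close>
  have "v (\<lambda>x. 1) = 0"
    using tangent_mult[of "\<lambda>x. 1" "\<lambda>x. 1"] smooth_at_const by simp
  then show ?thesis
    using tangent_cmult[of "\<lambda>x. 1" c] smooth_at_const by simp
qed

text \<open>Cutting off by the indicator \<open>c\<close> of an open neighbourhood, which is smooth
  near p, makes \<open>c * f\<close> and \<open>c * h\<close> equal everywhere; the Leibniz rule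
  with \<open>c p = 1\<close> and \<open>f p = h p\<close> then compares the derivatives. Otherwise
  neither function is smooth near p and both values are 0.\<close>

lemma tangent_cong:
  assumes "\<forall>\<^sub>F q in nhds p. f q = h q"
  shows "v f = v h"
proof (cases "smooth_at \<A> p f")
  case True
  obtain W where W: "open W" "p \<in> W" "\<And>q. q \<in> W \<Longrightarrow> f q = h q"
    using assms unfolding eventually_nhds by blast
  define c :: "'a \<Rightarrow> real" where "c = indicator W"
  have "\<forall>\<^sub>F q in nhds p. 1 = c q"
    unfolding eventually_nhds c_def using W(1,2) by (auto intro!: exI[of _ W])
  then have c: "smooth_at \<A> p c"
    by (rule smooth_at_cong) (rule smooth_at_const)
  have "(\<lambda>x. c x * f x) = (\<lambda>x. c x * h x)" "c p = 1" "f p = h p"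
    using W by (auto simp: c_def indicator_def)
  moreover have "smooth_at \<A> p h" using smooth_at_cong[OF assms True] .
  ultimately show ?thesis
    using tangent_mult[OF c True] tangent_mult[OF c, of h] by simp
next
  case False
  then show ?thesis
    using tangent_nonsmooth smooth_at_cong_iff[OF assms] by simp
qed

end

lemma tangent_spaceI:
  assumes "\<And>f h. smooth_at \<A> p f \<Longrightarrow> smooth_at \<A> p h \<Longrightarrow> v (\<lambda>x. f x + h x) = v f + v h"
    "\<And>c f. smooth_at \<A> p f \<Longrightarrow> v (\<lambda>x. c * f x) = c * v f"
    "\<And>f h. smooth_at \<A> p f \<Longrightarrow> smooth_at \<A> p h \<Longrightarrow> v (\<lambda>x. f x * h x) = f p * v h + h p * v f"
    "\<And>f. \<not> smooth_at \<A> p f \<Longrightarrow> v f = 0"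
  shows "v \<in> tangent_space \<A> p"
  using assms unfolding tangent_space_def by blast

lemma subspace_tangent_space: "subspace (tangent_space \<A> p)"
  unfolding subspace_def
  by (auto intro!: tangent_spaceI simp: scaleR_fun_def tangent_add tangent_cmult tangent_mult
      tangent_nonsmooth algebra_simps)

section \<open>Vector fields near a point as a module over smooth functions\<close>

lemma vfieldI:
  assumes "\<forall>\<^sub>F q in nhds p. X q \<in> tangent_space \<A> q"
    and "\<forall>\<^sub>F q in nhds p. \<forall>f. smooth_at \<A> q f \<longrightarrow> smooth_at \<A> q (\<lambda>r. X r f)"
  shows "vfield_at \<A> p X"
  using assms unfolding section_at_iff by (auto elim: eventually_elim2)

lemma vfield_tangent: "vfield_at \<A> p X \<Longrightarrow> X p \<in> tangent_space \<A> p"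
  unfolding section_at_def vector_field_def by blast

lemma vfield_smooth: "vfield_at \<A> p X \<Longrightarrow> smooth_at \<A> p f \<Longrightarrow> smooth_at \<A> p (\<lambda>q. X q f)"
  unfolding section_at_def vector_field_def by blast

lemma vfield_add:
  assumes "vfield_at \<A> p X" "vfield_at \<A> p Y"
  shows "vfield_at \<A> p (\<lambda>q. X q + Y q)"
  using eventually_conj[OF section_at_eventually[OF assms(1)] section_at_eventually[OF assms(2)]]
  by (intro vfieldI; eventually_elim)
     (auto simp: subspace_add[OF subspace_tangent_space] vfield_tangent vfield_smooth smooth_at_add)

lemma vfield_scaleR:
  assumes "smooth_at \<A> p f" "vfield_at \<A> p X"
  shows "vfield_at \<A> p (\<lambda>q. f q *\<^sub>R X q)"
  using eventually_conj[OF smooth_at_eventually[OF assms(1)] section_at_eventually[OF assms(2)]]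
  by (intro vfieldI; eventually_elim)
     (auto simp: subspace_scale[OF subspace_tangent_space] vfield_tangent vfield_smooth
       smooth_at_mult scaleR_fun_apply)

lemma vfield_zero: "vfield_at \<A> p (\<lambda>q. 0)"
  by (rule vfieldI) (auto simp: subspace_0[OF subspace_tangent_space] smooth_at_const)

lemma vfield_sum:
  "finite B \<Longrightarrow> (\<And>b. b \<in> B \<Longrightarrow> vfield_at \<A> p (X b)) \<Longrightarrow> vfield_at \<A> p (\<lambda>q. \<Sum>b\<in>B. X b q)"
  by (induction B rule: finite_induct) (auto intro: vfield_zero vfield_add)

lemma vfield_minus: "vfield_at \<A> p X \<Longrightarrow> vfield_at \<A> p (\<lambda>q. - X q)"
  using vfield_scaleR[OF smooth_at_const[of p "-1"], of X] by simp

lemma vfield_diff: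
  "vfield_at \<A> p X \<Longrightarrow> vfield_at \<A> p Y \<Longrightarrow> vfield_at \<A> p (\<lambda>q. X q - Y q)"
  using vfield_add[OF _ vfield_minus[of p Y]] by simp

text \<open>Smoothness of the field is required at all nearby points too, so the equality is first
  spread to neighbourhoods of these points.\<close>

lemma vfield_cong:
  assumes "\<forall>\<^sub>F q in nhds p. X q = Y q" "vfield_at \<A> p X"
  shows "vfield_at \<A> p Y"
proof -
  have ev: "\<forall>\<^sub>F q in nhds p. (\<forall>\<^sub>F r in nhds q. X r = Y r) \<and> X q = Y q \<and> vfield_at \<A> q X"
    using assms(1) section_at_eventually[OF assms(2)]
    by (simp add: eventually_conj_iff eventually_eventually)
  have "smooth_at \<A> q (\<lambda>r. Y r f)"
    if "\<forall>\<^sub>F r in nhds q. X r = Y r" "vfield_at \<A> q X" "smooth_at \<A> q f" for q f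
    by (rule smooth_at_cong[OF _ vfield_smooth[OF that(2,3)]])
       (use that(1) in \<open>auto elim: eventually_mono\<close>)
  with ev show ?thesis
    by (intro vfieldI) (auto elim!: eventually_mono dest: vfield_tangent)
qed

section \<open>Lie brackets\<close>

lemma bracket_apply:
  "smooth_at \<A> p f \<Longrightarrow> bracket \<A> X Y p f = X p (\<lambda>q. Y q f) - Y p (\<lambda>q. X q f)"
  by (simp add: bracket_def)

lemma vfield_apply_add:
  assumes "vfield_at \<A> p X" "smooth_at \<A> p f" "smooth_at \<A> p h"
  shows "\<forall>\<^sub>F q in nhds p. X q (\<lambda>x. f x + h x) = X q f + X q h"
  using section_at_eventually[OF assms(1)] smooth_at_eventually[OF assms(2)]
    smooth_at_eventually[OF assms(3)]
  by eventually_elim (simp add: tangent_add[OF vfield_tangent])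

lemma vfield_apply_cmult:
  assumes "vfield_at \<A> p X" "smooth_at \<A> p f"
  shows "\<forall>\<^sub>F q in nhds p. X q (\<lambda>x. c * f x) = c * X q f"
  using section_at_eventually[OF assms(1)] smooth_at_eventually[OF assms(2)]
  by eventually_elim (simp add: tangent_cmult[OF vfield_tangent])

lemma vfield_apply_mult:
  assumes "vfield_at \<A> p X" "smooth_at \<A> p f" "smooth_at \<A> p h"
  shows "\<forall>\<^sub>F q in nhds p. X q (\<lambda>x. f x * h x) = f q * X q h + h q * X q f"
  using section_at_eventually[OF assms(1)] smooth_at_eventually[OF assms(2)]
    smooth_at_eventually[OF assms(3)]
  by eventually_elim (simp add: tangent_mult[OF vfield_tangent])

text \<open>The derivation rules for the inner field hold only near p and are moved under the outer
  derivative by \<open>tangent_cong\<close>. In the Leibniz rule the mixed products of first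
  derivatives cancel.\<close>

lemma bracket_tangent:
  assumes X: "vfield_at \<A> p X" and Y: "vfield_at \<A> p Y"
  shows "bracket \<A> X Y p \<in> tangent_space \<A> p"
proof (rule tangent_spaceI)
  note Xp = vfield_tangent[OF X] and Yp = vfield_tangent[OF Y]
  note sm = smooth_at_add smooth_at_mult smooth_at_cmult vfield_smooth[OF X] vfield_smooth[OF Y]
  fix f h c assume f: "smooth_at \<A> p f"
  show "bracket \<A> X Y p (\<lambda>x. c * f x) = c * bracket \<A> X Y p f"
    using f tangent_cong[OF Xp vfield_apply_cmult[OF Y f, of c]]
      tangent_cong[OF Yp vfield_apply_cmult[OF X f, of c]]
    by (simp add: bracket_apply sm tangent_cmult[OF Xp] tangent_cmult[OF Yp] algebra_simps)
  assume h: "smooth_at \<A> p h"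
  show "bracket \<A> X Y p (\<lambda>x. f x + h x) = bracket \<A> X Y p f + bracket \<A> X Y p h"
    using f h tangent_cong[OF Xp vfield_apply_add[OF Y f h]]
      tangent_cong[OF Yp vfield_apply_add[OF X f h]]
    by (simp add: bracket_apply sm tangent_add[OF Xp] tangent_add[OF Yp])
  show "bracket \<A> X Y p (\<lambda>x. f x * h x) = f p * bracket \<A> X Y p h + h p * bracket \<A> X Y p f"
    using f h tangent_cong[OF Xp vfield_apply_mult[OF Y f h]]
      tangent_cong[OF Yp vfield_apply_mult[OF X f h]]
    by (simp add: bracket_apply sm tangent_add[OF Xp] tangent_add[OF Yp] tangent_mult[OF Xp]
        tangent_mult[OF Yp] algebra_simps)
qed (simp add: bracket_def)

lemma vfield_bracket:
  assumes X: "vfield_at \<A> p X" and Y: "vfield_at \<A> p Y"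
  shows "vfield_at \<A> p (bracket \<A> X Y)"
proof -
  have sm: "smooth_at \<A> q (\<lambda>r. bracket \<A> X Y r f)"
    if "vfield_at \<A> q X" "vfield_at \<A> q Y" "smooth_at \<A> q f" for q f
  proof (rule smooth_at_cong)
    show "\<forall>\<^sub>F r in nhds q. X r (\<lambda>s. Y s f) - Y r (\<lambda>s. X s f) = bracket \<A> X Y r f"
      using smooth_at_eventually[OF that(3)] by eventually_elim (simp add: bracket_apply)
    show "smooth_at \<A> q (\<lambda>r. X r (\<lambda>s. Y s f) - Y r (\<lambda>s. X s f))"
      by (intro smooth_at_diff vfield_smooth[OF that(1) vfield_smooth[OF that(2,3)]]
          vfield_smooth[OF that(2) vfield_smooth[OF that(1,3)]])
  qed
  show ?thesis
    using eventually_conj[OF section_at_eventually[OF X] section_at_eventually[OF Y]]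
    by (intro vfieldI; eventually_elim) (auto simp: sm bracket_tangent)
qed

lemma bracket_antisym: "bracket \<A> Y X p = - bracket \<A> X Y p"
  by (rule ext) (simp add: bracket_def)

lemma bracket_add:
  assumes "vfield_at \<A> p X" "vfield_at \<A> p Y" "vfield_at \<A> p Z"
  shows "bracket \<A> X (\<lambda>q. Y q + Z q) p = bracket \<A> X Y p + bracket \<A> X Z p"
  by (rule ext) (simp add: bracket_def tangent_add[OF vfield_tangent[OF assms(1)]]
      vfield_smooth assms)

lemma bracket_scaleR:
  assumes "vfield_at \<A> p X" "vfield_at \<A> p Y" "smooth_at \<A> p h"
  shows "bracket \<A> X (\<lambda>q. h q *\<^sub>R Y q) p = X p h *\<^sub>R Y p + h p *\<^sub>R bracket \<A> X Y p"
proof (rule ext)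
  fix f
  show "bracket \<A> X (\<lambda>q. h q *\<^sub>R Y q) p f = (X p h *\<^sub>R Y p + h p *\<^sub>R bracket \<A> X Y p) f"
    \<comment> \<open>On a function that is not smooth at p the bracket is 0 by definition, so
      \<open>Y p f\<close> has to vanish as well.\<close>
    using tangent_nonsmooth[OF vfield_tangent[OF assms(2)], of f]
    by (simp add: bracket_def scaleR_fun_apply tangent_mult[OF vfield_tangent[OF assms(1)]]
        vfield_smooth assms algebra_simps)
qed

lemma bracket_zero: "vfield_at \<A> p X \<Longrightarrow> bracket \<A> X (\<lambda>q. 0) p = 0"
  by (rule ext) (simp add: bracket_def tangent_const[OF vfield_tangent])

lemma bracket_sum:
  assumes "vfield_at \<A> p X" "finite B" "\<And>b. b \<in> B \<Longrightarrow> vfield_at \<A> p (Y b)"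
  shows "bracket \<A> X (\<lambda>q. \<Sum>b\<in>B. Y b q) p = (\<Sum>b\<in>B. bracket \<A> X (Y b) p)"
  using assms(2,3)
  by (induction B rule: finite_induct)
     (auto simp: bracket_zero bracket_add vfield_sum assms(1))

text \<open>Expanding all brackets gives each of the six orderings of X, Y, Z applied to f twice,
  with opposite signs. The auxiliary fact \<open>br\<close> expands a bracket standing under an
  outer derivative.\<close>

lemma bracket_jacobi:
  assumes X: "vfield_at \<A> p X" and Y: "vfield_at \<A> p Y" and Z: "vfield_at \<A> p Z"
  shows "bracket \<A> X (bracket \<A> Y Z) p + bracket \<A> Y (bracket \<A> Z X) p
    + bracket \<A> Z (bracket \<A> X Y) p = 0"
proof (rule ext)
  fix f
  have br: "A p (\<lambda>q. bracket \<A> B C q f) = A p (\<lambda>q. B q (\<lambda>r. C r f)) - A p (\<lambda>q. C q (\<lambda>r. B r f))"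
    if "vfield_at \<A> p A" "vfield_at \<A> p B" "vfield_at \<A> p C" "smooth_at \<A> p f" for A B C
  proof -
    have "\<forall>\<^sub>F q in nhds p. bracket \<A> B C q f = B q (\<lambda>r. C r f) - C q (\<lambda>r. B r f)"
      using smooth_at_eventually[OF that(4)] by eventually_elim (simp add: bracket_apply)
    from tangent_cong[OF vfield_tangent[OF that(1)] this] show ?thesis
      using that by (simp add: tangent_diff[OF vfield_tangent[OF that(1)]] vfield_smooth)
  qed
  show "(bracket \<A> X (bracket \<A> Y Z) p + bracket \<A> Y (bracket \<A> Z X) p
    + bracket \<A> Z (bracket \<A> X Y) p) f = 0 f"
  proof (cases "smooth_at \<A> p f")
    case True
    then show ?thesis
      by (simp add: bracket_apply br assms vfield_smooth)
  qed (simp add: bracket_def)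
qed

text \<open>The cut-off argument of \<open>tangent_cong\<close> for fields: the indicator has value
  1 and derivative 0 at p, so its Leibniz terms reduce to the two covariant derivatives.\<close>

lemma connection_cong:
  assumes D: "linear_connection \<A> D" and v: "v \<in> tangent_space \<A> p"
    and B: "vfield_at \<A> p B" and BC: "\<forall>\<^sub>F q in nhds p. B q = C q"
  shows "D p v B = D p v C"
proof -
  obtain W where W: "open W" "p \<in> W" "\<And>q. q \<in> W \<Longrightarrow> B q = C q"
    using BC unfolding eventually_nhds by blast
  define c :: "'a \<Rightarrow> real" where "c = indicator W"
  have c1: "\<forall>\<^sub>F q in nhds p. 1 = c q"
    unfolding eventually_nhds c_def using W(1,2) by (auto intro!: exI[of _ W])
  then have c: "smooth_at \<A> p c"
    by (rule smooth_at_cong) (rule smooth_at_const)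
  have vc: "v c = 0" "c p = 1"
    using tangent_cong[OF v c1] tangent_const[OF v] W(2) by (simp_all add: c_def)
  have C: "vfield_at \<A> p C" using vfield_cong[OF BC B] .
  have leibniz: "D p v (\<lambda>q. c q *\<^sub>R E q) = v c *\<^sub>R E p + c p *\<^sub>R D p v E" if "vfield_at \<A> p E" for E
    using D v c that unfolding linear_connection_def by blast
  have "(\<lambda>q. c q *\<^sub>R B q) = (\<lambda>q. c q *\<^sub>R C q)"
    using W(3) by (auto simp: c_def indicator_def fun_eq_iff)
  then show ?thesis
    using leibniz[OF B] leibniz[OF C] vc by simp
qed

section \<open>Coordinate fields\<close>

text \<open>The partial derivative in direction b of the chart expression. The value 0 on non-smooth
  functions matches the normalization in \<open>tangent_space\<close>.\<close>

definition coord_field :: "'a set \<Rightarrow> ('a \<Rightarrow> 'e) \<Rightarrow> 'e \<Rightarrow> 'a vfield" where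
  "coord_field U \<phi> b q = (\<lambda>f. if smooth_at \<A> q f
     then frechet_derivative (\<lambda>x. f (inv_into U \<phi> x)) (at (\<phi> q)) b else 0)"

lemma smooth_at_chart_derivative:
  assumes "(U, \<phi>) \<in> \<A>" "q \<in> U" "smooth_at \<A> q f"
  shows "((\<lambda>x. f (inv_into U \<phi> x)) has_derivative
    (\<lambda>b. coord_field U \<phi> b q f)) (at (\<phi> q))"
proof -
  obtain W where W: "open W" "q \<in> W" "\<And>V U \<phi> k. (U, \<phi>) \<in> \<A> \<Longrightarrow> V \<subseteq> W \<Longrightarrow>
      Ck_on k (\<phi> ` (U \<inter> V)) (\<lambda>x. f (inv_into U \<phi> x))"
    using smooth_atE[OF assms(3)] by blast
  have "(\<lambda>x. f (inv_into U \<phi> x)) differentiable (at (\<phi> q))"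
    using W(3)[OF assms(1) order_refl, of "Suc 0"] W(2) assms(2) by auto
  then show ?thesis
    using assms(3) by (simp add: coord_field_def frechet_derivative_works)
qed

lemma coord_field_eqI:
  assumes "(U, \<phi>) \<in> \<A>" "q \<in> U" "smooth_at \<A> q f"
    "((\<lambda>x. f (inv_into U \<phi> x)) has_derivative F) (at (\<phi> q))"
  shows "coord_field U \<phi> b q f = F b"
  using has_derivative_unique[OF smooth_at_chart_derivative[OF assms(1-3)] assms(4)] by metis

lemma coord_field_tangent:
  assumes c: "(U, \<phi>) \<in> \<A>" "q \<in> U"
  shows "coord_field U \<phi> b q \<in> tangent_space \<A> q"
proof (rule tangent_spaceI)
  note d = smooth_at_chart_derivative[OF c]
  fix f h r assume f: "smooth_at \<A> q f"
  show "coord_field U \<phi> b q (\<lambda>x. r * f x) = r * coord_field U \<phi> b q f"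
    by (rule coord_field_eqI[OF c smooth_at_cmult[OF f] has_derivative_mult_right[OF d[OF f]]])
  assume h: "smooth_at \<A> q h"
  show "coord_field U \<phi> b q (\<lambda>x. f x + h x) = coord_field U \<phi> b q f + coord_field U \<phi> b q h"
    by (rule coord_field_eqI[OF c smooth_at_add[OF f h] has_derivative_add[OF d[OF f] d[OF h]]])
  have "coord_field U \<phi> b q (\<lambda>x. f x * h x)
      = f (inv_into U \<phi> (\<phi> q)) * coord_field U \<phi> b q h
        + coord_field U \<phi> b q f * h (inv_into U \<phi> (\<phi> q))"
    by (rule coord_field_eqI[OF c smooth_at_mult[OF f h] has_derivative_mult[OF d[OF f] d[OF h]]])
  then show "coord_field U \<phi> b q (\<lambda>x. f x * h x)
      = f q * coord_field U \<phi> b q h + h q * coord_field U \<phi> b q f"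
    using chart_inv[OF c] by simp
qed (simp add: coord_field_def)

text \<open>Seen in another chart, the result is the directional derivative taken in
  \<open>\<phi>\<close>, composed with the transition map; \<open>Ck_on_compose\<close> applies.
  Regularity of order k of the derivative comes from order \<open>Suc k\<close> of f.\<close>

lemma coord_field_smooth:
  assumes c: "(U, \<phi>) \<in> \<A>" and p: "p \<in> U" and f: "smooth_at \<A> p f"
  shows "smooth_at \<A> p (\<lambda>q. coord_field U \<phi> b q f)"
proof -
  obtain W where W: "open W" "p \<in> W" "\<And>V U \<phi> k. (U, \<phi>) \<in> \<A> \<Longrightarrow> V \<subseteq> W \<Longrightarrow>
      Ck_on k (\<phi> ` (U \<inter> V)) (\<lambda>x. f (inv_into U \<phi> x))"
    using smooth_atE[OF f] by blast
  let ?F = "\<lambda>x. frechet_derivative (\<lambda>x. f (inv_into U \<phi> x)) (at x) b"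
  have sm: "smooth_at \<A> q f" if "q \<in> W" for q
    using smooth_atI[OF W(1) that W(3)] by blast
  have F: "Ck_on k (\<phi> ` (U \<inter> W)) ?F" for k
    using W(3)[OF c order_refl, of "Suc k"] by simp
  show ?thesis
  proof (rule smooth_atI[of "U \<inter> W"])
    show "open (U \<inter> W)" using W(1) chart(1)[OF c] by auto
    show "p \<in> U \<inter> W" using W p by auto
    fix U' \<psi> k assume c': "(U', \<psi>) \<in> \<A>"
    let ?S = "\<psi> ` (U' \<inter> (U \<inter> W))"
    have S: "open ?S" using chart_image_open[OF c'] W(1) chart(1)[OF c] by auto
    show "Ck_on k ?S (\<lambda>x. coord_field U \<phi> b (inv_into U' \<psi> x) f)"
    proof (rule Ck_on_cong[OF S])
      have G: "Ck_on k ?S (\<lambda>x. \<phi> (inv_into U' \<psi> x))"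
        using Ck_on_subset[OF chart_transition[OF c' c], of ?S k] by (auto simp: comp_def)
      show "Ck_on k ?S (\<lambda>x. ?F (\<phi> (inv_into U' \<psi> x)))"
        by (rule Ck_on_compose[OF S chart_image_open[OF c W(1)] _ F G])
          (use chart_inv[OF c'] in auto)
      show "?F (\<phi> (inv_into U' \<psi> x)) = coord_field U \<phi> b (inv_into U' \<psi> x) f" if "x \<in> ?S" for x
        using that chart_inv[OF c'] sm by (auto simp: coord_field_def)
    qed
  qed
qed

lemma vfield_coord_field:
  assumes "(U, \<phi>) \<in> \<A>" "p \<in> U"
  shows "vfield_at \<A> p (coord_field U \<phi> b)"
proof -
  have "\<forall>\<^sub>F q in nhds p. q \<in> U"
    using chart(1)[OF assms(1)] assms(2) by (rule eventually_nhds_in_open)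
  then show ?thesis
    by (intro vfieldI; eventually_elim)
      (auto intro: coord_field_tangent coord_field_smooth assms(1))
qed

lemma coord_field_coordinate:
  assumes c: "(U, \<phi>) \<in> \<A>" and p: "p \<in> U"
  shows "coord_field U \<phi> b p (\<lambda>q. \<phi> q \<bullet> b') = b \<bullet> b'"
proof (rule coord_field_eqI[OF c p])
  show "smooth_at \<A> p (\<lambda>q. \<phi> q \<bullet> b')"
  proof (rule smooth_atI[OF chart(1)[OF c] p])
    fix U' \<psi> k assume c': "(U', \<psi>) \<in> \<A>"
    show "Ck_on k (\<psi> ` (U' \<inter> U)) (\<lambda>x. \<phi> (inv_into U' \<psi> x) \<bullet> b')"
      using chart_transition[OF c' c]
      by (intro Ck_on_inner chart_image_open[OF c'] chart(1)[OF c]) (auto simp: comp_def)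
  qed
  show "((\<lambda>x. \<phi> (inv_into U \<phi> x) \<bullet> b') has_derivative (\<lambda>b. b \<bullet> b')) (at (\<phi> p))"
    by (rule has_derivative_transform_within_open[where f = "\<lambda>x. x \<bullet> b'" and s = "\<phi> ` U"])
      (use p chart(2)[OF c] in \<open>auto simp: chart_inv[OF c] intro!: derivative_eq_intros\<close>)
qed

text \<open>Counting dimensions replaces Hadamard's lemma: the coordinate fields are independent at
  each point, so they span any tangent space of dimension at most \<open>DIM('e)\<close>.\<close>

lemma tangent_subset_span_coord:
  assumes c: "(U, \<phi>) \<in> \<A>" and p: "p \<in> U"
    and B: "tangent_space \<A> p \<subseteq> span B" "finite B" "card B \<le> DIM('e)"
  shows "tangent_space \<A> p \<subseteq> span ((\<lambda>b. coord_field U \<phi> b p) ` Basis)"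
proof
  let ?c = "\<lambda>b. coord_field U \<phi> b p"
  have val: "?c b (\<lambda>q. \<phi> q \<bullet> b') = (if b = b' then 1 else 0)" if "b \<in> Basis" "b' \<in> Basis" for b b'
    using coord_field_coordinate[OF c p] that by (simp add: inner_Basis)
  have inj: "inj_on ?c Basis"
    by (rule inj_onI) (metis val zero_neq_one)
  have ind: "independent (?c ` Basis)"
  proof (rule ccontr)
    assume "\<not> independent (?c ` Basis)"
    then obtain u w where w: "w \<in> ?c ` Basis" "u w \<noteq> 0" and z: "(\<Sum>v\<in>?c ` Basis. u v *\<^sub>R v) = 0"
      using dependent_finite[of "?c ` Basis"] by auto
    then obtain b' where b': "b' \<in> Basis" "w = ?c b'" by auto
    \<comment> \<open>Evaluating the vanishing combination on the coordinate function of
      \<open>b'\<close> isolates the coefficient of \<open>?c b'\<close>.\<close>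
    have "0 = (\<Sum>b\<in>Basis. u (?c b) *\<^sub>R ?c b) (\<lambda>q. \<phi> q \<bullet> b')"
      using z by (simp add: sum.reindex[OF inj])
    also have "\<dots> = (\<Sum>b\<in>Basis. if b = b' then u (?c b') else 0)"
      unfolding sum_fun_apply by (rule sum.cong) (auto simp: scaleR_fun_apply val b')
    finally show False using w(2) b' by simp
  qed
  fix u assume u: "u \<in> tangent_space \<A> p"
  show "u \<in> span (?c ` Basis)"
  proof (rule ccontr)
    assume nu: "u \<notin> span (?c ` Basis)"
    then have "independent (insert u (?c ` Basis))"
      using ind by (simp add: independent_insert)
    moreover have "insert u (?c ` Basis) \<subseteq> span B"
      using u coord_field_tangent[OF c p] B(1) by auto
    ultimately have "card (insert u (?c ` Basis)) \<le> card B"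
      using independent_span_bound[OF B(2)] by blast
    moreover have "card (insert u (?c ` Basis)) = Suc DIM('e)"
      using nu span_base[of u "?c ` Basis"] by (auto simp: card_insert_if card_image[OF inj])
    ultimately show False using B(3) by simp
  qed
qed

text \<open>The values at p of fields defined near p form a subspace containing the coordinate
  vectors, and these span the tangent space under the dimension bound.\<close>

lemma tangent_extension:
  assumes B: "tangent_space \<A> p \<subseteq> span B" "finite B" "card B \<le> DIM('e)"
    and u: "u \<in> tangent_space \<A> p"
  obtains X where "vfield_at \<A> p X" "X p = u"
proof -
  let ?E = "{u. \<exists>X. vfield_at \<A> p X \<and> X p = u}"
  obtain U \<phi> where c: "(U, \<phi>) \<in> \<A>" "p \<in> U" by (rule chart_at)
  have "subspace ?E"
    unfolding subspace_def
  proof (intro conjI ballI allI)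
    show "0 \<in> ?E" using vfield_zero by auto
    fix x y a assume x: "x \<in> ?E"
    show "a *\<^sub>R x \<in> ?E" using x vfield_scaleR[OF smooth_at_const] by auto
    assume y: "y \<in> ?E"
    show "x + y \<in> ?E" using x y vfield_add by auto
  qed
  moreover have "(\<lambda>b. coord_field U \<phi> b p) ` Basis \<subseteq> ?E"
    using vfield_coord_field[OF c] by auto
  ultimately have "span ((\<lambda>b. coord_field U \<phi> b p) ` Basis) \<subseteq> ?E"
    by (rule span_minimal[rotated])
  then show ?thesis
    using tangent_subset_span_coord[OF c B] u that by auto
qed

end

section \<open>Paraquaternionic contact structures\<close>

lemma eps_sq: "eps s * eps s = 1"
  by (simp add: eps_def)

lemma cyclic_rotate: "cyclic i j k \<Longrightarrow> cyclic j k i"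
  by (auto simp: cyclic_def)

lemma cyclic_ix:
  assumes "cyclic i j k"
  shows "i \<in> {1,2,3}" "j \<in> {1,2,3}" "k \<in> {1,2,3}" "i \<noteq> j" "j \<noteq> k" "i \<noteq> k" "{1,2,3} = {i,j,k}"
  using assms by (auto simp: cyclic_def)

lemma sum_cyclic:
  fixes f :: "nat \<Rightarrow> 'b::ab_group_add"
  assumes "cyclic i j k"
  shows "(\<Sum>s\<in>{1,2,3}. f s) = f i + f j + f k"
  using cyclic_ix[OF assms] by (simp add: add.assoc)

lemma lin_on_add: "lin_on S f \<Longrightarrow> u \<in> S \<Longrightarrow> v \<in> S \<Longrightarrow> f (u + v) = f u + f v"
  unfolding lin_on_def by (metis scaleR_one)

lemma lin_on_scaleR: "lin_on S f \<Longrightarrow> u \<in> S \<Longrightarrow> f (a *\<^sub>R u) = a *\<^sub>R f u"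
  unfolding lin_on_def by (metis add.right_neutral scaleR_zero_left)

lemma lin_on_minus: "lin_on S f \<Longrightarrow> u \<in> S \<Longrightarrow> f (- u) = - f u"
  using lin_on_scaleR[of S f u "-1"] by simp

lemma lin_on_diff: "lin_on S f \<Longrightarrow> u \<in> S \<Longrightarrow> v \<in> S \<Longrightarrow> f (u - v) = f u - f v"
  unfolding lin_on_def
  by (metis (no_types, opaque_lifting) add_uminus_conv_diff scaleR_minus1_left scaleR_one)

lemma lin_on_zero: "lin_on S f \<Longrightarrow> u \<in> S \<Longrightarrow> f 0 = 0"
  using lin_on_scaleR[of S f u 0] by simp

lemma lin_on_sum:
  assumes "lin_on S f" "subspace S" "finite B" "\<And>b. b \<in> B \<Longrightarrow> x b \<in> S"
  shows "f (\<Sum>b\<in>B. x b) = (\<Sum>b\<in>B. f (x b))"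
  using assms(3,4)
  by (induction B rule: finite_induct)
     (auto simp: lin_on_zero[OF assms(1) subspace_0[OF assms(2)]] lin_on_add[OF assms(1)]
       subspace_sum[OF assms(2)])

text \<open>Exactly one of the three signs is negative. Identities such as
  \<open>eps i * eps j = - eps k\<close> are settled by running through these cases.\<close>

lemma eps_cases:
  assumes "cyclic i j k"
  obtains "eps i = 1" "eps j = 1" "eps k = -1" | "eps i = 1" "eps j = -1" "eps k = 1"
    | "eps i = -1" "eps j = 1" "eps k = 1"
  using assms by (auto simp: cyclic_def eps_def)

section \<open>Linearity of the metric trace\<close>

lemma gtrace_cong:
  "(\<And>a. a < 4 * n \<Longrightarrow> P (e a) (e a) = Q (e a) (e a)) \<Longrightarrow> gtrace n g p e P = gtrace n g p e Q"
  by (simp add: gtrace_def)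

lemma gtrace_add:
  "gtrace n g p e (\<lambda>X Y. P X Y + Q X Y) = gtrace n g p e P + gtrace n g p e Q"
  by (simp add: gtrace_def sum.distrib distrib_left)

lemma gtrace_cmult: "gtrace n g p e (\<lambda>X Y. c * P X Y) = c * gtrace n g p e P"
  by (simp add: gtrace_def sum_distrib_left mult.left_commute)

lemma gtrace_sum:
  "gtrace n g p e (\<lambda>X Y. \<Sum>b\<in>B. P b X Y) = (\<Sum>b\<in>B. gtrace n g p e (P b))"
  unfolding gtrace_def sum_distrib_left by (rule sum.swap)

locale pqc_connection =
  fixes \<A> :: "('a::{t2_space,second_countable_topology}, 'e::euclidean_space) atlas"
    and n :: nat
    and H :: "'a \<Rightarrow> 'a tvec set"
    and G :: "'a form2 set"
    and PQ :: "'a \<Rightarrow> ('a tvec \<Rightarrow> 'a tvec) set"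
    and g :: "'a form2"
    and U :: "'a set"
    and \<eta> :: "nat \<Rightarrow> 'a form1"
    and I :: "nat \<Rightarrow> 'a endo"
    and \<xi> :: "nat \<Rightarrow> 'a vfield"
    and D :: "'a conn"
    and \<alpha> :: "nat \<Rightarrow> 'a form1"
  assumes pqc: "pqc_manifold \<A> n H G PQ"
    and gG: "g \<in> G"
    and ld: "local_data \<A> H g PQ U \<eta> I"
    and rf: "reeb_fields \<A> H U \<eta> \<xi>"
    and cc: "canonical_pqc_connection \<A> n H g PQ D"
    and cf: "connection_forms \<A> H U I D \<alpha>"

sublocale pqc_connection \<subseteq> smooth_manifold \<A>
  using pqc by unfold_locales (simp add: pqc_manifold_def)

context pqc_connection
begin

declare One_nat_def [simp del]

abbreviation hp :: "'a \<Rightarrow> 'a tvec \<Rightarrow> 'a tvec" where "hp \<equiv> hpart \<eta> \<xi>"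

abbreviation hsection :: "'a \<Rightarrow> 'a vfield \<Rightarrow> bool" where "hsection \<equiv> section_at \<A> H"

section \<open>The horizontal metric and the endomorphisms \<open>I s\<close>\<close>

lemma n_pos: "n \<ge> 1" and dim_model: "DIM('e) = 4 * n + 3"
  using pqc by (auto simp: pqc_manifold_def)

lemma subspace_H: "subspace (H p)" and dim_H: "dim (H p) = 4 * n"
  and H_tangent: "u \<in> H p \<Longrightarrow> u \<in> tangent_space \<A> p"
  using pqc by (auto simp: pqc_manifold_def)

lemma open_U: "open U"
  using ld by (simp add: local_data_def)

lemma eventually_U: "p \<in> U \<Longrightarrow> \<forall>\<^sub>F q in nhds p. q \<in> U"
  using open_U by (rule eventually_nhds_in_open)

text \<open>The metric axioms are known for a reference metric of the conformal class. On H the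
  metric g is a positive multiple of it, and the algebraic properties of g are transferred through
  this factor.\<close>

lemma conformal_factor:
  obtains g0 f where "hor_metric \<A> n H g0" "\<And>p. f p > 0"
    "\<And>p u v. u \<in> H p \<Longrightarrow> v \<in> H p \<Longrightarrow> g p u v = f p * g0 p u v"
proof -
  obtain g0 where "hor_metric \<A> n H g0" and
    "G = {g. \<exists>f. smooth_fun \<A> UNIV f \<and> (\<forall>p. f p > 0) \<and>
               (\<forall>p. \<forall>u\<in>H p. \<forall>v\<in>H p. g p u v = f p * g0 p u v)}"
    using pqc unfolding pqc_manifold_def conformal_class_def by blast
  with gG that show ?thesis by blast
qed

lemma g_sym: "u \<in> H p \<Longrightarrow> v \<in> H p \<Longrightarrow> g p u v = g p v u"
  by (rule conformal_factor) (auto simp: hor_metric_def)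

lemma g_lin: "u \<in> H p \<Longrightarrow> lin_on (H p) (g p u)"
proof -
  assume u: "u \<in> H p"
  obtain g0 f where g0: "hor_metric \<A> n H g0" and
    f: "\<And>p u v. u \<in> H p \<Longrightarrow> v \<in> H p \<Longrightarrow> g p u v = f p * g0 p u v"
    by (rule conformal_factor) blast
  have "lin_on (H p) (g0 p u)" using g0 u by (simp add: hor_metric_def)
  then show ?thesis
    using u subspace_H[of p]
    by (simp add: lin_on_def f subspace_add subspace_scale algebra_simps)
qed

lemma g_zero: "u \<in> H p \<Longrightarrow> g p u 0 = 0" "u \<in> H p \<Longrightarrow> g p 0 u = 0"
  using lin_on_zero[OF g_lin] g_sym[of _ p 0] subspace_0[OF subspace_H] by auto

lemma g_add:
  assumes "u \<in> H p" "v \<in> H p" "w \<in> H p"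
  shows "g p u (v + w) = g p u v + g p u w" "g p (v + w) u = g p v u + g p w u"
  using assms lin_on_add[OF g_lin, of u p] g_sym[of _ p u] subspace_add[OF subspace_H] by auto

lemma g_diff:
  assumes "u \<in> H p" "v \<in> H p" "w \<in> H p"
  shows "g p u (v - w) = g p u v - g p u w" "g p (v - w) u = g p v u - g p w u"
  using assms lin_on_diff[OF g_lin, of u p] g_sym[of _ p u] subspace_diff[OF subspace_H] by auto

lemma g_scaleR:
  assumes "u \<in> H p" "v \<in> H p"
  shows "g p u (a *\<^sub>R v) = a * g p u v" "g p (a *\<^sub>R v) u = a * g p v u"
  using assms lin_on_scaleR[OF g_lin, of u p] g_sym[of _ p u] subspace_scale[OF subspace_H] by auto

lemma g_minus:
  assumes "u \<in> H p" "v \<in> H p"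
  shows "g p u (- v) = - g p u v" "g p (- v) u = - g p v u"
  using assms lin_on_minus[OF g_lin, of u p] g_sym[of _ p u] subspace_neg[OF subspace_H] by auto

lemma H_zero: "0 \<in> H p"
  using subspace_0[OF subspace_H] .

context
  fixes s assumes s: "s \<in> {1,2,3::nat}"
begin

lemma one_form_eta: "one_form \<A> U (\<eta> s)"
  using ld s unfolding local_data_def by fast

lemma end_field_I: "end_field \<A> H U (I s)"
  using ld s unfolding local_data_def by fast

lemma vector_field_xi: "vector_field \<A> U (\<xi> s)"
  using rf s unfolding reeb_fields_def by blast

lemma smooth_eta: "p \<in> U \<Longrightarrow> vfield_at \<A> p X \<Longrightarrow> smooth_at \<A> p (\<lambda>q. \<eta> s q (X q))"
  using one_form_eta unfolding one_form_def by blast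

context
  fixes p assumes p: "p \<in> U"
begin

lemma vfield_xi: "vfield_at \<A> p (\<xi> s)"
  using vector_field_imp_vfield_at[OF vector_field_xi open_U p] .

lemma eta_lin: "lin_on (tangent_space \<A> p) (\<eta> s p)"
  using one_form_eta p unfolding one_form_def by blast

lemma eta_H: "u \<in> H p \<Longrightarrow> \<eta> s p u = 0"
  using ld s p unfolding local_data_def by blast

lemma I_lin: "lin_on (H p) (I s p)"
  using end_field_I p unfolding end_field_def hor_end_def by blast

lemma I_H: "u \<in> H p \<Longrightarrow> I s p u \<in> H p"
  using end_field_I p unfolding end_field_def hor_end_def by blast

lemma I_sq: "u \<in> H p \<Longrightarrow> I s p (I s p u) = eps s *\<^sub>R u"
  using ld s p unfolding local_data_def by blast

lemma I_iso: "u \<in> H p \<Longrightarrow> v \<in> H p \<Longrightarrow> g p (I s p u) (I s p v) = - eps s * g p u v"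
  using ld s p unfolding local_data_def by blast

text \<open>Put \<open>I s p u\<close> in place of u in \<open>I_iso\<close>, use
  \<open>I_sq\<close>, and cancel the sign \<open>eps s\<close>.\<close>

lemma I_skew:
  assumes u: "u \<in> H p" and v: "v \<in> H p"
  shows "g p (I s p u) v = - g p u (I s p v)"
proof -
  have "- eps s * g p (I s p u) v = eps s * g p u (I s p v)"
    using I_iso[of "I s p u" v] I_sq[OF u] u v by (simp add: I_H g_scaleR)
  then show ?thesis by (simp add: eps_def split: if_splits)
qed

lemma I_self: "u \<in> H p \<Longrightarrow> g p (I s p u) u = 0"
  using I_skew[of u u] g_sym[of "I s p u" p u] I_H by simp

lemma I_hor:
  assumes "section_at \<A> H p X"
  shows "section_at \<A> H p (\<lambda>q. I s q (X q))"
proof (rule section_at_vfieldI)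
  show "vfield_at \<A> p (\<lambda>q. I s q (X q))"
    using end_field_I p assms unfolding end_field_def by blast
  show "\<forall>\<^sub>F q in nhds p. I s q (X q) \<in> H q"
    using section_at_eventually[OF assms] eventually_U[OF p]
    by eventually_elim
      (use end_field_I in \<open>auto simp: end_field_def hor_end_def dest: section_at_mem\<close>)
qed

end

end

lemma H_I:
  assumes "p \<in> U" "v \<in> tangent_space \<A> p" "\<And>s. s \<in> {1,2,3} \<Longrightarrow> \<eta> s p v = 0"
  shows "v \<in> H p"
proof -
  have "H p = {v \<in> tangent_space \<A> p. \<forall>s\<in>{1,2,3}. \<eta> s p v = 0}"
    using ld assms(1) unfolding local_data_def by blast
  with assms(2,3) show ?thesis by blast
qed

lemma eta_xi: "p \<in> U \<Longrightarrow> s \<in> {1,2,3} \<Longrightarrow> t \<in> {1,2,3} \<Longrightarrow> \<eta> s p (\<xi> t p) = (if s = t then 1 else 0)"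
  using rf unfolding reeb_fields_def by blast

lemma I_cyclic:
  assumes "cyclic i j k" "p \<in> U" "u \<in> H p"
  shows "I i p (I j p u) = - eps k *\<^sub>R I k p u" "I j p (I i p u) = eps k *\<^sub>R I k p u"
  using ld assms unfolding local_data_def by blast+

section \<open>The splitting of the tangent space into H and V\<close>

lemma vfield_H: "hsection p X \<Longrightarrow> vfield_at \<A> p X"
  by (rule section_at_mono)

lemma xi_tangent: "p \<in> U \<Longrightarrow> s \<in> {1,2,3} \<Longrightarrow> \<xi> s p \<in> tangent_space \<A> p"
  by (rule vfield_tangent[OF vfield_xi])

lemma vpart_tangent: "p \<in> U \<Longrightarrow> vpart \<eta> \<xi> p v \<in> tangent_space \<A> p"
  unfolding vpart_def
  by (intro subspace_sum[OF subspace_tangent_space] subspace_scale[OF subspace_tangent_space]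
      xi_tangent)

lemma eta_sum_xi:
  assumes "p \<in> U" "t \<in> {1,2,3}"
  shows "\<eta> t p (\<Sum>s\<in>{1,2,3}. c s *\<^sub>R \<xi> s p) = c t"
proof -
  have "\<eta> t p (\<Sum>s\<in>{1,2,3}. c s *\<^sub>R \<xi> s p) = (\<Sum>s\<in>{1,2,3}. \<eta> t p (c s *\<^sub>R \<xi> s p))"
    by (rule lin_on_sum[OF eta_lin[OF assms(2,1)] subspace_tangent_space])
      (auto simp: assms subspace_scale[OF subspace_tangent_space] xi_tangent)
  also have "\<dots> = (\<Sum>s\<in>{1,2,3}. if s = t then c t else 0)"
  proof (rule sum.cong[OF refl])
    fix s :: nat assume s: "s \<in> {1,2,3}"
    show "\<eta> t p (c s *\<^sub>R \<xi> s p) = (if s = t then c t else 0)"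
      using lin_on_scaleR[OF eta_lin[OF assms(2,1)] xi_tangent[OF assms(1) s]]
        eta_xi[OF assms s] by auto
  qed
  also have "\<dots> = c t" using assms(2) by (subst sum.delta) auto
  finally show ?thesis .
qed

lemma hp_H: "p \<in> U \<Longrightarrow> u \<in> H p \<Longrightarrow> hp p u = u"
  by (simp add: hpart_def vpart_def eta_H)

lemma hp_in_H:
  assumes "p \<in> U" "v \<in> tangent_space \<A> p"
  shows "hp p v \<in> H p"
proof (rule H_I[OF assms(1)])
  show "hp p v \<in> tangent_space \<A> p"
    unfolding hpart_def
    by (rule subspace_diff[OF subspace_tangent_space assms(2) vpart_tangent[OF assms(1)]])
  fix t :: nat assume t: "t \<in> {1,2,3}"
  show "\<eta> t p (hp p v) = 0"
    unfolding hpart_def lin_on_diff[OF eta_lin[OF t assms(1)] assms(2) vpart_tangent[OF assms(1)]]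
    by (simp only: vpart_def eta_sum_xi[OF assms(1) t] diff_self)
qed

lemma hp_lin:
  assumes "p \<in> U" "u \<in> tangent_space \<A> p" "v \<in> tangent_space \<A> p"
  shows "hp p (u - v) = hp p u - hp p v"
  unfolding hpart_def vpart_def
  by (simp add: lin_on_diff[OF eta_lin] assms algebra_simps)

lemma hp_vert:
  assumes "p \<in> U" "v \<in> vert \<xi> p"
  shows "hp p v = 0" "v \<in> tangent_space \<A> p"
    "v = (\<Sum>s\<in>{1,2,3}. \<eta> s p v *\<^sub>R \<xi> s p)"
proof -
  \<comment> \<open>The span is first written as explicit combinations of the Reeb vectors; the
    forms \<open>\<eta> s\<close> then read off the coefficients.\<close>
  have "vert \<xi> p \<subseteq> {v. \<exists>c. v = (\<Sum>s\<in>{1,2,3}. c s *\<^sub>R \<xi> s p)}"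
    unfolding vert_def
  proof (rule span_minimal)
    show "subspace {v. \<exists>c. v = (\<Sum>s\<in>{1,2,3::nat}. c s *\<^sub>R \<xi> s p)}" (is "subspace ?E")
      unfolding subspace_def
    proof (intro conjI ballI allI)
      show "0 \<in> ?E" by (auto intro!: exI[of _ "\<lambda>_. 0"])
      fix x y a assume x: "x \<in> ?E"
      then obtain c where c: "x = (\<Sum>s\<in>{1,2,3}. c s *\<^sub>R \<xi> s p)" by blast
      have "a *\<^sub>R x = (\<Sum>s\<in>{1,2,3}. (a * c s) *\<^sub>R \<xi> s p)"
        unfolding c scaleR_sum_right by (simp add: scaleR_scaleR)
      then show "a *\<^sub>R x \<in> ?E" by (intro CollectI exI)
      assume "y \<in> ?E"
      then obtain d where d: "y = (\<Sum>s\<in>{1,2,3}. d s *\<^sub>R \<xi> s p)" by blast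
      have "x + y = (\<Sum>s\<in>{1,2,3}. (c s + d s) *\<^sub>R \<xi> s p)"
        unfolding c d by (simp only: scaleR_add_left sum.distrib)
      then show "x + y \<in> ?E" by (intro CollectI exI)
    qed
    have "\<xi> t p \<in> ?E" if "t \<in> {1,2,3}" for t
    proof -
      have "(\<Sum>s\<in>{1,2,3}. (if s = t then 1 else 0) *\<^sub>R \<xi> s p)
          = (\<Sum>s\<in>{1,2,3}. if s = t then \<xi> t p else 0)"
        by (rule sum.cong) auto
      also have "\<dots> = \<xi> t p" using that by (subst sum.delta) auto
      finally show ?thesis by (intro CollectI exI) (rule sym)
    qed
    then show "{\<xi> 1 p, \<xi> 2 p, \<xi> 3 p} \<subseteq> ?E"
      by (intro insert_subsetI empty_subsetI) simp_all
  qed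
  then obtain c where c: "v = (\<Sum>s\<in>{1,2,3}. c s *\<^sub>R \<xi> s p)"
    using assms(2) by (auto dest!: subsetD)
  show v: "v = (\<Sum>s\<in>{1,2,3}. \<eta> s p v *\<^sub>R \<xi> s p)"
  proof -
    have "(\<Sum>s\<in>{1,2,3}. \<eta> s p v *\<^sub>R \<xi> s p) = (\<Sum>s\<in>{1,2,3}. c s *\<^sub>R \<xi> s p)"
      by (rule sum.cong[OF refl]) (simp only: c eta_sum_xi[OF assms(1)])
    with c show ?thesis by simp
  qed
  show "hp p v = 0" by (simp only: hpart_def vpart_def v[symmetric] diff_self)
  show "v \<in> tangent_space \<A> p"
    using vpart_tangent[OF assms(1), of v] v by (simp only: vpart_def)
qed

lemma xi_vert: "s \<in> {1,2,3} \<Longrightarrow> \<xi> s p \<in> vert \<xi> p"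
  unfolding vert_def by (rule span_base) auto

lemma section_xi: "p \<in> U \<Longrightarrow> s \<in> {1,2,3} \<Longrightarrow> section_at \<A> (vert \<xi>) p (\<xi> s)"
  by (rule section_at_vfieldI[OF vfield_xi]) (auto simp: xi_vert)

lemma hp_field:
  assumes "p \<in> U" "vfield_at \<A> p X"
  shows "hsection p (\<lambda>q. hp q (X q))"
proof (rule section_at_vfieldI)
  show "vfield_at \<A> p (\<lambda>q. hp q (X q))"
    unfolding hpart_def vpart_def
    by (intro vfield_diff assms vfield_sum vfield_scaleR smooth_eta vfield_xi) auto
  show "\<forall>\<^sub>F q in nhds p. hp q (X q) \<in> H q"
    using section_at_eventually[OF assms(2)] eventually_U[OF assms(1)]
    by eventually_elim (auto intro: hp_in_H vfield_tangent)
qed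

text \<open>A basis of \<open>H p\<close> and the three Reeb vectors together span the tangent space
  with at most \<open>4 * n + 3\<close> vectors, so u extends to a field. Its horizontal projection
  is horizontal near p and has the same value at p.\<close>

lemma H_extension:
  assumes p: "p \<in> U" and u: "u \<in> H p"
  obtains X where "hsection p X" "X p = u"
proof -
  obtain B where B: "B \<subseteq> H p" "H p \<subseteq> span B" "card B = dim (H p)"
    by (rule basis_exists[of "H p"])
  \<comment> \<open>An infinite set has \<open>card\<close> 0, while here the cardinality is
    \<open>4 * n > 0\<close>.\<close>
  have fin: "finite B"
    using B(3) dim_H n_pos by (metis card.infinite mult_is_0 not_one_le_zero zero_neq_numeral)
  let ?B = "B \<union> (\<lambda>s. \<xi> s p) ` {1,2,3}"
  have "tangent_space \<A> p \<subseteq> span ?B"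
  proof
    fix v assume v: "v \<in> tangent_space \<A> p"
    have "hp p v \<in> span ?B"
      using hp_in_H[OF p v] B(2) span_mono[of B ?B] by blast
    moreover have "vpart \<eta> \<xi> p v \<in> span ?B"
      unfolding vpart_def by (intro span_sum span_scale span_base) auto
    ultimately have "hp p v + vpart \<eta> \<xi> p v \<in> span ?B"
      by (rule span_add)
    then show "v \<in> span ?B" by (simp add: hpart_def)
  qed
  moreover have "card ?B \<le> DIM('e)"
    using card_Un_le[of B "(\<lambda>s. \<xi> s p) ` {1,2,3}"] card_image_le[of "{1,2,3::nat}" "\<lambda>s. \<xi> s p"]
    by (simp add: B(3) dim_H dim_model)
  moreover have "finite ?B" using fin by simp
  ultimately obtain X where X: "vfield_at \<A> p X" "X p = u"
    using tangent_extension[OF _ _ _ H_tangent[OF u]] by metis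
  show ?thesis
    by (rule that[OF hp_field[OF p X(1)]]) (simp add: X(2) hp_H p u)
qed

text \<open>An orthonormal basis of the reference metric is divided by the square root of the
  conformal factor, and each vector is extended to a horizontal field.\<close>

lemma orthonormal_basis_exists:
  assumes p: "p \<in> U"
  obtains e where "orthonormal_basis_at \<A> n H g p e"
proof -
  obtain g0 f where g0: "hor_metric \<A> n H g0" and f: "\<And>p. f p > 0"
    "\<And>p u v. u \<in> H p \<Longrightarrow> v \<in> H p \<Longrightarrow> g p u v = f p * g0 p u v"
    by (rule conformal_factor) blast
  obtain e :: "nat \<Rightarrow> 'a tvec" where e: "span (e ` {..<4*n}) = H p"
    "\<And>a b. a < 4*n \<Longrightarrow> b < 4*n \<Longrightarrow>
      g0 p (e a) (e b) = (if a \<noteq> b then 0 else if a < 2*n then 1 else - 1)"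
    using g0 unfolding hor_metric_def by metis
  define c where "c = 1 / sqrt (f p)"
  have c: "c \<noteq> 0" "c * c * f p = 1"
    using f(1)[of p] by (auto simp: c_def)
  have eH: "e a \<in> H p" if "a < 4*n" for a
    using e(1) span_base[of "e a" "e ` {..<4*n}"] that by auto
  have "\<exists>X. hsection p X \<and> X p = c *\<^sub>R e a" if "a < 4*n" for a
    by (rule H_extension[OF p subspace_scale[OF subspace_H eH[OF that], of c]]) blast
  then have "\<exists>X. a < 4*n \<longrightarrow> hsection p X \<and> X p = c *\<^sub>R e a" for a
    by blast
  then obtain E where E: "\<And>a. a < 4*n \<Longrightarrow> hsection p (E a) \<and> E a p = c *\<^sub>R e a"
    using choice[of "\<lambda>a X. a < 4*n \<longrightarrow> hsection p X \<and> X p = c *\<^sub>R e a"] by blast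
  have gE: "g p (E a p) (E b p) = (if a \<noteq> b then 0 else if a < 2*n then 1 else - 1)"
    if "a < 4*n" "b < 4*n" for a b
  proof -
    have "g p (E a p) (E b p) = c * c * f p * g0 p (e a) (e b)"
      using that E eH by (simp add: g_scaleR subspace_scale[OF subspace_H] f(2)[symmetric])
    with c e(2)[OF that] show ?thesis by simp
  qed
  have "span ((\<lambda>a. E a p) ` {..<4*n}) = H p"
  proof
    show "span ((\<lambda>a. E a p) ` {..<4*n}) \<subseteq> H p"
      by (rule span_minimal[OF _ subspace_H]) (auto simp: E eH subspace_scale[OF subspace_H])
    have "e a \<in> span ((\<lambda>a. E a p) ` {..<4*n})" if "a < 4*n" for a
    proof -
      have "(1/c) *\<^sub>R E a p \<in> span ((\<lambda>a. E a p) ` {..<4*n})"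
        using that by (intro span_scale span_base) auto
      then show ?thesis using c E that by simp
    qed
    then show "H p \<subseteq> span ((\<lambda>a. E a p) ` {..<4*n})"
      using e(1) by (metis (no_types, lifting) image_subsetI lessThan_iff span_minimal subspace_span)
  qed
  then have "orthonormal_basis_at \<A> n H g p E"
    unfolding orthonormal_basis_at_def using E gE by auto
  then show ?thesis by (rule that)
qed

section \<open>Structure equations\<close>

lemma eta_xi_deriv:
  assumes "p \<in> U" "v \<in> tangent_space \<A> p" "s \<in> {1,2,3}" "t \<in> {1,2,3}"
  shows "v (\<lambda>q. \<eta> s q (\<xi> t q)) = 0"
proof -
  have "\<forall>\<^sub>F q in nhds p. \<eta> s q (\<xi> t q) = (if s = t then 1 else 0)"
    using eventually_U[OF assms(1)] by eventually_elim (rule eta_xi[OF _ assms(3,4)])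
  from tangent_cong[OF assms(2) this] show ?thesis
    using tangent_const[OF assms(2)] by metis
qed

lemma eta_H_deriv:
  assumes "p \<in> U" "v \<in> tangent_space \<A> p" "s \<in> {1,2,3}" "hsection p X"
  shows "v (\<lambda>q. \<eta> s q (X q)) = 0"
proof -
  have "\<forall>\<^sub>F q in nhds p. \<eta> s q (X q) = 0"
    using eventually_U[OF assms(1)] section_at_eventually[OF assms(4)]
    by eventually_elim (rule eta_H[OF assms(3)], auto dest: section_at_mem)
  from tangent_cong[OF assms(2) this] show ?thesis
    using tangent_const[OF assms(2)] by metis
qed

lemma ext_deriv_xi_xi:
  assumes "p \<in> U" "r \<in> {1,2,3}" "s \<in> {1,2,3}" "t \<in> {1,2,3}"
  shows "ext_deriv \<A> (\<eta> t) (\<xi> s) (\<xi> r) p = - \<eta> t p (bracket \<A> (\<xi> s) (\<xi> r) p)"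
  by (simp only: ext_deriv_def eta_xi_deriv[OF assms(1) xi_tangent[OF assms(1)]] assms)

lemma ext_deriv_xi_H:
  assumes "p \<in> U" "s \<in> {1,2,3}" "t \<in> {1,2,3}" "hsection p X"
  shows "ext_deriv \<A> (\<eta> t) (\<xi> s) X p = - \<eta> t p (bracket \<A> (\<xi> s) X p)"
  using eta_xi_deriv[OF assms(1) vfield_tangent[OF vfield_H[OF assms(4)]] assms(3,2)]
    eta_H_deriv[OF assms(1) xi_tangent[OF assms(1,2)] assms(3,4)]
  by (simp add: ext_deriv_def)

lemma eta_bracket_H:
  assumes "p \<in> U" "s \<in> {1,2,3}" "hsection p X" "hsection p Y"
  shows "\<eta> s p (bracket \<A> X Y p) = 2 * eps s * g p (I s p (X p)) (Y p)"
proof -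
  have "ext_deriv \<A> (\<eta> s) X Y p = - 2 * eps s * g p (I s p (X p)) (Y p)"
    using ld assms unfolding local_data_def by blast
  with eta_H_deriv[OF assms(1) vfield_tangent[OF vfield_H[OF assms(3)]] assms(2,4)]
    eta_H_deriv[OF assms(1) vfield_tangent[OF vfield_H[OF assms(4)]] assms(2,3)]
  show ?thesis by (simp add: ext_deriv_def)
qed

lemma reeb_diag:
  assumes "p \<in> U" "s \<in> {1,2,3}" "hsection p X"
  shows "\<eta> s p (bracket \<A> (\<xi> s) X p) = 0"
proof -
  have "ext_deriv \<A> (\<eta> s) (\<xi> s) X p = 0"
    using rf assms unfolding reeb_fields_def by blast
  then show ?thesis using ext_deriv_xi_H[OF assms(1,2,2,3)] by simp
qed

lemma reeb_cyclic:
  assumes "p \<in> U" "cyclic i j k" "hsection p X"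
  shows "\<eta> i p (bracket \<A> (\<xi> j) X p) = eps k * \<eta> j p (bracket \<A> (\<xi> i) X p)"
proof -
  have "ext_deriv \<A> (\<eta> i) (\<xi> j) X p = eps k * ext_deriv \<A> (\<eta> j) (\<xi> i) X p"
    using rf assms unfolding reeb_fields_def by blast
  then show ?thesis
    using ext_deriv_xi_H[OF assms(1) cyclic_ix(2,1)[OF assms(2)] assms(3)]
      ext_deriv_xi_H[OF assms(1) cyclic_ix(1,2)[OF assms(2)] assms(3)] by simp
qed

text \<open>Meant for iterated brackets, whose inner bracket need not be horizontal. B is split into
  its horizontal part and the multiples of the \<open>\<xi> r\<close>; since \<open>\<eta> t\<close>
  of \<open>\<xi> r\<close> is 1 or 0, the Leibniz rule leaves a derivative term only for
  \<open>r = t\<close>.\<close>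

lemma eta_bracket_split:
  assumes p: "p \<in> U" and t: "t \<in> {1,2,3}" and A: "vfield_at \<A> p A" and B: "vfield_at \<A> p B"
  shows "\<eta> t p (bracket \<A> A B p) = \<eta> t p (bracket \<A> A (\<lambda>q. hp q (B q)) p)
    + A p (\<lambda>q. \<eta> t q (B q)) + (\<Sum>r\<in>{1,2,3}. \<eta> r p (B p) * \<eta> t p (bracket \<A> A (\<xi> r) p))"
proof -
  note lin = eta_lin[OF t p] and sub = subspace_tangent_space
  note hB = vfield_H[OF hp_field[OF p B]]
  have fB: "vfield_at \<A> p (\<lambda>q. \<eta> r q (B q) *\<^sub>R \<xi> r q)" if "r \<in> {1,2,3}" for r
    by (intro vfield_scaleR smooth_eta vfield_xi that p B)
  have summand: "\<eta> t p (bracket \<A> A (\<lambda>q. \<eta> r q (B q) *\<^sub>R \<xi> r q) p)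
      = (if r = t then A p (\<lambda>q. \<eta> t q (B q)) else 0)
        + \<eta> r p (B p) * \<eta> t p (bracket \<A> A (\<xi> r) p)" if r: "r \<in> {1,2,3}" for r
  proof -
    have "bracket \<A> A (\<lambda>q. \<eta> r q (B q) *\<^sub>R \<xi> r q) p
        = A p (\<lambda>q. \<eta> r q (B q)) *\<^sub>R \<xi> r p + \<eta> r p (B p) *\<^sub>R bracket \<A> A (\<xi> r) p"
      by (rule bracket_scaleR[OF A vfield_xi[OF r p] smooth_eta[OF r p B]])
    then show ?thesis
      using eta_xi[OF p t r] lin_on_scaleR[OF lin xi_tangent[OF p r]]
        lin_on_scaleR[OF lin bracket_tangent[OF A vfield_xi[OF r p]]]
        lin_on_add[OF lin subspace_scale[OF sub xi_tangent[OF p r]]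
          subspace_scale[OF sub bracket_tangent[OF A vfield_xi[OF r p]]]]
      by auto
  qed
  define C where "C r q = \<eta> r q (B q) *\<^sub>R \<xi> r q" for r q
  have C: "vfield_at \<A> p (C r)" if "r \<in> {1,2,3}" for r
    using fB[OF that] unfolding C_def .
  have split: "B = (\<lambda>q. hp q (B q) + (\<Sum>r\<in>{1,2,3}. C r q))"
    by (rule ext) (simp only: hpart_def vpart_def C_def diff_add_cancel)
  have "bracket \<A> A (\<lambda>q. \<Sum>r\<in>{1,2,3}. C r q) p = (\<Sum>r\<in>{1,2,3}. bracket \<A> A (C r) p)"
    by (rule bracket_sum[OF A _ C]) simp_all
  moreover have "vfield_at \<A> p (\<lambda>q. \<Sum>r\<in>{1,2,3}. C r q)"
    by (rule vfield_sum[OF _ C]) simp_all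
  ultimately have "bracket \<A> A B p = bracket \<A> A (\<lambda>q. hp q (B q)) p
      + (\<Sum>r\<in>{1,2,3}. bracket \<A> A (C r) p)"
    by (subst split) (simp only: bracket_add[OF A hB])
  moreover have "\<eta> t p (\<Sum>r\<in>{1,2,3}. bracket \<A> A (C r) p)
      = (\<Sum>r\<in>{1,2,3}. \<eta> t p (bracket \<A> A (C r) p))"
    by (rule lin_on_sum[OF lin sub _ bracket_tangent[OF A C]]) simp_all
  moreover have "(\<Sum>r\<in>{1,2,3}. bracket \<A> A (C r) p) \<in> tangent_space \<A> p"
    by (rule subspace_sum[OF sub bracket_tangent[OF A C]])
  ultimately have "\<eta> t p (bracket \<A> A B p) = \<eta> t p (bracket \<A> A (\<lambda>q. hp q (B q)) p)
      + (\<Sum>r\<in>{1,2,3}. \<eta> t p (bracket \<A> A (C r) p))"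
    by (simp only: lin_on_add[OF lin bracket_tangent[OF A hB]])
  also have "(\<Sum>r\<in>{1,2,3}. \<eta> t p (bracket \<A> A (C r) p))
      = (\<Sum>r\<in>{1,2,3}. if r = t then A p (\<lambda>q. \<eta> t q (B q)) else 0)
        + (\<Sum>r\<in>{1,2,3}. \<eta> r p (B p) * \<eta> t p (bracket \<A> A (\<xi> r) p))"
    unfolding sum.distrib[symmetric] C_def by (rule sum.cong[OF refl summand])
  also have "(\<Sum>r\<in>{1,2,3}. if r = t then A p (\<lambda>q. \<eta> t q (B q)) else 0)
      = A p (\<lambda>q. \<eta> t q (B q))"
    using t by (subst sum.delta) auto
  finally show ?thesis by (simp only: add.assoc)
qed

text \<open>This is the Lie derivative of \<open>\<omega>\<^sub>t\<close> along
  \<open>\<xi> s\<close> on horizontal arguments. The brackets are projected to H because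
  \<open>\<omega>\<^sub>t\<close> vanishes on V.\<close>

definition lie_omega :: "nat \<Rightarrow> nat \<Rightarrow> 'a vfield \<Rightarrow> 'a vfield \<Rightarrow> 'a \<Rightarrow> real" where
  "lie_omega s t X Y p = \<xi> s p (\<lambda>q. g q (I t q (X q)) (Y q))
     - g p (I t p (hp p (bracket \<A> (\<xi> s) X p))) (Y p)
     - g p (I t p (X p)) (hp p (bracket \<A> (\<xi> s) Y p))"

text \<open>\<open>d\<^sup>2\<eta>\<^sub>t(\<xi>\<^sub>s, X, Y) = 0\<close>, obtained by applying \<open>\<eta>\<^sub>t\<close> to the Jacobi identity.\<close>

lemma structure_equation:
  assumes p: "p \<in> U" and s: "s \<in> {1,2,3}" and t: "t \<in> {1,2,3}"
    and X: "hsection p X" and Y: "hsection p Y"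
  defines "b \<equiv> \<lambda>t s X q. \<eta> t q (bracket \<A> (\<xi> s) X q)"
  shows "2 * eps t * lie_omega s t X Y p
    + (b t s (\<lambda>q. hp q (bracket \<A> X Y q)) p - X p (b t s Y) + Y p (b t s X))
    + (\<Sum>r\<in>{1,2,3}. b r s Y p * b t r X p - b r s X p * b t r Y p)
    = 2 * (\<Sum>r\<in>{1,2,3}. eps r * g p (I r p (X p)) (Y p) * ext_deriv \<A> (\<eta> t) (\<xi> s) (\<xi> r) p)"
proof -
  note V = vfield_H[OF X] vfield_H[OF Y] vfield_xi[OF s p]
  note XY = vfield_bracket[OF V(1,2)] and sX = vfield_bracket[OF V(3,1)]
    and sY = vfield_bracket[OF V(3,2)]
  note ZX = hp_field[OF p sX] and ZY = hp_field[OF p sY]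
  let ?w = "\<lambda>q. g q (I t q (X q)) (Y q)"
  have anti: "\<eta> t p (bracket \<A> A (\<xi> r) p) = - b t r A p" if "hsection p A" "r \<in> {1,2,3}" for A r
    using bracket_antisym[of "\<xi> r" A p]
      lin_on_minus[OF eta_lin[OF t p] bracket_tangent[OF vfield_xi[OF that(2) p] vfield_H[OF that(1)]]]
    by (simp add: b_def)
  \<comment> \<open>The vertical components of \<open>bracket \<A> X Y\<close> are
    \<open>2 * eps r\<close> times \<open>\<omega>\<^sub>r(X, Y)\<close>. They produce the
    right-hand side of the equation, and differentiating the t-th one gives the first term of
    \<open>lie_omega\<close>.\<close>
  have e1: "\<eta> t p (bracket \<A> (\<xi> s) (bracket \<A> X Y) p)
      = b t s (\<lambda>q. hp q (bracket \<A> X Y q)) p + 2 * eps t * \<xi> s p ?w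
        - 2 * (\<Sum>r\<in>{1,2,3}. eps r * g p (I r p (X p)) (Y p) * ext_deriv \<A> (\<eta> t) (\<xi> s) (\<xi> r) p)"
  proof -
    have ev: "\<forall>\<^sub>F q in nhds p. \<eta> t q (bracket \<A> X Y q) = 2 * eps t * ?w q"
      using eventually_U[OF p] section_at_eventually[OF X] section_at_eventually[OF Y]
      by eventually_elim (rule eta_bracket_H[OF _ t])
    \<comment> \<open>Smoothness of \<open>?w\<close> is obtained by writing it as a multiple of the
      smooth function \<open>\<eta> t\<close> of the bracket.\<close>
    have "\<forall>\<^sub>F q in nhds p. (eps t / 2) * \<eta> t q (bracket \<A> X Y q) = ?w q"
      using ev by eventually_elim (simp add: eps_def)
    then have "smooth_at \<A> p ?w"
      by (rule smooth_at_cong) (intro smooth_at_cmult smooth_eta[OF t p XY])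
    then have "\<xi> s p (\<lambda>q. \<eta> t q (bracket \<A> X Y q)) = 2 * eps t * \<xi> s p ?w"
      using tangent_cong[OF vfield_tangent[OF V(3)] ev]
        tangent_cmult[OF vfield_tangent[OF V(3)], of ?w "2 * eps t"] by simp
    moreover have "(\<Sum>r\<in>{1,2,3}. \<eta> r p (bracket \<A> X Y p) * \<eta> t p (bracket \<A> (\<xi> s) (\<xi> r) p))
      = (\<Sum>r\<in>{1,2,3}. - 2 * (eps r * g p (I r p (X p)) (Y p)
          * ext_deriv \<A> (\<eta> t) (\<xi> s) (\<xi> r) p))"
    proof (rule sum.cong[OF refl])
      fix r :: nat assume r: "r \<in> {1,2,3}"
      show "\<eta> r p (bracket \<A> X Y p) * \<eta> t p (bracket \<A> (\<xi> s) (\<xi> r) p)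
        = - 2 * (eps r * g p (I r p (X p)) (Y p) * ext_deriv \<A> (\<eta> t) (\<xi> s) (\<xi> r) p)"
        using eta_bracket_H[OF p r X Y] ext_deriv_xi_xi[OF p r s t] by simp
    qed
    ultimately show ?thesis
      using eta_bracket_split[OF p t V(3) XY] unfolding b_def sum_distrib_left[symmetric] by linarith
  qed
  \<comment> \<open>Here the vertical components of the inner bracket are the values
    \<open>b r s B\<close>; they give the quadratic terms in the horizontal 1-forms b.\<close>
  have e2: "\<eta> t p (bracket \<A> A (bracket \<A> (\<xi> s) B) p)
      = 2 * eps t * g p (I t p (A p)) (hp p (bracket \<A> (\<xi> s) B p)) + A p (b t s B)
        - (\<Sum>r\<in>{1,2,3}. b r s B p * b t r A p)" if "hsection p A" "hsection p B" for A B
  proof -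
    note sB = vfield_bracket[OF V(3) vfield_H[OF that(2)]]
    have "(\<Sum>r\<in>{1,2,3}. \<eta> r p (bracket \<A> (\<xi> s) B p) * \<eta> t p (bracket \<A> A (\<xi> r) p))
      = (\<Sum>r\<in>{1,2,3}. - (b r s B p * b t r A p))"
    proof (rule sum.cong[OF refl])
      fix r :: nat assume r: "r \<in> {1,2,3}"
      show "\<eta> r p (bracket \<A> (\<xi> s) B p) * \<eta> t p (bracket \<A> A (\<xi> r) p)
        = - (b r s B p * b t r A p)"
        using anti[OF that(1) r] by (simp add: b_def)
    qed
    then show ?thesis
      using eta_bracket_split[OF p t vfield_H[OF that(1)] sB]
        eta_bracket_H[OF p t that(1) hp_field[OF p sB]]
      unfolding b_def sum_negf by linarith
  qed
  \<comment> \<open>The sign sits inside a field that is differentiated again, so it is pulled out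
    as the constant factor -1.\<close>
  have mYs: "bracket \<A> X (bracket \<A> Y (\<xi> s)) p = - bracket \<A> X (bracket \<A> (\<xi> s) Y) p"
  proof -
    have "bracket \<A> Y (\<xi> s) = (\<lambda>q. (- 1) *\<^sub>R bracket \<A> (\<xi> s) Y q)"
      by (rule ext) (simp add: bracket_antisym[of Y])
    then show ?thesis
      using bracket_scaleR[OF V(1) sY smooth_at_const[of p "-1"]]
        tangent_const[OF vfield_tangent[OF V(1)]] by simp
  qed
  note brT = bracket_tangent[OF V(3) XY] bracket_tangent[OF V(1) sY] bracket_tangent[OF V(2) sX]
  have "bracket \<A> (\<xi> s) (bracket \<A> X Y) p - bracket \<A> X (bracket \<A> (\<xi> s) Y) p
      + bracket \<A> Y (bracket \<A> (\<xi> s) X) p = 0"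
    using bracket_jacobi[OF V(3,1,2)] mYs by simp
  then have "\<eta> t p (bracket \<A> (\<xi> s) (bracket \<A> X Y) p)
      - \<eta> t p (bracket \<A> X (bracket \<A> (\<xi> s) Y) p)
      + \<eta> t p (bracket \<A> Y (bracket \<A> (\<xi> s) X) p) = 0"
    using lin_on_add[OF eta_lin[OF t p] subspace_diff[OF subspace_tangent_space brT(1,2)] brT(3)]
      lin_on_diff[OF eta_lin[OF t p] brT(1,2)]
      lin_on_zero[OF eta_lin[OF t p] subspace_0[OF subspace_tangent_space]] by simp
  moreover have "g p (I t p (Y p)) (hp p (bracket \<A> (\<xi> s) X p))
      = - g p (I t p (hp p (bracket \<A> (\<xi> s) X p))) (Y p)"
    using I_skew[OF t p section_at_mem[OF Y] section_at_mem[OF ZX]]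
      g_sym[OF section_at_mem[OF Y] I_H[OF t p section_at_mem[OF ZX]]] by simp
  ultimately show ?thesis
    unfolding lie_omega_def e1 e2[OF X Y] e2[OF Y X] sum_subtractf by (simp add: algebra_simps)
qed

text \<open>For \<open>s = t\<close> the form \<open>b t t\<close> vanishes on horizontal fields
  near p, which removes the linear terms. In the quadratic sum \<open>b t r\<close> is a multiple of
  \<open>b r t\<close> by the Reeb conditions, so every summand is antisymmetrized to 0.\<close>

lemma lie_omega_diag:
  assumes p: "p \<in> U" and t: "t \<in> {1,2,3}" and X: "hsection p X" and Y: "hsection p Y"
  shows "eps t * lie_omega t t X Y p
    = (\<Sum>r\<in>{1,2,3}. eps r * g p (I r p (X p)) (Y p) * ext_deriv \<A> (\<eta> t) (\<xi> t) (\<xi> r) p)"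
proof -
  obtain j k where c: "cyclic t j k" using t by (auto simp: cyclic_def)
  note c' = cyclic_rotate[OF c] cyclic_rotate[OF cyclic_rotate[OF c]]
  let ?b = "\<lambda>t s X q. \<eta> t q (bracket \<A> (\<xi> s) X q)"
  have d: "X p (?b t t Y) = 0" if "hsection p X" "hsection p Y" for X Y
  proof -
    note v = vfield_tangent[OF vfield_H[OF that(1)]]
    have "\<forall>\<^sub>F q in nhds p. ?b t t Y q = 0"
      using eventually_U[OF p] section_at_eventually[OF that(2)]
      by eventually_elim (rule reeb_diag[OF _ t])
    from tangent_cong[OF v this] tangent_const[OF v] show ?thesis by metis
  qed
  have "(\<Sum>r\<in>{1,2,3}. ?b r t Y p * ?b t r X p - ?b r t X p * ?b t r Y p) = 0"
    unfolding sum_cyclic[OF c]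
    using reeb_cyclic[OF p c X] reeb_cyclic[OF p c Y] reeb_cyclic[OF p c'(2) X]
      reeb_cyclic[OF p c'(2) Y] by simp
  then show ?thesis
    using structure_equation[OF p t t X Y] d[OF X Y] d[OF Y X]
      reeb_diag[OF p t hp_field[OF p vfield_bracket[OF vfield_H[OF X] vfield_H[OF Y]]]]
    by simp
qed

text \<open>From the structure equation for \<open>(s,t) = (j,i)\<close> subtract
  \<open>eps k\<close> times the one for \<open>(i,j)\<close>. The linear and quadratic terms
  cancel, and \<open>- eps j * eps k = eps i\<close> gives both Lie derivatives the same
  coefficient.\<close>

lemma lie_omega_cyclic:
  assumes p: "p \<in> U" and c: "cyclic i j k" and X: "hsection p X" and Y: "hsection p Y"
  shows "eps i * (lie_omega j i X Y p + lie_omega i j X Y p)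
    = (\<Sum>r\<in>{1,2,3}. eps r * g p (I r p (X p)) (Y p) *
        (ext_deriv \<A> (\<eta> i) (\<xi> j) (\<xi> r) p - eps k * ext_deriv \<A> (\<eta> j) (\<xi> i) (\<xi> r) p))"
proof -
  note ix = cyclic_ix(1-3)[OF c]
  note c' = cyclic_rotate[OF c] cyclic_rotate[OF cyclic_rotate[OF c]]
  let ?b = "\<lambda>t s X q. \<eta> t q (bracket \<A> (\<xi> s) X q)"
  let ?Q = "\<lambda>t s. \<Sum>r\<in>{1,2,3}. ?b r s Y p * ?b t r X p - ?b r s X p * ?b t r Y p"
  let ?K = "\<lambda>t s. ?b t s (\<lambda>q. hp q (bracket \<A> X Y q)) p - X p (?b t s Y) + Y p (?b t s X)"
  let ?R = "\<lambda>t s. \<Sum>r\<in>{1,2,3}. eps r * g p (I r p (X p)) (Y p) * ext_deriv \<A> (\<eta> t) (\<xi> s) (\<xi> r) p"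
  have d: "X p (?b i j Y) = eps k * X p (?b j i Y)" if "hsection p X" "hsection p Y" for X Y
  proof -
    note v = vfield_tangent[OF vfield_H[OF that(1)]]
    have "\<forall>\<^sub>F q in nhds p. ?b i j Y q = eps k * ?b j i Y q"
      using eventually_U[OF p] section_at_eventually[OF that(2)]
      by eventually_elim (rule reeb_cyclic[OF _ c])
    from tangent_cong[OF v this] show ?thesis
      using tangent_cmult[OF v smooth_eta[OF ix(2) p vfield_bracket[OF vfield_xi[OF ix(1) p]
        vfield_H[OF that(2)]]], of "eps k"] by simp
  qed
  have K: "?K i j = eps k * ?K j i"
    using d[OF X Y] d[OF Y X]
      reeb_cyclic[OF p c hp_field[OF p vfield_bracket[OF vfield_H[OF X] vfield_H[OF Y]]]]
    by (simp add: algebra_simps)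
  \<comment> \<open>Only \<open>r = k\<close> contributes, since \<open>b i i\<close> and
    \<open>b j j\<close> vanish. The Reeb conditions for the pairs (j,k) and (k,i) match what
    remains.\<close>
  have Q: "?Q i j = eps k * ?Q j i"
    unfolding sum_cyclic[OF c]
    using reeb_diag[OF p ix(1) X] reeb_diag[OF p ix(1) Y] reeb_diag[OF p ix(2) X]
      reeb_diag[OF p ix(2) Y] reeb_cyclic[OF p c'(1) X] reeb_cyclic[OF p c'(1) Y]
      reeb_cyclic[OF p c'(2) X] reeb_cyclic[OF p c'(2) Y]
    by (cases rule: eps_cases[OF c]) simp_all
  have R: "(\<Sum>r\<in>{1,2,3}. eps r * g p (I r p (X p)) (Y p) *
      (ext_deriv \<A> (\<eta> i) (\<xi> j) (\<xi> r) p - eps k * ext_deriv \<A> (\<eta> j) (\<xi> i) (\<xi> r) p))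
    = ?R i j - eps k * ?R j i"
    unfolding sum_distrib_left sum_subtractf[symmetric] by (rule sum.cong[OF refl]) algebra
  have E: "2 * eps i * lie_omega j i X Y p + ?K i j + ?Q i j = 2 * ?R i j"
    "2 * eps j * lie_omega i j X Y p + ?K j i + ?Q j i = 2 * ?R j i"
    using structure_equation[OF p ix(2,1) X Y] structure_equation[OF p ix(1,2) X Y] by simp_all
  show ?thesis
    unfolding R using E K Q
    by (cases rule: eps_cases[OF c]) (simp_all add: distrib_left)
qed

section \<open>The canonical connection\<close>

lemma linear_connection: "linear_connection \<A> D"
  using cc by (simp add: canonical_pqc_connection_def)

lemma canonical:
  assumes "p \<in> U"
  shows "v \<in> tangent_space \<A> p \<Longrightarrow> hsection p X \<Longrightarrow> D p v X \<in> H p"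
    and "v \<in> tangent_space \<A> p \<Longrightarrow> section_at \<A> (vert \<xi>) p Z \<Longrightarrow> D p v Z \<in> vert \<xi> p"
    and "v \<in> tangent_space \<A> p \<Longrightarrow> vfield_at \<A> p B \<Longrightarrow> vfield_at \<A> p C \<Longrightarrow>
      v (\<lambda>q. gext g \<eta> \<xi> q (B q) (C q)) =
        gext g \<eta> \<xi> p (D p v B) (C p) + gext g \<eta> \<xi> p (B p) (D p v C)"
    and "v \<in> tangent_space \<A> p \<Longrightarrow> section_at \<A> (vert \<xi>) p Z \<Longrightarrow> hsection p X \<Longrightarrow>
      nabla_end D p v (\<lambda>q. V_to_PQ \<eta> I q (Z q)) X = V_to_PQ \<eta> I p (D p v Z) (X p)"
    and "section_at \<A> (vert \<xi>) p Z \<Longrightarrow> orthonormal_basis_at \<A> n H g p e \<Longrightarrow>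
      Q \<in> sp_n H g I p \<Longrightarrow> R \<in> sp_1 I p \<Longrightarrow>
      gtrace n g p e (\<lambda>X Y. g p (hp p (torsion \<A> D Z X p)) ((Q + R) (Y p))) = 0"
proof -
  note c = cc[unfolded canonical_pqc_connection_def, THEN conjunct2, rule_format,
      OF conjI[OF ld rf] assms]
  note d = c[THEN conjunct1, THEN bspec]
  show "D p v X \<in> H p" if "v \<in> tangent_space \<A> p" "hsection p X"
    by (rule d[OF that(1), THEN conjunct1, rule_format, OF that(2)])
  show "D p v Z \<in> vert \<xi> p" if "v \<in> tangent_space \<A> p" "section_at \<A> (vert \<xi>) p Z"
    by (rule d[OF that(1), THEN conjunct2, THEN conjunct1, rule_format, OF that(2)])
  show "v (\<lambda>q. gext g \<eta> \<xi> q (B q) (C q)) =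
        gext g \<eta> \<xi> p (D p v B) (C p) + gext g \<eta> \<xi> p (B p) (D p v C)"
    if "v \<in> tangent_space \<A> p" "vfield_at \<A> p B" "vfield_at \<A> p C"
    by (rule d[OF that(1), THEN conjunct2, THEN conjunct2, THEN conjunct1, rule_format,
        OF conjI[OF that(2,3)]])
  show "nabla_end D p v (\<lambda>q. V_to_PQ \<eta> I q (Z q)) X = V_to_PQ \<eta> I p (D p v Z) (X p)"
    if "v \<in> tangent_space \<A> p" "section_at \<A> (vert \<xi>) p Z" "hsection p X"
    by (rule d[OF that(1), THEN conjunct2, THEN conjunct2, THEN conjunct2, THEN conjunct2,
        rule_format, OF conjI[OF that(2,3)]])
  show "gtrace n g p e (\<lambda>X Y. g p (hp p (torsion \<A> D Z X p)) ((Q + R) (Y p))) = 0"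
    if "section_at \<A> (vert \<xi>) p Z" "orthonormal_basis_at \<A> n H g p e"
      "Q \<in> sp_n H g I p" "R \<in> sp_1 I p"
    by (rule c[THEN conjunct2, THEN conjunct2, rule_format, OF conjI[OF that(1,2)] that(3,4)])
qed

lemma nabla_I:
  assumes "p \<in> U" "v \<in> tangent_space \<A> p" "hsection p X" "cyclic i j k"
  shows "nabla_end D p v (I i) X
    = \<alpha> j p v *\<^sub>R I k p (X p) + (eps k * \<alpha> k p v) *\<^sub>R I j p (X p)"
  using cf assms unfolding connection_forms_def by blast

lemma gext_H:
  assumes "p \<in> U" "u \<in> H p" "v \<in> H p"
  shows "gext g \<eta> \<xi> p u v = g p u v"
  using assms by (simp add: gext_def hp_H eta_H)

text \<open>The argument is a field, since \<open>torsion\<close> is given by a formula on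
  fields.\<close>

definition tor_H :: "nat \<Rightarrow> 'a vfield \<Rightarrow> 'a \<Rightarrow> 'a tvec" where
  "tor_H s X p = hp p (torsion \<A> D (\<xi> s) X p)"

lemma D_tangent:
  "v \<in> tangent_space \<A> p \<Longrightarrow> vfield_at \<A> p B \<Longrightarrow> D p v B \<in> tangent_space \<A> p"
  using linear_connection[unfolded linear_connection_def, THEN conjunct1] by simp

lemma torsion_tangent:
  assumes "vfield_at \<A> p X" "vfield_at \<A> p Y"
  shows "torsion \<A> D X Y p \<in> tangent_space \<A> p"
  unfolding torsion_def
  by (intro subspace_diff[OF subspace_tangent_space] D_tangent bracket_tangent vfield_tangent assms)

lemma tor_H_in_H:
  assumes "p \<in> U" "s \<in> {1,2,3}" "hsection p X"
  shows "tor_H s X p \<in> H p"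
  unfolding tor_H_def
  by (intro hp_in_H torsion_tangent vfield_xi vfield_H assms)

text \<open>The connection preserves H and V, so in the torsion of \<open>\<xi> s\<close> and X the
  derivative of \<open>\<xi> s\<close> has no horizontal part.\<close>

lemma hp_bracket_xi:
  assumes p: "p \<in> U" and s: "s \<in> {1,2,3}" and X: "hsection p X"
  shows "hp p (bracket \<A> (\<xi> s) X p) = D p (\<xi> s p) X - tor_H s X p"
proof -
  note v = xi_tangent[OF p s] and w = vfield_tangent[OF vfield_H[OF X]]
  note DX = canonical(1)[OF p v X] and Dxi = canonical(2)[OF p w section_xi[OF p s]]
  note t = H_tangent[OF DX] hp_vert(2)[OF p Dxi] bracket_tangent[OF vfield_xi[OF s p] vfield_H[OF X]]
  have "tor_H s X p = D p (\<xi> s p) X - hp p (bracket \<A> (\<xi> s) X p)"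
    unfolding tor_H_def torsion_def
    using hp_lin[OF p subspace_diff[OF subspace_tangent_space t(1,2)] t(3)] hp_lin[OF p t(1,2)]
      hp_H[OF p DX] hp_vert(1)[OF p Dxi] by simp
  then show ?thesis by simp
qed

text \<open>Metric compatibility differentiates \<open>\<omega>\<^sub>t(X, Y)\<close> and
  \<open>hp_bracket_xi\<close> rewrites the brackets; the derivatives of X and Y then combine to the
  derivative of \<open>I t\<close>.\<close>

lemma lie_omega_connection:
  assumes p: "p \<in> U" and s: "s \<in> {1,2,3}" and t: "t \<in> {1,2,3}"
    and X: "hsection p X" and Y: "hsection p Y"
  shows "lie_omega s t X Y p = g p (nabla_end D p (\<xi> s p) (I t) X) (Y p)
    + g p (I t p (tor_H s X p)) (Y p) + g p (I t p (X p)) (tor_H s Y p)"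
proof -
  note v = xi_tangent[OF p s] and IX = I_hor[OF t p X]
  note Xp = section_at_mem[OF X] and Yp = section_at_mem[OF Y]
  note DX = canonical(1)[OF p v X] and DY = canonical(1)[OF p v Y] and DIX = canonical(1)[OF p v IX]
  note TX = tor_H_in_H[OF p s X] and TY = tor_H_in_H[OF p s Y]
  \<comment> \<open>Compatibility is stated for the extended metric, which agrees with g on
    horizontal vectors over U.\<close>
  have "\<forall>\<^sub>F q in nhds p. g q (I t q (X q)) (Y q) = gext g \<eta> \<xi> q (I t q (X q)) (Y q)"
    using eventually_U[OF p] section_at_eventually[OF IX] section_at_eventually[OF Y]
    by eventually_elim (rule gext_H[symmetric], auto dest: section_at_mem)
  from tangent_cong[OF v this]
  have "\<xi> s p (\<lambda>q. g q (I t q (X q)) (Y q)) = gext g \<eta> \<xi> p (D p (\<xi> s p) (\<lambda>q. I t q (X q))) (Y p)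
      + gext g \<eta> \<xi> p (I t p (X p)) (D p (\<xi> s p) Y)"
    using canonical(3)[OF p v vfield_H[OF IX] vfield_H[OF Y]] by simp
  also have "\<dots> = g p (D p (\<xi> s p) (\<lambda>q. I t q (X q))) (Y p) + g p (I t p (X p)) (D p (\<xi> s p) Y)"
    by (simp add: gext_H p DIX Yp DY I_H[OF t p Xp])
  finally show ?thesis
    unfolding lie_omega_def hp_bracket_xi[OF p s X] hp_bracket_xi[OF p s Y] nabla_end_def
    by (simp add: g_diff DIX Yp TX TY DX DY I_H[OF t p] Xp lin_on_diff[OF I_lin[OF t p]])
qed

section \<open>Traces\<close>

text \<open>Two distinct structures compose to a nonzero multiple of the third, with constants
  independent of the point. Both orientations of the pair (t,m) are covered.\<close>

lemma I_comp_third: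
  assumes "t \<in> {1,2,3}" "m \<in> {1,2,3}" "t \<noteq> m"
  obtains r c c' where "r \<in> {1,2,3}" "c \<noteq> 0" "c' \<noteq> 0"
    "\<And>p u. p \<in> U \<Longrightarrow> u \<in> H p \<Longrightarrow> I t p (I m p u) = c *\<^sub>R I r p u"
    "\<And>p u. p \<in> U \<Longrightarrow> u \<in> H p \<Longrightarrow> I r p (I m p u) = c' *\<^sub>R I t p u"
proof -
  have nz: "eps s \<noteq> 0" for s by (simp add: eps_def)
  obtain r where "cyclic t m r \<or> cyclic m t r"
    using assms by (auto simp: cyclic_def)
  then show ?thesis
  proof
    assume c: "cyclic t m r"
    show ?thesis
      by (rule that[of r "- eps r" "eps t"])
        (use cyclic_ix(3)[OF c] nz I_cyclic(1)[OF c] I_cyclic(2)[OF cyclic_rotate[OF c]] in auto)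
  next
    assume c: "cyclic m t r"
    show ?thesis
      by (rule that[of r "eps r" "- eps t"])
        (use cyclic_ix(3)[OF c] nz I_cyclic(2)[OF c]
          I_cyclic(1)[OF cyclic_rotate[OF cyclic_rotate[OF c]]] in auto)
  qed
qed

context
  fixes p e assumes p: "p \<in> U" and e: "orthonormal_basis_at \<A> n H g p e"
begin

lemma basis_section: "a < 4 * n \<Longrightarrow> hsection p (e a)"
  using e by (simp add: orthonormal_basis_at_def)

lemma basis_H: "a < 4 * n \<Longrightarrow> e a p \<in> H p"
  by (rule section_at_mem[OF basis_section])

lemma basis_sq: "a < 4 * n \<Longrightarrow> g p (e a p) (e a p) * g p (e a p) (e a p) = 1"
  using e by (auto simp: orthonormal_basis_at_def)

text \<open>\<open>I m\<close> preserves g up to a global sign, and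
  \<open>orthonormal_basis_at\<close> does not prescribe which vectors are positive. It is
  invertible because its square is plus or minus the identity, so the images still span
  \<open>H p\<close>.\<close>

lemma I_basis:
  assumes m: "m \<in> {1,2,3}"
  shows "orthonormal_basis_at \<A> n H g p (\<lambda>a q. I m q (e a q))"
  unfolding orthonormal_basis_at_def
proof (intro conjI allI impI)
  fix a assume a: "a < 4 * n"
  show "hsection p (\<lambda>q. I m q (e a q))" by (rule I_hor[OF m p basis_section[OF a]])
  have "g p (e a p) (e a p) = 1 \<or> g p (e a p) (e a p) = -1"
    using e a by (simp add: orthonormal_basis_at_def)
  then show "g p (I m p (e a p)) (I m p (e a p)) = 1 \<or> g p (I m p (e a p)) (I m p (e a p)) = - 1"
    by (auto simp: I_iso[OF m p basis_H[OF a] basis_H[OF a]] eps_def)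
  fix b assume b: "b < 4 * n" "a \<noteq> b"
  have "g p (e a p) (e b p) = 0" using e a b by (simp add: orthonormal_basis_at_def)
  then show "g p (I m p (e a p)) (I m p (e b p)) = 0"
    by (simp add: I_iso[OF m p basis_H[OF a] basis_H[OF b(1)]])
next
  let ?E = "span ((\<lambda>a. I m p (e a p)) ` {..<4 * n})"
  have span: "span ((\<lambda>a. e a p) ` {..<4 * n}) = H p"
    using e by (simp add: orthonormal_basis_at_def)
  show "?E = H p"
  proof
    show "?E \<subseteq> H p"
      by (rule span_minimal[OF _ subspace_H]) (auto intro: I_H[OF m p] basis_H)
    have "subspace {u \<in> H p. I m p u \<in> ?E}"
      unfolding subspace_def
      by (auto simp: H_zero lin_on_zero[OF I_lin[OF m p] H_zero] lin_on_add[OF I_lin[OF m p]]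
          lin_on_scaleR[OF I_lin[OF m p]] subspace_add[OF subspace_H] subspace_scale[OF subspace_H]
          span_zero span_add span_scale)
    then have "span ((\<lambda>a. e a p) ` {..<4 * n}) \<subseteq> {u \<in> H p. I m p u \<in> ?E}"
      by (rule span_minimal[rotated]) (auto intro: span_base basis_H)
    then have *: "I m p u \<in> ?E" if "u \<in> H p" for u using that span by auto
    show "H p \<subseteq> ?E"
    proof
      fix u assume u: "u \<in> H p"
      have "eps m *\<^sub>R I m p (I m p u) \<in> ?E"
        by (rule span_scale[OF *[OF I_H[OF m p u]]])
      then show "u \<in> ?E" by (simp add: I_sq[OF m p u] eps_sq)
    qed
  qed
qed

lemma gtrace_I_basis:
  assumes "m \<in> {1,2,3}"
  shows "gtrace n g p (\<lambda>a q. I m q (e a q)) P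
    = - eps m * gtrace n g p e (\<lambda>X Y. P (\<lambda>q. I m q (X q)) (\<lambda>q. I m q (Y q)))"
  unfolding gtrace_def sum_distrib_left
  by (rule sum.cong) (auto simp: I_iso[OF assms p basis_H basis_H])

text \<open>On the diagonal each of the \<open>4 * n\<close> summands is \<open>- eps m\<close>, as
  the weights square to 1. Off the diagonal, skewness turns the summand into a multiple of
  \<open>g p u (I q p u)\<close> for the third structure, which is 0.\<close>

lemma gtrace_I_I:
  assumes r: "r \<in> {1,2,3}" and m: "m \<in> {1,2,3}"
  shows "gtrace n g p e (\<lambda>X Y. g p (I r p (X p)) (I m p (Y p)))
    = (if r = m then - eps m * (4 * real n) else 0)"
proof (cases "r = m")
  case True
  have "gtrace n g p e (\<lambda>X Y. g p (I r p (X p)) (I m p (Y p)))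
      = (\<Sum>a<4*n. - eps m * (g p (e a p) (e a p) * g p (e a p) (e a p)))"
    unfolding gtrace_def
    by (rule sum.cong) (auto simp: True I_iso[OF m p basis_H basis_H])
  also have "\<dots> = (\<Sum>a<4*n. - eps m)"
    by (rule sum.cong) (auto simp: basis_sq)
  finally show ?thesis by (simp add: True)
next
  case False
  obtain q c where q: "q \<in> {1,2,3}" and c: "\<And>u. u \<in> H p \<Longrightarrow> I r p (I m p u) = c *\<^sub>R I q p u"
    by (rule I_comp_third[OF r m False]) (use p in blast)
  have "g p (I r p u) (I m p u) = 0" if u: "u \<in> H p" for u
    using I_skew[OF r p u I_H[OF m p u]] g_scaleR(1)[OF u I_H[OF q p u], of c] c[OF u]
      I_skew[OF q p u u] I_self[OF q p u] by simp
  then show ?thesis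
    using False by (simp add: gtrace_def basis_H)
qed

text \<open>Orthogonality of the torsion endomorphism to sp(n) + sp(1), tested with the sp(n)
  component 0.\<close>

lemma gtrace_tor_I:
  assumes s: "s \<in> {1,2,3}" and m: "m \<in> {1,2,3}"
  shows "gtrace n g p e (\<lambda>X Y. g p (tor_H s X p) (I m p (Y p))) = 0"
proof -
  have "0 \<in> sp_n H g I p"
    by (auto simp: sp_n_def hor_end_def lin_on_def H_zero g_zero
        lin_on_zero[OF I_lin[OF _ p] H_zero])
  moreover have "I m p \<in> sp_1 I p"
    unfolding sp_1_def by (rule span_base) (use m in auto)
  ultimately show ?thesis
    using canonical(5)[OF p section_xi[OF p s] e, of 0 "I m p"] by (simp add: tor_H_def)
qed

end

context
  fixes p e assumes p: "p \<in> U" and e: "orthonormal_basis_at \<A> n H g p e"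
begin

text \<open>Testing the torsion condition on the orthonormal basis \<open>I\<^sub>m e\<^sub>a\<close> gives the second identity without
  having to know that the torsion is tensorial.\<close>

lemma gtrace_tor_I_I:
  assumes s: "s \<in> {1,2,3}" and t: "t \<in> {1,2,3}" and m: "m \<in> {1,2,3}" and ne: "t \<noteq> m"
  shows "gtrace n g p e (\<lambda>X Y. g p (tor_H s X p) (I t p (I m p (Y p)))) = 0"
    and "gtrace n g p e (\<lambda>X Y. g p (tor_H s (\<lambda>q. I m q (X q)) p) (I t p (Y p))) = 0"
proof -
  obtain r c c' where r: "r \<in> {1,2,3}" and nz: "c \<noteq> 0" "c' \<noteq> 0"
    and c: "\<And>u. u \<in> H p \<Longrightarrow> I t p (I m p u) = c *\<^sub>R I r p u"
    and c': "\<And>u. u \<in> H p \<Longrightarrow> I r p (I m p u) = c' *\<^sub>R I t p u"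
    by (rule I_comp_third[OF t m ne]) (use p in blast)
  note bs = basis_section[OF p e] and bH = basis_H[OF p e]
  have "gtrace n g p e (\<lambda>X Y. g p (tor_H s X p) (I t p (I m p (Y p))))
      = gtrace n g p e (\<lambda>X Y. c * g p (tor_H s X p) (I r p (Y p)))"
    by (rule gtrace_cong)
      (simp add: c bH g_scaleR tor_H_in_H[OF p s bs] I_H[OF r p])
  then show "gtrace n g p e (\<lambda>X Y. g p (tor_H s X p) (I t p (I m p (Y p)))) = 0"
    by (simp add: gtrace_cmult gtrace_tor_I[OF p e s r])
  \<comment> \<open>The change of basis costs the nonzero factor \<open>- eps m\<close>. The index r
    is tested because \<open>I r\<close> composed with \<open>I m\<close> is a nonzero multiple of
    \<open>I t\<close>.\<close>
  have "0 = gtrace n g p e (\<lambda>X Y. g p (tor_H s (\<lambda>q. I m q (X q)) p) (I r p (I m p (Y p))))"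
    using gtrace_tor_I[OF p I_basis[OF p e m] s r] gtrace_I_basis[OF p e m]
    by (simp add: eps_def split: if_splits)
  also have "\<dots> = gtrace n g p e (\<lambda>X Y. c' * g p (tor_H s (\<lambda>q. I m q (X q)) p) (I t p (Y p)))"
    by (rule gtrace_cong)
      (simp add: c' bH g_scaleR tor_H_in_H[OF p s I_hor[OF m p bs]] I_H[OF t p])
  finally show "gtrace n g p e (\<lambda>X Y. g p (tor_H s (\<lambda>q. I m q (X q)) p) (I t p (Y p))) = 0"
    using nz by (simp add: gtrace_cmult)
qed

lemma gtrace_lin_I:
  assumes "r \<in> {1,2,3}" "m \<in> {1,2,3}" "r \<noteq> m"
  shows "gtrace n g p e (\<lambda>X Y. g p (a *\<^sub>R I m p (X p) + b *\<^sub>R I r p (X p)) (I m p (Y p)))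
    = - (4 * real n) * eps m * a"
proof -
  have "gtrace n g p e (\<lambda>X Y. g p (a *\<^sub>R I m p (X p) + b *\<^sub>R I r p (X p)) (I m p (Y p)))
    = gtrace n g p e (\<lambda>X Y. a * g p (I m p (X p)) (I m p (Y p)) + b * g p (I r p (X p)) (I m p (Y p)))"
    by (rule gtrace_cong)
      (simp add: g_add g_scaleR I_H[OF assms(1) p] I_H[OF assms(2) p] basis_H[OF p e]
        subspace_scale[OF subspace_H])
  then show ?thesis
    using assms by (simp add: gtrace_add gtrace_cmult gtrace_I_I[OF p e])
qed

text \<open>Both torsion terms of \<open>lie_omega_connection\<close> have trace 0 when tested on
  \<open>I m\<close> with m different from t. What survives is a, the \<open>I m\<close> coefficient
  of the derivative of \<open>I t\<close>.\<close>

lemma gtrace_lie_omega: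
  assumes s: "s \<in> {1,2,3}" and t: "t \<in> {1,2,3}" and m: "m \<in> {1,2,3}" and ne: "t \<noteq> m"
    and r: "r \<in> {1,2,3}" "r \<noteq> m"
    and nabla: "\<And>X. hsection p X \<Longrightarrow>
      nabla_end D p (\<xi> s p) (I t) X = a *\<^sub>R I m p (X p) + b *\<^sub>R I r p (X p)"
  shows "gtrace n g p e (\<lambda>X Y. lie_omega s t X (\<lambda>q. I m q (Y q)) p) = - (4 * real n) * eps m * a"
proof -
  note bs = basis_section[OF p e] and bH = basis_H[OF p e]
  have "gtrace n g p e (\<lambda>X Y. lie_omega s t X (\<lambda>q. I m q (Y q)) p)
    = gtrace n g p e (\<lambda>X Y. g p (a *\<^sub>R I m p (X p) + b *\<^sub>R I r p (X p)) (I m p (Y p))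
      + (-1) * g p (tor_H s X p) (I t p (I m p (Y p)))
      + g p (tor_H s (\<lambda>q. I m q (X q)) p) (I t p (Y p)))"
  proof (rule gtrace_cong)
    fix l assume l: "l < 4 * n"
    note ml = I_hor[OF m p bs[OF l]] and Tl = tor_H_in_H[OF p s bs[OF l]]
    have "lie_omega s t (e l) (\<lambda>q. I m q (e l q)) p
      = g p (nabla_end D p (\<xi> s p) (I t) (e l)) (I m p (e l p))
        + g p (I t p (tor_H s (e l) p)) (I m p (e l p))
        + g p (I t p (e l p)) (tor_H s (\<lambda>q. I m q (e l q)) p)"
      by (rule lie_omega_connection[OF p s t bs[OF l] ml])
    then show "lie_omega s t (e l) (\<lambda>q. I m q (e l q)) p
      = g p (a *\<^sub>R I m p (e l p) + b *\<^sub>R I r p (e l p)) (I m p (e l p))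
      + (-1) * g p (tor_H s (e l) p) (I t p (I m p (e l p)))
      + g p (tor_H s (\<lambda>q. I m q (e l q)) p) (I t p (e l p))"
      using nabla[OF bs[OF l]] I_skew[OF t p Tl I_H[OF m p bH[OF l]]]
        g_sym[OF I_H[OF t p bH[OF l]] tor_H_in_H[OF p s ml]] by simp
  qed
  then show ?thesis
    by (simp only: gtrace_add gtrace_cmult gtrace_lin_I[OF r(1) m r(2)] gtrace_tor_I_I[OF s t m ne]
        mult_zero_right add_0_right)
qed

lemma gtrace_structure_rhs:
  assumes m: "m \<in> {1,2,3}"
  shows "gtrace n g p e (\<lambda>X Y. \<Sum>r\<in>{1,2,3}. eps r * g p (I r p (X p)) (I m p (Y p)) * F r)
    = - (4 * real n) * F m"
proof -
  have "gtrace n g p e (\<lambda>X Y. \<Sum>r\<in>{1,2,3}. eps r * g p (I r p (X p)) (I m p (Y p)) * F r)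
    = (\<Sum>r\<in>{1,2,3}. gtrace n g p e (\<lambda>X Y. (eps r * F r) * g p (I r p (X p)) (I m p (Y p))))"
    unfolding gtrace_sum[symmetric] by (simp only: mult_ac)
  also have "\<dots> = (\<Sum>r\<in>{1,2,3}. if r = m then - (4 * real n) * F m else 0)"
  proof (rule sum.cong[OF refl])
    fix r :: nat assume r: "r \<in> {1,2,3}"
    show "gtrace n g p e (\<lambda>X Y. (eps r * F r) * g p (I r p (X p)) (I m p (Y p)))
      = (if r = m then - (4 * real n) * F m else 0)"
      unfolding gtrace_cmult gtrace_I_I[OF p e r m] by (simp add: eps_def)
  qed
  also have "\<dots> = - (4 * real n) * F m" using m by (subst sum.delta) auto
  finally show ?thesis .
qed

end

section \<open>Connection forms on the Reeb fields\<close>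

text \<open>The two evaluations of the trace of the Lie derivative of
  \<open>\<omega>\<^sub>t\<close> along \<open>\<xi> t\<close>: by the connection and by the
  structure equation. Dividing by \<open>4 * n\<close> leaves a.\<close>

lemma nabla_diag_coeff:
  assumes p: "p \<in> U" and t: "t \<in> {1,2,3}" and m: "m \<in> {1,2,3}" and ne: "t \<noteq> m"
    and r: "r \<in> {1,2,3}" "r \<noteq> m"
    and nabla: "\<And>X. hsection p X \<Longrightarrow>
      nabla_end D p (\<xi> t p) (I t) X = a *\<^sub>R I m p (X p) + b *\<^sub>R I r p (X p)"
  shows "a = eps t * eps m * ext_deriv \<A> (\<eta> t) (\<xi> t) (\<xi> m) p"
proof -
  obtain e where e: "orthonormal_basis_at \<A> n H g p e"
    by (rule orthonormal_basis_exists[OF p])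
  note bs = basis_section[OF p e]
  have "gtrace n g p e (\<lambda>X Y. eps t * lie_omega t t X (\<lambda>q. I m q (Y q)) p)
    = gtrace n g p e (\<lambda>X Y. \<Sum>r\<in>{1,2,3}. eps r * g p (I r p (X p)) (I m p (Y p))
        * ext_deriv \<A> (\<eta> t) (\<xi> t) (\<xi> r) p)"
    by (rule gtrace_cong) (rule lie_omega_diag[OF p t bs I_hor[OF m p bs]])
  moreover have "gtrace n g p e (\<lambda>X Y. lie_omega t t X (\<lambda>q. I m q (Y q)) p)
      = - (4 * real n) * eps m * a"
    by (rule gtrace_lie_omega[OF p e t t m ne r]) (rule nabla)
  ultimately have "eps t * (- (4 * real n) * eps m * a)
      = - (4 * real n) * ext_deriv \<A> (\<eta> t) (\<xi> t) (\<xi> m) p"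
    by (simp only: gtrace_cmult gtrace_structure_rhs[OF p e m])
  then have "eps t * eps m * a = ext_deriv \<A> (\<eta> t) (\<xi> t) (\<xi> m) p"
    using n_pos by simp
  then show ?thesis by (auto simp: eps_def split: if_splits)
qed

lemma alpha_off_diagonal:
  assumes p: "p \<in> U" and c: "cyclic i j k"
  shows "\<alpha> j p (\<xi> i p) = - eps j * ext_deriv \<A> (\<eta> i) (\<xi> i) (\<xi> k) p"
    and "\<alpha> k p (\<xi> i p) = - ext_deriv \<A> (\<eta> i) (\<xi> i) (\<xi> j) p"
proof -
  note ix = cyclic_ix(1-3)[OF c] and ne = cyclic_ix(4-6)[OF c]
  note v = xi_tangent[OF p ix(1)]
  have "\<alpha> j p (\<xi> i p) = eps i * eps k * ext_deriv \<A> (\<eta> i) (\<xi> i) (\<xi> k) p"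
    by (rule nabla_diag_coeff[OF p ix(1,3) ne(3) ix(2) ne(2) nabla_I[OF p v _ c]])
  then show "\<alpha> j p (\<xi> i p) = - eps j * ext_deriv \<A> (\<eta> i) (\<xi> i) (\<xi> k) p"
    by (cases rule: eps_cases[OF c]) simp_all
  have "eps k * \<alpha> k p (\<xi> i p) = eps i * eps j * ext_deriv \<A> (\<eta> i) (\<xi> i) (\<xi> j) p"
  proof (rule nabla_diag_coeff[OF p ix(1,2) ne(1) ix(3)])
    show "k \<noteq> j" using ne by simp
    show "nabla_end D p (\<xi> i p) (I i) X
      = (eps k * \<alpha> k p (\<xi> i p)) *\<^sub>R I j p (X p) + \<alpha> j p (\<xi> i p) *\<^sub>R I k p (X p)"
      if "hsection p X" for X
      using nabla_I[OF p v that c] by (simp add: add.commute)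
  qed
  then show "\<alpha> k p (\<xi> i p) = - ext_deriv \<A> (\<eta> i) (\<xi> i) (\<xi> j) p"
    by (cases rule: eps_cases[OF c]) simp_all
qed

text \<open>Tracing \<open>lie_omega_cyclic\<close> against \<open>I k\<close> selects the
  \<open>I k\<close> coefficients of the derivative of \<open>I i\<close> along
  \<open>\<xi> j\<close> and of \<open>I j\<close> along \<open>\<xi> i\<close>; these are the two
  diagonal values.\<close>

lemma alpha_diagonal_relation:
  assumes p: "p \<in> U" and c: "cyclic i j k"
  shows "\<alpha> j p (\<xi> j p) + eps i * \<alpha> i p (\<xi> i p) =
    - eps j * (ext_deriv \<A> (\<eta> i) (\<xi> j) (\<xi> k) p - eps k * ext_deriv \<A> (\<eta> j) (\<xi> i) (\<xi> k) p)"
proof -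
  note ix = cyclic_ix(1-3)[OF c] and ne = cyclic_ix(4-6)[OF c]
  obtain e where e: "orthonormal_basis_at \<A> n H g p e"
    by (rule orthonormal_basis_exists[OF p])
  note bs = basis_section[OF p e]
  have 1: "nabla_end D p (\<xi> j p) (I i) X
      = \<alpha> j p (\<xi> j p) *\<^sub>R I k p (X p) + (eps k * \<alpha> k p (\<xi> j p)) *\<^sub>R I j p (X p)"
    if "hsection p X" for X
    by (rule nabla_I[OF p xi_tangent[OF p ix(2)] that c])
  have 2: "nabla_end D p (\<xi> i p) (I j) X
      = (eps i * \<alpha> i p (\<xi> i p)) *\<^sub>R I k p (X p) + \<alpha> k p (\<xi> i p) *\<^sub>R I i p (X p)"
    if "hsection p X" for X
    using nabla_I[OF p xi_tangent[OF p ix(1)] that cyclic_rotate[OF c]] by (simp add: add.commute)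
  let ?F = "\<lambda>r. ext_deriv \<A> (\<eta> i) (\<xi> j) (\<xi> r) p - eps k * ext_deriv \<A> (\<eta> j) (\<xi> i) (\<xi> r) p"
  have "gtrace n g p e (\<lambda>X Y. eps i * (lie_omega j i X (\<lambda>q. I k q (Y q)) p
        + lie_omega i j X (\<lambda>q. I k q (Y q)) p))
    = gtrace n g p e (\<lambda>X Y. \<Sum>r\<in>{1,2,3}. eps r * g p (I r p (X p)) (I k p (Y p)) * ?F r)"
    by (rule gtrace_cong) (rule lie_omega_cyclic[OF p c bs I_hor[OF ix(3) p bs]])
  moreover have "gtrace n g p e (\<lambda>X Y. lie_omega j i X (\<lambda>q. I k q (Y q)) p)
      = - (4 * real n) * eps k * \<alpha> j p (\<xi> j p)"
    by (rule gtrace_lie_omega[OF p e ix(2,1,3) ne(3) ix(2) ne(2)]) (rule 1)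
  moreover have "gtrace n g p e (\<lambda>X Y. lie_omega i j X (\<lambda>q. I k q (Y q)) p)
      = - (4 * real n) * eps k * (eps i * \<alpha> i p (\<xi> i p))"
    by (rule gtrace_lie_omega[OF p e ix(1,2,3) ne(2) ix(1) ne(3)]) (rule 2)
  ultimately have "eps i * (- (4 * real n) * eps k * \<alpha> j p (\<xi> j p)
      + - (4 * real n) * eps k * (eps i * \<alpha> i p (\<xi> i p))) = - (4 * real n) * ?F k"
    by (simp only: gtrace_cmult gtrace_add gtrace_structure_rhs[OF p e ix(3)])
  then have "(4 * real n) * (eps i * eps k * (\<alpha> j p (\<xi> j p) + eps i * \<alpha> i p (\<xi> i p)))
      = (4 * real n) * ?F k"
    by (simp add: algebra_simps)
  then have "eps i * eps k * (\<alpha> j p (\<xi> j p) + eps i * \<alpha> i p (\<xi> i p)) = ?F k"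
    using n_pos by (subst (asm) mult_cancel_left) simp
  then show ?thesis
    by (cases rule: eps_cases[OF c]) simp_all
qed

section \<open>The same 1-forms as coefficients of the derivatives of the Reeb fields\<close>

lemma gtrace_comb:
  assumes p: "p \<in> U" and e: "orthonormal_basis_at \<A> n H g p e" and m: "m \<in> {1,2,3}"
  shows "gtrace n g p e (\<lambda>X Y. g p (\<Sum>s\<in>{1,2,3}. c s *\<^sub>R I s p (X p)) (I m p (Y p)))
    = - eps m * (4 * real n) * c m"
proof -
  have "gtrace n g p e (\<lambda>X Y. g p (\<Sum>s\<in>{1,2,3}. c s *\<^sub>R I s p (X p)) (I m p (Y p)))
    = gtrace n g p e (\<lambda>X Y. \<Sum>s\<in>{1,2,3}. c s * g p (I s p (X p)) (I m p (Y p)))"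
  proof (rule gtrace_cong)
    fix a assume a: "a < 4 * n"
    let ?u = "e a p"
    have u: "?u \<in> H p" and w: "I m p ?u \<in> H p"
      using basis_H[OF p e a] I_H[OF m p] by auto
    have cI: "c s *\<^sub>R I s p ?u \<in> H p" if "s \<in> {1,2,3}" for s
      by (rule subspace_scale[OF subspace_H I_H[OF that p u]])
    have "g p (\<Sum>s\<in>{1,2,3}. c s *\<^sub>R I s p ?u) (I m p ?u)
        = g p (I m p ?u) (\<Sum>s\<in>{1,2,3}. c s *\<^sub>R I s p ?u)"
      by (rule g_sym[OF subspace_sum[OF subspace_H cI] w])
    also have "\<dots> = (\<Sum>s\<in>{1,2,3}. g p (I m p ?u) (c s *\<^sub>R I s p ?u))"
      by (rule lin_on_sum[OF g_lin[OF w] subspace_H _ cI]) simp_all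
    also have "\<dots> = (\<Sum>s\<in>{1,2,3}. c s * g p (I s p ?u) (I m p ?u))"
    proof (rule sum.cong[OF refl])
      fix s :: nat assume s: "s \<in> {1,2,3}"
      show "g p (I m p ?u) (c s *\<^sub>R I s p ?u) = c s * g p (I s p ?u) (I m p ?u)"
        by (simp only: g_scaleR(1)[OF w I_H[OF s p u]] g_sym[OF w I_H[OF s p u]])
    qed
    finally show "g p (\<Sum>s\<in>{1,2,3}. c s *\<^sub>R I s p ?u) (I m p ?u)
      = (\<Sum>s\<in>{1,2,3}. c s * g p (I s p ?u) (I m p ?u))" .
  qed
  also have "\<dots> = (\<Sum>s\<in>{1,2,3}. c s * gtrace n g p e (\<lambda>X Y. g p (I s p (X p)) (I m p (Y p))))"
    by (simp only: gtrace_sum gtrace_cmult)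
  also have "\<dots> = (\<Sum>s\<in>{1,2,3}. if s = m then - eps m * (4 * real n) * c m else 0)"
  proof (rule sum.cong[OF refl])
    fix s :: nat assume s: "s \<in> {1,2,3}"
    show "c s * gtrace n g p e (\<lambda>X Y. g p (I s p (X p)) (I m p (Y p)))
      = (if s = m then - eps m * (4 * real n) * c m else 0)"
      unfolding gtrace_I_I[OF p e s m] by simp
  qed
  also have "\<dots> = - eps m * (4 * real n) * c m" using m by (subst sum.delta) auto
  finally show ?thesis .
qed

lemma V_to_PQ_xi:
  assumes "q \<in> U" "i \<in> {1,2,3}"
  shows "V_to_PQ \<eta> I q (\<xi> i q) = I i q"
proof -
  have "V_to_PQ \<eta> I q (\<xi> i q) = (\<Sum>s\<in>{1,2,3}. if s = i then I i q else 0)"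
    unfolding V_to_PQ_def
  proof (rule sum.cong[OF refl])
    fix s :: nat assume "s \<in> {1,2,3}"
    from eta_xi[OF assms(1) this assms(2)]
    show "\<eta> s q (\<xi> i q) *\<^sub>R I s q = (if s = i then I i q else 0)" by simp
  qed
  also have "\<dots> = I i q" using assms(2) by (subst sum.delta) auto
  finally show ?thesis .
qed

text \<open>\<open>connection_forms\<close> prescribes the derivatives of the \<open>I i\<close>;
  parallelism of the map V to PQ carries the coefficients over to the \<open>\<xi> i\<close>.
  Tracing against \<open>I m\<close> separates them.\<close>

lemma eta_nabla_xi:
  assumes p: "p \<in> U" and v: "v \<in> tangent_space \<A> p" and c: "cyclic i j k"
  shows "\<eta> i p (D p v (\<xi> i)) = 0" "\<eta> j p (D p v (\<xi> i)) = eps k * \<alpha> k p v"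
    "\<eta> k p (D p v (\<xi> i)) = \<alpha> j p v"
proof -
  note ix = cyclic_ix(1-3)[OF c] and ne = cyclic_ix(4-6)[OF c]
  obtain e where e: "orthonormal_basis_at \<A> n H g p e"
    by (rule orthonormal_basis_exists[OF p])
  let ?w = "D p v (\<xi> i)"
  define f where "f s = (if s = k then \<alpha> j p v else if s = j then eps k * \<alpha> k p v else 0)" for s
  have eq: "(\<Sum>s\<in>{1,2,3}. \<eta> s p ?w *\<^sub>R I s p (X p)) = (\<Sum>s\<in>{1,2,3}. f s *\<^sub>R I s p (X p))"
    if X: "hsection p X" for X
  proof -
    \<comment> \<open>The image of \<open>\<xi> i\<close> is known to be \<open>I i\<close> only
      over U, so locality of the connection is invoked.\<close>
    have "\<forall>\<^sub>F q in nhds p. I i q (X q) = V_to_PQ \<eta> I q (\<xi> i q) (X q)"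
      using eventually_U[OF p] by eventually_elim (simp only: V_to_PQ_xi[OF _ ix(1)])
    from connection_cong[OF linear_connection v vfield_H[OF I_hor[OF ix(1) p X]] this]
    have "nabla_end D p v (\<lambda>q. V_to_PQ \<eta> I q (\<xi> i q)) X = nabla_end D p v (I i) X"
      by (simp only: nabla_end_def V_to_PQ_xi[OF p ix(1)])
    then have "V_to_PQ \<eta> I p ?w (X p) = nabla_end D p v (I i) X"
      using canonical(4)[OF p v section_xi[OF p ix(1)] X] by simp
    then have "V_to_PQ \<eta> I p ?w (X p)
        = \<alpha> j p v *\<^sub>R I k p (X p) + (eps k * \<alpha> k p v) *\<^sub>R I j p (X p)"
      using nabla_I[OF p v X c] by simp
    also have "\<dots> = (\<Sum>s\<in>{1,2,3}. f s *\<^sub>R I s p (X p))"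
      unfolding sum_cyclic[OF c] using ne by (simp add: f_def)
    finally show ?thesis
      by (simp only: V_to_PQ_def sum_fun_apply scaleR_fun_apply)
  qed
  have *: "\<eta> m p ?w = f m" if m: "m \<in> {1,2,3}" for m
  proof -
    have "gtrace n g p e (\<lambda>X Y. g p (\<Sum>s\<in>{1,2,3}. \<eta> s p ?w *\<^sub>R I s p (X p)) (I m p (Y p)))
      = gtrace n g p e (\<lambda>X Y. g p (\<Sum>s\<in>{1,2,3}. f s *\<^sub>R I s p (X p)) (I m p (Y p)))"
      by (rule gtrace_cong) (simp only: eq[OF basis_section[OF p e]])
    then show ?thesis
      unfolding gtrace_comb[OF p e m] using n_pos by (simp add: eps_def split: if_splits)
  qed
  show "\<eta> i p ?w = 0" "\<eta> j p ?w = eps k * \<alpha> k p v" "\<eta> k p ?w = \<alpha> j p v"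
    using *[OF ix(1)] *[OF ix(2)] *[OF ix(3)] ne by (auto simp: f_def)
qed

section \<open>Torsion on the Reeb fields\<close>

lemma ext_deriv_xi_antisym:
  assumes "p \<in> U" "r \<in> {1,2,3}" "s \<in> {1,2,3}" "t \<in> {1,2,3}"
  shows "ext_deriv \<A> (\<eta> t) (\<xi> s) (\<xi> r) p = - ext_deriv \<A> (\<eta> t) (\<xi> r) (\<xi> s) p"
  using ext_deriv_xi_xi[OF assms(1,2,3,4)] ext_deriv_xi_xi[OF assms(1,3,2,4)]
    bracket_antisym[of "\<xi> r" "\<xi> s" p]
    lin_on_minus[OF eta_lin[OF assms(4,1)]
      bracket_tangent[OF vfield_xi[OF assms(3,1)] vfield_xi[OF assms(2,1)]]] by simp

lemma torsion_xi_vert: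
  assumes p: "p \<in> U" and a: "a \<in> {1,2,3}" and b: "b \<in> {1,2,3}" and c: "c \<in> {1,2,3}"
  shows "gext g \<eta> \<xi> p (torsion \<A> D (\<xi> a) (\<xi> b) p) (\<xi> c p)
    = - eps c * (\<eta> c p (D p (\<xi> a p) (\<xi> b)) - \<eta> c p (D p (\<xi> b p) (\<xi> a))
        + ext_deriv \<A> (\<eta> c) (\<xi> a) (\<xi> b) p)"
proof -
  note va = vfield_xi[OF a p] and vb = vfield_xi[OF b p]
  note ta = D_tangent[OF xi_tangent[OF p a] vb] and tb = D_tangent[OF xi_tangent[OF p b] va]
  let ?t = "torsion \<A> D (\<xi> a) (\<xi> b) p"
  have "(\<Sum>s\<in>{1,2,3}. eps s * \<eta> s p ?t * \<eta> s p (\<xi> c p))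
      = (\<Sum>s\<in>{1,2,3}. if s = c then eps c * \<eta> c p ?t else 0)"
  proof (rule sum.cong[OF refl])
    fix s :: nat assume s: "s \<in> {1,2,3}"
    show "eps s * \<eta> s p ?t * \<eta> s p (\<xi> c p) = (if s = c then eps c * \<eta> c p ?t else 0)"
      using eta_xi[OF p s c] by simp
  qed
  also have "\<dots> = eps c * \<eta> c p ?t" using c by (subst sum.delta) auto
  finally have "gext g \<eta> \<xi> p ?t (\<xi> c p) = - eps c * \<eta> c p ?t"
    using g_zero(1)[OF hp_in_H[OF p torsion_tangent[OF va vb]]] hp_vert(1)[OF p xi_vert[OF c]]
    by (simp add: gext_def)
  moreover have "\<eta> c p ?t = \<eta> c p (D p (\<xi> a p) (\<xi> b)) - \<eta> c p (D p (\<xi> b p) (\<xi> a))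
      + ext_deriv \<A> (\<eta> c) (\<xi> a) (\<xi> b) p"
    using lin_on_diff[OF eta_lin[OF c p] subspace_diff[OF subspace_tangent_space ta tb]
        bracket_tangent[OF va vb]] lin_on_diff[OF eta_lin[OF c p] ta tb]
      ext_deriv_xi_xi[OF p b a c] by (simp add: torsion_def)
  ultimately show ?thesis by simp
qed

text \<open>Derivatives of Reeb fields are vertical, so only minus the horizontal part of the
  bracket remains on the left. On the right \<open>\<omega>\<^sub>i\<close> kills
  \<open>\<xi> s\<close>, leaving the bracket term; \<open>I_iso\<close> supplies the sign cancelled
  by \<open>eps i\<close>.\<close>

lemma torsion_xi_hor:
  assumes p: "p \<in> U" and s: "s \<in> {1,2,3}" and t: "t \<in> {1,2,3}" and i: "i \<in> {1,2,3}"
    and X: "hsection p X"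
  shows "gext g \<eta> \<xi> p (torsion \<A> D (\<xi> t) (\<xi> s) p) (X p)
    = - eps i * lie_deriv_form2 \<A> (\<xi> t) (omega g \<eta> I \<xi> i) (\<xi> s) (\<lambda>q. I i q (X q)) p"
proof -
  note vs = vfield_xi[OF s p] and vt = vfield_xi[OF t p]
  note ts = xi_tangent[OF p s] and tt = xi_tangent[OF p t]
  note Xp = section_at_mem[OF X] and IX = I_hor[OF i p X]
  note Dt = canonical(2)[OF p tt section_xi[OF p s]] and Ds = canonical(2)[OF p ts section_xi[OF p t]]
  let ?h = "hp p (bracket \<A> (\<xi> t) (\<xi> s) p)"
  have h: "?h \<in> H p" by (rule hp_in_H[OF p bracket_tangent[OF vt vs]])
  have "hp p (torsion \<A> D (\<xi> t) (\<xi> s) p) = - ?h"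
    using hp_lin[OF p subspace_diff[OF subspace_tangent_space hp_vert(2)[OF p Dt] hp_vert(2)[OF p Ds]]
        bracket_tangent[OF vt vs]] hp_lin[OF p hp_vert(2)[OF p Dt] hp_vert(2)[OF p Ds]]
      hp_vert(1)[OF p Dt] hp_vert(1)[OF p Ds] by (simp add: torsion_def)
  then have lhs: "gext g \<eta> \<xi> p (torsion \<A> D (\<xi> t) (\<xi> s) p) (X p) = - g p ?h (X p)"
    using g_minus(2)[OF Xp h] by (simp add: gext_def hp_H[OF p Xp] eta_H[OF _ p Xp])
  have zero: "omega g \<eta> I \<xi> i q (\<xi> s q) w = 0" if q: "q \<in> U" "w \<in> tangent_space \<A> q" for q w
    using g_zero(2)[OF hp_in_H[OF q]] hp_vert(1)[OF q(1) xi_vert[OF s]]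
      lin_on_zero[OF I_lin[OF i q(1)] H_zero] by (simp add: omega_def)
  have "\<forall>\<^sub>F q in nhds p. omega g \<eta> I \<xi> i q (\<xi> s q) (I i q (X q)) = 0"
    using eventually_U[OF p] section_at_eventually[OF IX]
    by eventually_elim (rule zero, assumption, rule vfield_tangent[OF vfield_H])
  from tangent_cong[OF tt this]
  have "\<xi> t p (\<lambda>q. omega g \<eta> I \<xi> i q (\<xi> s q) (I i q (X q))) = 0"
    using tangent_const[OF tt] by metis
  moreover have "omega g \<eta> I \<xi> i p (bracket \<A> (\<xi> t) (\<xi> s) p) (I i p (X p)) = - eps i * g p ?h (X p)"
    by (simp add: omega_def hp_H[OF p I_H[OF i p Xp]] I_iso[OF i p h Xp])
  ultimately show ?thesis
    unfolding lhs lie_deriv_form2_def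
    using zero[OF p bracket_tangent[OF vt vfield_H[OF IX]]] eps_sq[of i]
    by (simp add: mult.assoc[symmetric])
qed

lemma torsion_xi_cyclic:
  assumes p: "p \<in> U" and c: "cyclic i j k"
  shows "gext g \<eta> \<xi> p (torsion \<A> D (\<xi> i) (\<xi> j) p) (\<xi> k p)
    = - eps k * (eps i * \<alpha> i p (\<xi> i p) - \<alpha> j p (\<xi> j p) + ext_deriv \<A> (\<eta> k) (\<xi> i) (\<xi> j) p)"
  using torsion_xi_vert[OF p cyclic_ix(1,2,3)[OF c]]
    eta_nabla_xi(2)[OF p xi_tangent[OF p cyclic_ix(1)[OF c]] cyclic_rotate[OF c]]
    eta_nabla_xi(3)[OF p xi_tangent[OF p cyclic_ix(2)[OF c]] c] by simp

text \<open>By \<open>torsion_xi_cyclic\<close> both sides contain \<open>\<alpha> k\<close> on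
  \<open>\<xi> k\<close> with the same coefficient. The rest is
  \<open>alpha_diagonal_relation\<close>.\<close>

lemma torsion_xi_rotate:
  assumes p: "p \<in> U" and c: "cyclic i j k"
  shows "gext g \<eta> \<xi> p (torsion \<A> D (\<xi> j) (\<xi> k) p) (\<xi> i p)
    = gext g \<eta> \<xi> p (torsion \<A> D (\<xi> k) (\<xi> i) p) (\<xi> j p)"
  using alpha_diagonal_relation[OF p c]
    torsion_xi_cyclic[OF p cyclic_rotate[OF c]]
    torsion_xi_cyclic[OF p cyclic_rotate[OF cyclic_rotate[OF c]]]
    ext_deriv_xi_antisym[OF p cyclic_ix(3,1,2)[OF c]]
  by (cases rule: eps_cases[OF c]) simp_all

text \<open>The derivative of \<open>\<xi> i\<close> has no \<open>\<xi> i\<close> component, and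
  the remaining derivative term cancels the exterior derivative by
  \<open>alpha_off_diagonal\<close>.\<close>

lemma torsion_xi_zero:
  assumes p: "p \<in> U" and c: "cyclic i j k"
  shows "gext g \<eta> \<xi> p (torsion \<A> D (\<xi> i) (\<xi> j) p) (\<xi> i p) = 0"
    and "gext g \<eta> \<xi> p (torsion \<A> D (\<xi> i) (\<xi> k) p) (\<xi> i p) = 0"
proof -
  note ix = cyclic_ix(1-3)[OF c] and c' = cyclic_rotate[OF c] cyclic_rotate[OF cyclic_rotate[OF c]]
  note v = xi_tangent[OF p ix(1)] xi_tangent[OF p ix(2)] xi_tangent[OF p ix(3)]
  show "gext g \<eta> \<xi> p (torsion \<A> D (\<xi> i) (\<xi> j) p) (\<xi> i p) = 0"
    using torsion_xi_vert[OF p ix(1,2,1)] eta_nabla_xi(3)[OF p v(1) c'(1)]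
      eta_nabla_xi(1)[OF p v(2) c] alpha_off_diagonal(2)[OF p c] by simp
  show "gext g \<eta> \<xi> p (torsion \<A> D (\<xi> i) (\<xi> k) p) (\<xi> i p) = 0"
    using torsion_xi_vert[OF p ix(1,3,1)] eta_nabla_xi(2)[OF p v(1) c'(2)]
      eta_nabla_xi(1)[OF p v(3) c] alpha_off_diagonal(1)[OF p c] eps_sq[of j]
    by (simp add: mult.assoc[symmetric])
qed

section \<open>Traces of the Lie derivative of \<open>I k\<close> along
  \<open>\<xi> i\<close>\<close>

lemma lie_deriv_I_tor:
  assumes p: "p \<in> U" and s: "s \<in> {1,2,3}" and t: "t \<in> {1,2,3}" and X: "hsection p X"
  shows "lie_deriv_end \<A> \<eta> \<xi> (\<xi> s) (I t) X p
    = nabla_end D p (\<xi> s p) (I t) X - tor_H s (\<lambda>q. I t q (X q)) p + I t p (tor_H s X p)"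
  unfolding lie_deriv_end_def hp_bracket_xi[OF p s X] hp_bracket_xi[OF p s I_hor[OF t p X]]
    nabla_end_def
  by (simp add: lin_on_diff[OF I_lin[OF t p] canonical(1)[OF p xi_tangent[OF p s] X]
        tor_H_in_H[OF p s X]])

text \<open>The torsion terms again have trace 0 against \<open>I j\<close>, and the derivative of
  \<open>I k\<close> along \<open>\<xi> i\<close> has \<open>I j\<close> coefficient
  \<open>\<alpha> i p (\<xi> i p)\<close>.\<close>

lemma gtrace_lie_deriv_I:
  assumes p: "p \<in> U" and c: "cyclic i j k" and e: "orthonormal_basis_at \<A> n H g p e"
  shows "gtrace n g p e (\<lambda>X Y. g p (lie_deriv_end \<A> \<eta> \<xi> (\<xi> i) (I k) X p) (I j p (Y p)))
    = - (4 * real n) * eps j * \<alpha> i p (\<xi> i p)"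
proof -
  note ix = cyclic_ix(1-3)[OF c] and ne = cyclic_ix(4-6)[OF c]
  note bs = basis_section[OF p e] and bH = basis_H[OF p e]
  note v = xi_tangent[OF p ix(1)]
  have "gtrace n g p e (\<lambda>X Y. g p (lie_deriv_end \<A> \<eta> \<xi> (\<xi> i) (I k) X p) (I j p (Y p)))
    = gtrace n g p e (\<lambda>X Y.
        g p (\<alpha> i p (\<xi> i p) *\<^sub>R I j p (X p) + (eps j * \<alpha> j p (\<xi> i p)) *\<^sub>R I i p (X p)) (I j p (Y p))
        + (-1) * g p (tor_H i (\<lambda>q. I k q (X q)) p) (I j p (Y p))
        + (-1) * g p (tor_H i X p) (I k p (I j p (Y p))))"
  proof (rule gtrace_cong)
    fix a assume a: "a < 4 * n"
    note kH = I_hor[OF ix(3) p bs[OF a]] and u = bH[OF a] and w = I_H[OF ix(2) p bH[OF a]]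
    let ?N = "\<alpha> i p (\<xi> i p) *\<^sub>R I j p (e a p) + (eps j * \<alpha> j p (\<xi> i p)) *\<^sub>R I i p (e a p)"
    have N: "?N \<in> H p"
      by (intro subspace_add subspace_scale subspace_H I_H[OF ix(1) p] I_H[OF ix(2) p] u)
    note T = tor_H_in_H[OF p ix(1) kH] tor_H_in_H[OF p ix(1) bs[OF a]]
    have "lie_deriv_end \<A> \<eta> \<xi> (\<xi> i) (I k) (e a) p
        = ?N - tor_H i (\<lambda>q. I k q (e a q)) p + I k p (tor_H i (e a) p)"
      unfolding lie_deriv_I_tor[OF p ix(1,3) bs[OF a]]
      using nabla_I[OF p v bs[OF a] cyclic_rotate[OF cyclic_rotate[OF c]]] by simp
    then show "g p (lie_deriv_end \<A> \<eta> \<xi> (\<xi> i) (I k) (e a) p) (I j p (e a p))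
        = g p ?N (I j p (e a p))
        + (-1) * g p (tor_H i (\<lambda>q. I k q (e a q)) p) (I j p (e a p))
        + (-1) * g p (tor_H i (e a) p) (I k p (I j p (e a p)))"
      using g_add(2)[OF w subspace_diff[OF subspace_H N T(1)] I_H[OF ix(3) p T(2)]]
        g_diff(2)[OF w N T(1)] I_skew[OF ix(3) p T(2) w] by simp
  qed
  also have "\<dots> = - (4 * real n) * eps j * \<alpha> i p (\<xi> i p)"
    unfolding gtrace_add gtrace_cmult gtrace_lin_I[OF p e ix(1,2) ne(1)]
      gtrace_tor_I_I(1)[OF p e ix(1,3,2) ne(2)[symmetric]]
      gtrace_tor_I_I(2)[OF p e ix(1,2,3) ne(2)] by simp
  finally show ?thesis .
qed

text \<open>The preceding trace evaluated in the basis \<open>I j\<close> applied to e; the square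
  of \<open>I j\<close> in the second slot is \<open>eps j\<close>. No tensoriality of the Lie
  derivative enters.\<close>

lemma gtrace_lie_deriv_I':
  assumes p: "p \<in> U" and c: "cyclic i j k" and e: "orthonormal_basis_at \<A> n H g p e"
  shows "gtrace n g p e (\<lambda>X Y. g p (lie_deriv_end \<A> \<eta> \<xi> (\<xi> i) (I k) (\<lambda>q. I j q (X q)) p) (Y p))
    = (4 * real n) * eps j * \<alpha> i p (\<xi> i p)"
proof -
  note ix = cyclic_ix(1-3)[OF c]
  let ?L = "\<lambda>X. lie_deriv_end \<A> \<eta> \<xi> (\<xi> i) (I k) X p"
  have "- (4 * real n) * eps j * \<alpha> i p (\<xi> i p)
    = - eps j * gtrace n g p e (\<lambda>X Y. g p (?L (\<lambda>q. I j q (X q))) (I j p (I j p (Y p))))"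
    unfolding gtrace_lie_deriv_I[OF p c I_basis[OF p e ix(2)], symmetric]
    by (rule gtrace_I_basis[OF p e ix(2)])
  also have "gtrace n g p e (\<lambda>X Y. g p (?L (\<lambda>q. I j q (X q))) (I j p (I j p (Y p))))
    = gtrace n g p e (\<lambda>X Y. eps j * g p (?L (\<lambda>q. I j q (X q))) (Y p))"
  proof (rule gtrace_cong)
    fix a assume a: "a < 4 * n"
    note X = I_hor[OF ix(2) p basis_section[OF p e a]] and u = basis_H[OF p e a]
    have "?L (\<lambda>q. I j q (e a q)) \<in> H p"
      unfolding lie_deriv_end_def
      by (intro subspace_diff subspace_H I_H[OF ix(3) p] hp_in_H[OF p] bracket_tangent
          vfield_xi[OF ix(1) p] vfield_H X I_hor[OF ix(3) p X])
    then show "g p (?L (\<lambda>q. I j q (e a q))) (I j p (I j p (e a p)))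
        = eps j * g p (?L (\<lambda>q. I j q (e a q))) (e a p)"
      using g_scaleR(1)[OF _ u] I_sq[OF ix(2) p u] by simp
  qed
  finally show ?thesis
    using eps_sq[of j] unfolding gtrace_cmult by (simp add: mult.assoc[symmetric])
qed

end

theorem proposition3p8:
  fixes \<A> :: "('a::{t2_space,second_countable_topology}, 'e::euclidean_space) atlas"
    and n :: nat
    and H :: "'a \<Rightarrow> 'a tvec set"
    and G :: "'a form2 set"
    and PQ :: "'a \<Rightarrow> ('a tvec \<Rightarrow> 'a tvec) set"
    and g :: "'a form2"
    and U :: "'a set"
    and \<eta> :: "nat \<Rightarrow> 'a form1"
    and I :: "nat \<Rightarrow> 'a endo"
    and \<xi> :: "nat \<Rightarrow> 'a vfield"
    and D :: "'a conn"
    and \<alpha> :: "nat \<Rightarrow> 'a form1"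
    and T :: "'a vfield \<Rightarrow> 'a vfield \<Rightarrow> 'a vfield \<Rightarrow> 'a \<Rightarrow> real"
    and d :: "nat \<Rightarrow> 'a vfield \<Rightarrow> 'a vfield \<Rightarrow> 'a \<Rightarrow> real"
    and LI :: "nat \<Rightarrow> nat \<Rightarrow> 'a vfield \<Rightarrow> 'a vfield"
  assumes "pqc_manifold \<A> n H G PQ"
    and "g \<in> G"
    and "local_data \<A> H g PQ U \<eta> I"
    and "reeb_fields \<A> H U \<eta> \<xi>"
    and "canonical_pqc_connection \<A> n H g PQ D"
    and "connection_forms \<A> H U I D \<alpha>"
  defines "T \<equiv> (\<lambda>X Y Z p. gext g \<eta> \<xi> p (torsion \<A> D X Y p) (Z p))"
    and "d \<equiv> (\<lambda>s. ext_deriv \<A> (\<eta> s))"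
    and "LI \<equiv> (\<lambda>s t. lie_deriv_end \<A> \<eta> \<xi> (\<xi> s) (I t))"
  shows "\<exists>lam :: 'a \<Rightarrow> real. \<forall>p\<in>U. \<forall>i j k. cyclic i j k \<longrightarrow>
    (\<forall>s\<in>{1,2,3}. \<forall>t\<in>{1,2,3}. \<forall>X. section_at \<A> H p X \<longrightarrow>
       T (\<xi> t) (\<xi> s) X p =
         - eps i * lie_deriv_form2 \<A> (\<xi> t) (omega g \<eta> I \<xi> i) (\<xi> s) (\<lambda>q. I i q (X q)) p) \<and>
    T (\<xi> i) (\<xi> j) (\<xi> i) p = 0 \<and>
    T (\<xi> i) (\<xi> k) (\<xi> i) p = 0 \<and>
    T (\<xi> j) (\<xi> k) (\<xi> i) p = - lam p \<and>
    T (\<xi> k) (\<xi> i) (\<xi> j) p = - lam p \<and>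
    T (\<xi> i) (\<xi> j) (\<xi> k) p = - lam p \<and>
    (\<forall>e. orthonormal_basis_at \<A> n H g p e \<longrightarrow>
       lam p = 1 / (2 * real n) * gtrace n g p e (\<lambda>X Y. g p (LI i k X p) (I j p (Y p)))
         - eps i * d i (\<xi> j) (\<xi> k) p
         + eps j * d j (\<xi> k) (\<xi> i) p
         + eps k * d k (\<xi> i) (\<xi> j) p) \<and>
    \<alpha> j p (\<xi> i p) = - eps j * d i (\<xi> i) (\<xi> k) p \<and>
    \<alpha> k p (\<xi> i p) = - d i (\<xi> i) (\<xi> j) p \<and>
    \<alpha> i p (\<xi> i p) =
      1 / 2 * (eps k * d i (\<xi> j) (\<xi> k) p + d j (\<xi> k) (\<xi> i) p
        - eps i * d k (\<xi> i) (\<xi> j) p - eps j * lam p) \<and>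
    (\<forall>e. orthonormal_basis_at \<A> n H g p e \<longrightarrow>
       \<alpha> i p (\<xi> i p) =
         eps j / (4 * real n) * gtrace n g p e (\<lambda>X Y. g p (LI i k (\<lambda>q. I j q (X q)) p) (Y p)))"
proof -
  interpret pqc_connection \<A> n H G PQ g U \<eta> I \<xi> D \<alpha>
    using assms(1-6) by (intro pqc_connection.intro)
  \<comment> \<open>Defined through one torsion component, \<open>lam\<close> depends on neither a
    basis nor a cyclic triple. Rotation invariance gives the other components, and the trace formula
    follows at the end.\<close>
  define lam where "lam p = - T (\<xi> 1) (\<xi> 2) (\<xi> 3) p" for p
  have rot: "T (\<xi> j) (\<xi> k) (\<xi> i) p = T (\<xi> k) (\<xi> i) (\<xi> j) p" if "p \<in> U" "cyclic i j k" for p i j k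
    using torsion_xi_rotate[OF that] by (simp add: T_def)
  have lam: "T (\<xi> i) (\<xi> j) (\<xi> k) p = - lam p" if p: "p \<in> U" and c: "cyclic i j k" for p i j k
  proof -
    have "cyclic 1 2 3" "cyclic 2 3 1" "cyclic 3 1 2" by (simp_all add: cyclic_def)
    note rot[OF p this(1)] rot[OF p this(2)] rot[OF p this(3)]
    with c show ?thesis unfolding lam_def cyclic_def by fastforce
  qed
  have n0: "real n > 0" using n_pos by simp
  show ?thesis
  proof (rule exI[of _ lam], intro ballI allI impI conjI)
    fix p i j k assume p: "p \<in> U" and c: "cyclic i j k"
    note c' = cyclic_rotate[OF c] cyclic_rotate[OF cyclic_rotate[OF c]]
    note ix = cyclic_ix(1-3)[OF c]
    show "T (\<xi> j) (\<xi> k) (\<xi> i) p = - lam p" "T (\<xi> k) (\<xi> i) (\<xi> j) p = - lam p"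
      "T (\<xi> i) (\<xi> j) (\<xi> k) p = - lam p"
      using lam[OF p c'(1)] lam[OF p c'(2)] lam[OF p c] .
    show "T (\<xi> i) (\<xi> j) (\<xi> i) p = 0" "T (\<xi> i) (\<xi> k) (\<xi> i) p = 0"
      using torsion_xi_zero[OF p c] by (simp_all add: T_def)
    show "\<alpha> j p (\<xi> i p) = - eps j * d i (\<xi> i) (\<xi> k) p" "\<alpha> k p (\<xi> i p) = - d i (\<xi> i) (\<xi> j) p"
      using alpha_off_diagonal[OF p c] by (simp_all add: d_def)
    have lam_eq: "- lam p = - eps k * (eps i * \<alpha> i p (\<xi> i p) - \<alpha> j p (\<xi> j p) + d k (\<xi> i) (\<xi> j) p)"
      using lam[OF p c] torsion_xi_cyclic[OF p c] by (simp add: T_def d_def)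
    have rel: "\<alpha> j p (\<xi> j p) + eps i * \<alpha> i p (\<xi> i p) =
        - eps j * (d i (\<xi> j) (\<xi> k) p + eps k * d j (\<xi> k) (\<xi> i) p)"
      using alpha_diagonal_relation[OF p c] ext_deriv_xi_antisym[OF p ix(3,1,2)]
      by (simp add: d_def)
    show alpha: "\<alpha> i p (\<xi> i p) =
      1 / 2 * (eps k * d i (\<xi> j) (\<xi> k) p + d j (\<xi> k) (\<xi> i) p
        - eps i * d k (\<xi> i) (\<xi> j) p - eps j * lam p)"
      \<comment> \<open>Eliminating the value of \<open>\<alpha> j\<close> on \<open>\<xi> j\<close>
        from the two linear relations determines that of \<open>\<alpha> i\<close> on
        \<open>\<xi> i\<close>.\<close>
      using lam_eq rel by (cases rule: eps_cases[OF c]) simp_all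
    {
      fix s t :: nat and X assume "s \<in> {1,2,3}" "t \<in> {1,2,3}" "section_at \<A> H p X"
      from torsion_xi_hor[OF p this(1,2) ix(1) this(3)]
      show "T (\<xi> t) (\<xi> s) X p =
         - eps i * lie_deriv_form2 \<A> (\<xi> t) (omega g \<eta> I \<xi> i) (\<xi> s) (\<lambda>q. I i q (X q)) p"
        by (simp add: T_def)
    next
      fix e assume e: "orthonormal_basis_at \<A> n H g p e"
      \<comment> \<open>With this value of the trace, the formula for \<open>lam\<close> is the
        formula \<open>alpha\<close> solved for \<open>lam p\<close>.\<close>
      have "1 / (2 * real n) * gtrace n g p e (\<lambda>X Y. g p (LI i k X p) (I j p (Y p)))
          = - 2 * eps j * \<alpha> i p (\<xi> i p)"
        using gtrace_lie_deriv_I[OF p c e] n0 by (simp add: LI_def field_simps)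
      then show "lam p = 1 / (2 * real n) * gtrace n g p e (\<lambda>X Y. g p (LI i k X p) (I j p (Y p)))
         - eps i * d i (\<xi> j) (\<xi> k) p
         + eps j * d j (\<xi> k) (\<xi> i) p
         + eps k * d k (\<xi> i) (\<xi> j) p"
        using alpha by (cases rule: eps_cases[OF c]) simp_all
      show "\<alpha> i p (\<xi> i p) =
         eps j / (4 * real n) * gtrace n g p e (\<lambda>X Y. g p (LI i k (\<lambda>q. I j q (X q)) p) (Y p))"
        using gtrace_lie_deriv_I'[OF p c e] n0 eps_sq[of j] by (simp add: LI_def field_simps)
    }
  qed
qed

end
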